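(* Let $X\in\mathcal A$. Then: (1) There exists a consistent price process $Z$ such that $\mathbf E[Z_T\cdot X]=0$ if and only if $X$ is properly maximal. (2) Suppose that $X$ is properly maximal, let $Z$ be a consistent price process with $\mathbf E[Z_T\cdot X]=0$, and let $Q^Z$ be the collection of equivalent martingale measures for $Z$. Then the process $V^Z$ defined by $$V^Z_t=\mathbf E_{\mathbb Q}[Z_T\cdot X\mid\mathcal F_t],\qquad t=0,\ldots,T,$$ does not depend on the choice of $\mathbb Q\in Q^Z$, and it is a $Q^Z$-uniform martingale, i.e. a martingale under every $\mathbb Q\in Q^Z$.
   Context: $(\Omega,\mathcal F,(\mathcal F_t)_{t=0,\ldots,T},\mathbb P)$ is a filtered probability space, and there are $d$ assets. $m\mathcal F_t^+$ is the set of nonnegative real-valued $\mathcal F_t$-measurable functions. $L^0_d=L^0(\mathcal F,\mathbb R^d)$ carries the topology of convergence in probability (closures are taken in it), and $L^{0,+}_d$ is its subset of a.s. (componentwise) nonnegative elements. A finitely $\mathcal F_t$-generated convex cone is a set $\{\sum_{i=1}^n\alpha_i\Pi^i:\alpha_i\in m\mathcal F_t^+\}$ for some $\mathcal F_t$-measurable $\mathbb R^d$-valued $\Pi^1,\ldots,\Pi^n$ (the generators). Market: $\pi=(\pi_t)_{t=0,\ldots,T}$ is an adapted bid-ask process of $d\times d$ matrices with entries in $(0,\infty)$, $\pi^{i,i}_t=1$ and $\pi^{i_0,i_n}_t\le\pi^{i_0,i_1}_t\cdots\pi^{i_{n-1},i_n}_t$. With $e_1,\dots,e_d$ the canonical basis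 of $\mathbb R^d$, the time-$t$ trading cone is the finitely $\mathcal F_t$-generated convex cone with generators $e_j-\pi^{i,j}_te_i$ ($1\le i\ne j\le d$) and $-e_k$ ($1\le k\le d$). $\mathcal A$ is the cone of claims attainable from $0$, i.e. the sum of the trading cones at times $0,\ldots,T$. Standing assumptions: $\mathcal A$ is closed and arbitrage-free ($\mathcal A\cap L^{0,+}_d=\{0\}$), and $\mathcal A=K_0+\cdots+K_T$, where each $K_t$ is a finitely $\mathcal F_t$-generated convex cone contained in the time-$t$ trading cone, $K_T$ is the time-$T$ trading cone, and whenever $(\xi_0,\ldots,\xi_T)\in K_0\times\cdots\times K_T$ satisfies $\xi_0+\cdots+\xi_T=0$ a.s., all $\xi_t=0$. $K_t^*$ is the (random) polar cone of $K_t$: $K_t^*(\omega)=\{z\in\mathbb R^d: z\cdot\Pi^i_t(\omega)\le0\text{ for every generator }\Pi^i_t\text{ of }K_t\}$. A consistent price process is a $\mathbb P$-martingale $(Z_t)_{0\le t\le T}$ with $Z_t$ taking values in $K_t^*\setminus\{0\}$ a.s. for each $t$. For $X\in\mathcal A$, $[\mathcal A,X]=\{a-\lambda X:a\in\mathcal A,\lambda\ge0\}$; $X$ is properly maximal if the closure $\overline{[\mathcal A,X]}$ in $L^0_d$ is arbitrage-free, i.e. $\overline{[\mathcal A,X]}\cap L^{0,+}_d=\{0\}$. An equivalent martingale measure for $Z$ is a probability measure $\mathbb Q$ equivalent to $\mathbb P$ under which $Z$ is a martingale; the $\mathbb Q$-integrability of $Z_T\cdot X$ is implicit in writing $\mathbf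 E_{\mathbb Q}[Z_T\cdot X\mid\mathcal F_t]$. An equality $\mathbf E[Z_T\cdot X]=0$ includes integrability of $Z_T\cdot X$. *)

theory Defs
  imports "HOL-Probability.Probability"
begin

section \<open>The space of random vectors with convergence in probability\<close>

text \<open>
  Random vectors are represented by measurable functions, and a class of almost surely equal
  random vectors by all its members.  Accordingly every set of random vectors below is closed
  under almost sure equality, and the space carries a (non-Hausdorff) topology whose Kolmogorov
  quotient is the usual space of equivalence classes.
\<close>

definition L0_open :: "'a measure \<Rightarrow> ('a \<Rightarrow> 'b::euclidean_space) set \<Rightarrow> bool" where
  "L0_open M U \<longleftrightarrow> U \<subseteq> borel_measurable M \<and>
     (\<forall>f\<in>U. \<exists>e>0. \<forall>g\<in>borel_measurable M.
        measure M {\<omega>\<in>space M. dist (f \<omega>) (g \<omega>) > e} < e \<longrightarrow> g \<in> U)"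

definition L0_topology :: "'a measure \<Rightarrow> ('a \<Rightarrow> 'b::euclidean_space) topology" where
  "L0_topology M = topology (L0_open M)"

definition L0_zero :: "'a measure \<Rightarrow> ('a \<Rightarrow> 'b::euclidean_space) set" where
  "L0_zero M = {f \<in> borel_measurable M. AE \<omega> in M. f \<omega> = 0}"

definition L0_nonneg :: "'a measure \<Rightarrow> ('a \<Rightarrow> real ^ 'd) set" where
  "L0_nonneg M = {f \<in> borel_measurable M. AE \<omega> in M. \<forall>i. f \<omega> $ i \<ge> 0}"

definition arbitrage_free :: "'a measure \<Rightarrow> ('a \<Rightarrow> real ^ 'd) set \<Rightarrow> bool" where
  "arbitrage_free M S \<longleftrightarrow> S \<inter> L0_nonneg M = L0_zero M"

lemma (in prob_space) dist_prob_mono: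
  fixes f g :: "'a \<Rightarrow> 'b::euclidean_space"
  assumes "f \<in> borel_measurable M" "g \<in> borel_measurable M" "d \<le> e"
  shows "prob {\<omega>\<in>space M. dist (f \<omega>) (g \<omega>) > e} \<le> prob {\<omega>\<in>space M. dist (f \<omega>) (g \<omega>) > d}"
  using assms by (intro finite_measure_mono) (auto, measurable)

lemma (in prob_space) dist_prob_triangle:
  fixes f g h :: "'a \<Rightarrow> 'b::euclidean_space"
  assumes [measurable]: "f \<in> borel_measurable M" "g \<in> borel_measurable M" "h \<in> borel_measurable M"
  shows "prob {\<omega>\<in>space M. dist (f \<omega>) (h \<omega>) > d + e}
       \<le> prob {\<omega>\<in>space M. dist (f \<omega>) (g \<omega>) > d} + prob {\<omega>\<in>space M. dist (g \<omega>) (h \<omega>) > e}"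
proof -
  let ?A = "{\<omega>\<in>space M. dist (f \<omega>) (g \<omega>) > d}" and ?B = "{\<omega>\<in>space M. dist (g \<omega>) (h \<omega>) > e}"
  have "prob {\<omega>\<in>space M. dist (f \<omega>) (h \<omega>) > d + e} \<le> prob (?A \<union> ?B)"
  proof (intro finite_measure_mono subsetI)
    fix \<omega> assume "\<omega> \<in> {\<omega>\<in>space M. dist (f \<omega>) (h \<omega>) > d + e}"
    then show "\<omega> \<in> ?A \<union> ?B"
      using dist_triangle[of "f \<omega>" "h \<omega>" "g \<omega>"] by auto
  qed measurable
  also have "\<dots> \<le> prob ?A + prob ?B"
    by (intro measure_Un_le) measurable
  finally show ?thesis .
qed

lemma (in prob_space) openin_L0_topology:
  "openin (L0_topology M) = (L0_open M :: ('a \<Rightarrow> 'b::euclidean_space) set \<Rightarrow> bool)"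
proof -
  have int: "L0_open M (S \<inter> T)"
    if S: "L0_open M S" and T: "L0_open M T" for S T :: "('a \<Rightarrow> 'b) set"
    unfolding L0_open_def
  proof (intro conjI ballI)
    show "S \<inter> T \<subseteq> borel_measurable M" using S by (auto simp: L0_open_def)
    fix f assume f: "f \<in> S \<inter> T"
    have fm: "f \<in> borel_measurable M" using f S unfolding L0_open_def by blast
    from S f obtain d where d: "d > 0"
      "\<forall>g\<in>borel_measurable M. prob {\<omega>\<in>space M. dist (f \<omega>) (g \<omega>) > d} < d \<longrightarrow> g \<in> S"
      unfolding L0_open_def by blast
    from T f obtain e where e: "e > 0"
      "\<forall>g\<in>borel_measurable M. prob {\<omega>\<in>space M. dist (f \<omega>) (g \<omega>) > e} < e \<longrightarrow> g \<in> T"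
      unfolding L0_open_def by blast
    show "\<exists>e>0. \<forall>g\<in>borel_measurable M.
        prob {\<omega>\<in>space M. dist (f \<omega>) (g \<omega>) > e} < e \<longrightarrow> g \<in> S \<inter> T"
    proof (intro exI[of _ "min d e"] conjI ballI impI)
      show "min d e > 0" using d e by simp
      fix g assume g: "g \<in> borel_measurable M"
        and l: "prob {\<omega>\<in>space M. dist (f \<omega>) (g \<omega>) > min d e} < min d e"
      have "prob {\<omega>\<in>space M. dist (f \<omega>) (g \<omega>) > d} < d"
        using dist_prob_mono[OF fm g min.cobounded1[of d e]] l by linarith
      moreover have "prob {\<omega>\<in>space M. dist (f \<omega>) (g \<omega>) > e} < e"
        using dist_prob_mono[OF fm g min.cobounded2[of d e]] l by linarith
      ultimately show "g \<in> S \<inter> T" using d e g by blast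
    qed
  qed
  have un: "L0_open M (\<Union>K)" if K: "\<forall>S\<in>K. L0_open M S" for K :: "('a \<Rightarrow> 'b) set set"
    unfolding L0_open_def
  proof (intro conjI ballI)
    show "\<Union>K \<subseteq> borel_measurable M" using K unfolding L0_open_def by blast
    fix f assume "f \<in> \<Union>K"
    then obtain S where S: "S \<in> K" "f \<in> S" by blast
    then obtain e where "e > 0"
      "\<forall>g\<in>borel_measurable M. prob {\<omega>\<in>space M. dist (f \<omega>) (g \<omega>) > e} < e \<longrightarrow> g \<in> S"
      using K unfolding L0_open_def by blast
    with S show "\<exists>e>0. \<forall>g\<in>borel_measurable M.
        prob {\<omega>\<in>space M. dist (f \<omega>) (g \<omega>) > e} < e \<longrightarrow> g \<in> \<Union>K" by blast
  qed
  have "istopology (L0_open M :: ('a \<Rightarrow> 'b) set \<Rightarrow> bool)"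
    unfolding istopology_def using int un by blast
  then show ?thesis
    unfolding L0_topology_def by (rule topology_inverse')
qed

lemma (in prob_space) topspace_L0_topology:
  "topspace (L0_topology M) = (borel_measurable M :: ('a \<Rightarrow> 'b::euclidean_space) set)"
proof -
  have "openin (L0_topology M) (borel_measurable M :: ('a \<Rightarrow> 'b) set)"
    unfolding openin_L0_topology L0_open_def by (auto intro: exI[of _ 1])
  moreover have "topspace (L0_topology M) \<subseteq> (borel_measurable M :: ('a \<Rightarrow> 'b) set)"
    unfolding topspace_def openin_L0_topology L0_open_def by blast
  ultimately show ?thesis
    using openin_subset by blast
qed

text \<open>The topology is the one whose convergence is convergence in probability.\<close>

lemma (in prob_space) limitin_L0_topology:
  fixes f :: "nat \<Rightarrow> 'a \<Rightarrow> 'b::euclidean_space"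
  assumes f: "\<And>n. f n \<in> borel_measurable M" and l: "l \<in> borel_measurable M"
  shows "limitin (L0_topology M) f l sequentially \<longleftrightarrow>
    (\<forall>e>0. (\<lambda>n. prob {\<omega>\<in>space M. dist (f n \<omega>) (l \<omega>) > e}) \<longlonglongrightarrow> 0)"
proof
  assume lim: "limitin (L0_topology M) f l sequentially"
  show "\<forall>e>0. (\<lambda>n. prob {\<omega>\<in>space M. dist (f n \<omega>) (l \<omega>) > e}) \<longlonglongrightarrow> 0"
  proof (intro allI impI, rule order_tendstoI)
    fix e a :: real assume e: "e > 0" and a: "0 < a"
    define d where "d = min e a"
    have d: "d > 0" "d \<le> e" "d \<le> a" using e a by (auto simp: d_def)
    define U where "U = {g \<in> borel_measurable M.
      \<exists>r\<ge>0. r < d \<and> prob {\<omega>\<in>space M. dist (l \<omega>) (g \<omega>) > r} < d - r}"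
    have "L0_open M U"
      unfolding L0_open_def
    proof (intro conjI ballI)
      show "U \<subseteq> borel_measurable M" by (auto simp: U_def)
      fix g assume "g \<in> U"
      then obtain r where g: "g \<in> borel_measurable M" and r: "0 \<le> r" "r < d"
        "prob {\<omega>\<in>space M. dist (l \<omega>) (g \<omega>) > r} < d - r"
        by (auto simp: U_def)
      define s where "s = (d - r - prob {\<omega>\<in>space M. dist (l \<omega>) (g \<omega>) > r}) / 2"
      have s: "s > 0" using r by (simp add: s_def)
      show "\<exists>e>0. \<forall>h\<in>borel_measurable M.
          prob {\<omega>\<in>space M. dist (g \<omega>) (h \<omega>) > e} < e \<longrightarrow> h \<in> U"
      proof (intro exI[of _ s] conjI ballI impI s)
        fix h assume h: "h \<in> borel_measurable M"
          and p: "prob {\<omega>\<in>space M. dist (g \<omega>) (h \<omega>) > s} < s"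
        have lt: "prob {\<omega>\<in>space M. dist (l \<omega>) (h \<omega>) > r + s} < d - (r + s)"
          using dist_prob_triangle[OF l g h, of r s] p by (simp add: s_def field_simps)
        moreover have "r + s < d"
          using lt measure_nonneg[of M "{\<omega>\<in>space M. dist (l \<omega>) (h \<omega>) > r + s}"] by linarith
        moreover have "0 \<le> r + s" using r s by simp
        ultimately show "h \<in> U" using h unfolding U_def by blast
      qed
    qed
    moreover have "l \<in> U" using l d by (auto simp: U_def intro!: exI[of _ 0])
    ultimately have "eventually (\<lambda>n. f n \<in> U) sequentially"
      using lim unfolding limitin_def openin_L0_topology by blast
    then show "eventually (\<lambda>n. prob {\<omega>\<in>space M. dist (f n \<omega>) (l \<omega>) > e} < a) sequentially"
    proof eventually_elim
      case (elim n)
      then obtain r where r: "0 \<le> r" "r < d" "prob {\<omega>\<in>space M. dist (l \<omega>) (f n \<omega>) > r} < d - r"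
        by (auto simp: U_def)
      have "prob {\<omega>\<in>space M. dist (l \<omega>) (f n \<omega>) > e} \<le> prob {\<omega>\<in>space M. dist (l \<omega>) (f n \<omega>) > r}"
        using r d by (intro dist_prob_mono[OF l f]) simp
      with r d show ?case by (simp add: dist_commute)
    qed
  next
    fix e a :: real assume "a < 0"
    then show "eventually (\<lambda>n. a < prob {\<omega>\<in>space M. dist (f n \<omega>) (l \<omega>) > e}) sequentially"
      by (intro always_eventually allI less_le_trans[OF _ measure_nonneg])
  qed
next
  assume conv: "\<forall>e>0. (\<lambda>n. prob {\<omega>\<in>space M. dist (f n \<omega>) (l \<omega>) > e}) \<longlonglongrightarrow> 0"
  show "limitin (L0_topology M) f l sequentially"
    unfolding limitin_def topspace_L0_topology openin_L0_topology
  proof (intro conjI allI impI l)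
    fix U assume U: "L0_open M U \<and> l \<in> U"
    then obtain e where e: "e > 0"
      "\<forall>g\<in>borel_measurable M. prob {\<omega>\<in>space M. dist (l \<omega>) (g \<omega>) > e} < e \<longrightarrow> g \<in> U"
      unfolding L0_open_def by blast
    have "eventually (\<lambda>n. prob {\<omega>\<in>space M. dist (f n \<omega>) (l \<omega>) > e} < e) sequentially"
      using conv e(1) by (auto intro: order_tendstoD)
    then show "eventually (\<lambda>n. f n \<in> U) sequentially"
    proof eventually_elim
      case (elim n)
      then have "prob {\<omega>\<in>space M. dist (l \<omega>) (f n \<omega>) > e} < e" by (simp add: dist_commute)
      then show ?case using e(2) f[of n] by blast
    qed
  qed
qed


section \<open>Cones of random vectors\<close>

text \<open>
  \<open>gen_cone M N G\<close> is the convex cone generated by a finite set \<open>G\<close> of \<open>N\<close>-measurable vectors,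
  with coefficients that are nonnegative and measurable for the sub-sigma-algebra \<open>N\<close>.
\<close>

definition gen_cone ::
    "'a measure \<Rightarrow> 'a measure \<Rightarrow> ('a \<Rightarrow> real ^ 'd) set \<Rightarrow> ('a \<Rightarrow> real ^ 'd) set" where
  "gen_cone M N G = {\<xi> \<in> borel_measurable M. \<exists>\<alpha>.
     (\<forall>g\<in>G. \<alpha> g \<in> borel_measurable N \<and> (\<forall>\<omega>\<in>space N. 0 \<le> (\<alpha> g \<omega> :: real))) \<and>
     (AE \<omega> in M. \<xi> \<omega> = (\<Sum>g\<in>G. \<alpha> g \<omega> *\<^sub>R g \<omega>))}"

text \<open>The Minkowski sum \<open>K 0 + \<dots> + K T\<close>.\<close>

definition cone_sum ::
    "'a measure \<Rightarrow> nat \<Rightarrow> (nat \<Rightarrow> ('a \<Rightarrow> real ^ 'd) set) \<Rightarrow> ('a \<Rightarrow> real ^ 'd) set" where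
  "cone_sum M T K = {f \<in> borel_measurable M. \<exists>\<xi>.
     (\<forall>t\<le>T. \<xi> t \<in> K t) \<and> (AE \<omega> in M. f \<omega> = (\<Sum>t\<le>T. \<xi> t \<omega>))}"

text \<open>The set written \<open>[A, X]\<close> in the literature.\<close>

definition cone_adjoin_neg ::
    "('a \<Rightarrow> real ^ 'd) set \<Rightarrow> ('a \<Rightarrow> real ^ 'd) \<Rightarrow> ('a \<Rightarrow> real ^ 'd) set" where
  "cone_adjoin_neg A X = {(\<lambda>\<omega>. a \<omega> - c *\<^sub>R X \<omega>) | a c. a \<in> A \<and> (0::real) \<le> c}"

definition properly_maximal ::
    "'a measure \<Rightarrow> ('a \<Rightarrow> real ^ 'd) set \<Rightarrow> ('a \<Rightarrow> real ^ 'd) \<Rightarrow> bool" where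
  "properly_maximal M A X \<longleftrightarrow>
     arbitrage_free M (L0_topology M closure_of cone_adjoin_neg A X)"

definition polar_cone :: "('a \<Rightarrow> real ^ 'd) set \<Rightarrow> 'a \<Rightarrow> (real ^ 'd) set" where
  "polar_cone G \<omega> = {z. \<forall>g\<in>G. z \<bullet> g \<omega> \<le> 0}"


section \<open>The market\<close>

definition discrete_filtration :: "'a measure \<Rightarrow> (nat \<Rightarrow> 'a measure) \<Rightarrow> nat \<Rightarrow> bool" where
  "discrete_filtration M F T \<longleftrightarrow>
     (\<forall>t\<le>T. subalgebra M (F t)) \<and> (\<forall>s t. s \<le> t \<and> t \<le> T \<longrightarrow> subalgebra (F t) (F s))"

definition bid_ask_matrix :: "real ^ 'd ^ 'd \<Rightarrow> bool" where
  "bid_ask_matrix p \<longleftrightarrow>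
     (\<forall>i j. 0 < p $ i $ j) \<and> (\<forall>i. p $ i $ i = 1) \<and>
     (\<forall>(i :: nat \<Rightarrow> 'd) n. 1 \<le> n \<longrightarrow> p $ i 0 $ i n \<le> (\<Prod>k<n. p $ i k $ i (Suc k)))"

definition bid_ask_process ::
    "'a measure \<Rightarrow> (nat \<Rightarrow> 'a measure) \<Rightarrow> nat \<Rightarrow> (nat \<Rightarrow> 'a \<Rightarrow> real ^ 'd ^ 'd) \<Rightarrow> bool" where
  "bid_ask_process M F T \<pi> \<longleftrightarrow>
     (\<forall>t\<le>T. \<pi> t \<in> borel_measurable (F t) \<and> (AE \<omega> in M. bid_ask_matrix (\<pi> t \<omega>)))"

definition trading_generators :: "('a \<Rightarrow> real ^ 'd ^ 'd) \<Rightarrow> ('a \<Rightarrow> real ^ 'd) set" where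
  "trading_generators p =
     {(\<lambda>\<omega>. axis j 1 - p \<omega> $ i $ j *\<^sub>R axis i 1) | i j. i \<noteq> j} \<union> {(\<lambda>\<omega>. - axis k 1) | k. True}"

definition trading_cone ::
    "'a measure \<Rightarrow> (nat \<Rightarrow> 'a measure) \<Rightarrow> (nat \<Rightarrow> 'a \<Rightarrow> real ^ 'd ^ 'd) \<Rightarrow> nat \<Rightarrow>
     ('a \<Rightarrow> real ^ 'd) set" where
  "trading_cone M F \<pi> t = gen_cone M (F t) (trading_generators (\<pi> t))"

definition attainable ::
    "'a measure \<Rightarrow> (nat \<Rightarrow> 'a measure) \<Rightarrow> nat \<Rightarrow> (nat \<Rightarrow> 'a \<Rightarrow> real ^ 'd ^ 'd) \<Rightarrow>
     ('a \<Rightarrow> real ^ 'd) set" where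
  "attainable M F T \<pi> = cone_sum M T (trading_cone M F \<pi>)"

text \<open>
  \<open>G t\<close> is the chosen finite set of generators of the cone \<open>K\<^sub>t\<close>; the polar of \<open>K\<^sub>t\<close> is
  \<open>polar_cone (G t)\<close>, which up to null sets does not depend on that choice.
\<close>

definition reduced_generators ::
    "'a measure \<Rightarrow> (nat \<Rightarrow> 'a measure) \<Rightarrow> nat \<Rightarrow> (nat \<Rightarrow> 'a \<Rightarrow> real ^ 'd ^ 'd) \<Rightarrow>
     (nat \<Rightarrow> ('a \<Rightarrow> real ^ 'd) set) \<Rightarrow> bool" where
  "reduced_generators M F T \<pi> G \<longleftrightarrow>
     (\<forall>t\<le>T. finite (G t) \<and> G t \<subseteq> borel_measurable (F t) \<and>
        gen_cone M (F t) (G t) \<subseteq> trading_cone M F \<pi> t) \<and>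
     gen_cone M (F T) (G T) = trading_cone M F \<pi> T \<and>
     attainable M F T \<pi> = cone_sum M T (\<lambda>t. gen_cone M (F t) (G t)) \<and>
     (\<forall>\<xi>. (\<forall>t\<le>T. \<xi> t \<in> gen_cone M (F t) (G t)) \<and> (AE \<omega> in M. (\<Sum>t\<le>T. \<xi> t \<omega>) = 0) \<longrightarrow>
        (\<forall>t\<le>T. \<xi> t \<in> L0_zero M))"


section \<open>Martingales and price processes\<close>

text \<open>The conditional expectation of a vector is taken coordinatewise.\<close>

definition is_martingale ::
    "'a measure \<Rightarrow> (nat \<Rightarrow> 'a measure) \<Rightarrow> nat \<Rightarrow> (nat \<Rightarrow> 'a \<Rightarrow> 'b::euclidean_space) \<Rightarrow> bool" where
  "is_martingale M F T Z \<longleftrightarrow>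
     (\<forall>t\<le>T. Z t \<in> borel_measurable (F t) \<and> integrable M (Z t)) \<and>
     (\<forall>s t. s \<le> t \<and> t \<le> T \<longrightarrow>
        (\<forall>b\<in>Basis. AE \<omega> in M. real_cond_exp M (F s) (\<lambda>\<omega>. Z t \<omega> \<bullet> b) \<omega> = Z s \<omega> \<bullet> b))"

definition consistent_price_process ::
    "'a measure \<Rightarrow> (nat \<Rightarrow> 'a measure) \<Rightarrow> nat \<Rightarrow> (nat \<Rightarrow> ('a \<Rightarrow> real ^ 'd) set) \<Rightarrow>
     (nat \<Rightarrow> 'a \<Rightarrow> real ^ 'd) \<Rightarrow> bool" where
  "consistent_price_process M F T G Z \<longleftrightarrow>
     is_martingale M F T Z \<and> (\<forall>t\<le>T. AE \<omega> in M. Z t \<omega> \<in> polar_cone (G t) \<omega> - {0})"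

definition equivalent_martingale_measures ::
    "'a measure \<Rightarrow> (nat \<Rightarrow> 'a measure) \<Rightarrow> nat \<Rightarrow> (nat \<Rightarrow> 'a \<Rightarrow> 'b::euclidean_space) \<Rightarrow>
     'a measure set" where
  "equivalent_martingale_measures M F T Z =
     {Q. prob_space Q \<and> sets Q = sets M \<and> absolutely_continuous M Q \<and> absolutely_continuous Q M \<and>
         is_martingale Q F T Z}"

definition value_process ::
    "'a measure \<Rightarrow> (nat \<Rightarrow> 'a measure) \<Rightarrow> ('a \<Rightarrow> real) \<Rightarrow> nat \<Rightarrow> 'a \<Rightarrow> real" where
  "value_process Q F C t = real_cond_exp Q (F t) C"

text \<open>
  Equivalent martingale measures for \<open>Z\<close> under which the claim \<open>C\<close> is integrable, that is, those
  for which the conditional expectations of \<open>C\<close> make sense.  An equivalent change of measure can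
  destroy integrability of an unbounded claim, so the second condition is not automatic.
\<close>

definition pricing_measures ::
    "'a measure \<Rightarrow> (nat \<Rightarrow> 'a measure) \<Rightarrow> nat \<Rightarrow> (nat \<Rightarrow> 'a \<Rightarrow> 'b::euclidean_space) \<Rightarrow>
     ('a \<Rightarrow> real) \<Rightarrow> 'a measure set" where
  "pricing_measures M F T Z C = {Q \<in> equivalent_martingale_measures M F T Z. integrable Q C}"

end

theory Submission
  imports Defs
begin

text \<open>
  Fix a consistent price process \<open>Z\<close>.  Abel summation writes \<open>Z\<^sub>T \<bullet> (\<xi>\<^sub>0 + \<dots> + \<xi>\<^sub>T)\<close> as
  \<open>\<Sum>\<^sub>t Z\<^sub>t \<bullet> \<xi>\<^sub>t\<close>, whose terms are nonpositive for \<open>\<xi>\<^sub>t \<in> K\<^sub>t\<close>, plus a discrete stochastic integral of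
  \<open>Z\<close>.  A stochastic integral bounded below by an integrable variable is a true martingale, so
  \<open>E[Z\<^sub>T \<bullet> X] = 0\<close> forces \<open>Z\<^sub>t \<bullet> \<xi>\<^sub>t = 0\<close> for all \<open>t\<close> in a decomposition of \<open>X\<close>; then \<open>Z\<^sub>T \<bullet> X\<close> is a
  stochastic integral, the same one under every pricing measure, which is part (2).

  For the same reason \<open>Z\<^sub>T \<bullet> h\<close> is dominated by a stochastic integral for each \<open>h \<in> [A, X]\<close>.  If the
  negative parts of a sequence of stochastic integrals tend to 0 in probability, then so do the
  integrals themselves.  Hence a nonnegative limit \<open>f\<close> of such \<open>h\<close> has \<open>Z\<^sub>T \<bullet> f = 0\<close>, and \<open>f = 0\<close>
  because the trading generators make every nonzero element of the polar of \<open>K\<^sub>T\<close> positive.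

  Conversely, a Kreps--Yan argument applies to the closure of \<open>[A, X]\<close>.  Rescaled by a positive
  variable which makes \<open>X\<close> and all generators bounded, the closure meets \<open>L\<^sup>2\<close> in a closed convex
  cone, and orthogonal projection replaces the Hahn--Banach theorem.
\<close>

section \<open>Regularised inverses of positive semidefinite matrices\<close>

text \<open>The integrands that occur are arbitrary adapted vectors, without bounds or moments, so a
  stochastic integral has no expectation a priori and only one-sided information is available. Two
  one-step devices cope with this. Localisation to past events on which the integrand is bounded
  yields integrability. It yields no uniformity along a sequence of integrands; for that, a single
  integrable R has to dominate every v \<bullet> D with conditional second moment at most 1. Up to
  an integrability weight, the natural R is the supremum over v of v \<bullet> D divided by its
  conditional standard deviation, that is, the norm of D with respect to the inverse of its
  conditional Gram matrix. The matrix section serves this supremum. In the converse direction,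
  separation runs on the probability space restricted to \<open>F T\<close>, since it is the
  \<open>F T\<close>-measurable nonpositive claims that are shown to be attainable. The weight that
  bounds the claims is afterwards moved onto the separating functional, and the conditional
  expectations of the product form the price process.\<close>

definition ridge :: "real ^ 'd ^ 'd \<Rightarrow> real \<Rightarrow> real ^ 'd ^ 'd" where
  "ridge C e = C + e *\<^sub>R mat 1"

text \<open>The inverse is written by Cramer's rule so that it depends measurably on the matrix.\<close>

definition ridge_inv :: "real ^ 'd ^ 'd \<Rightarrow> real \<Rightarrow> real ^ 'd ^ 'd" where
  "ridge_inv C e = (\<chi> i j. det (\<chi> a c. if c = i then axis j 1 $ a else ridge C e $ a $ c) / det (ridge C e))"

definition psd :: "real ^ 'd ^ 'd \<Rightarrow> bool" where
  "psd C \<longleftrightarrow> (\<forall>i j. C $ i $ j = C $ j $ i) \<and> (\<forall>x. 0 \<le> x \<bullet> (C *v x))"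

lemma ridge_mult: "ridge C e *v x = C *v x + e *\<^sub>R x"
  by (simp add: ridge_def matrix_vector_mult_add_rdistrib scaleR_matrix_vector_assoc[symmetric])

lemma sym_matrix_inner:
  assumes "\<forall>i j. C $ i $ j = (C :: real ^ 'd ^ 'd) $ j $ i"
  shows "x \<bullet> (C *v y) = y \<bullet> (C *v x)"
proof -
  have "transpose C = C" using assms by (simp add: transpose_def vec_eq_iff)
  then show ?thesis by (metis dot_lmul_matrix inner_commute vector_transpose_matrix)
qed

lemma ridge_quadratic:
  assumes "psd C" shows "x \<bullet> (ridge C e *v x) \<ge> e * (x \<bullet> x)"
  using assms by (simp add: ridge_mult psd_def inner_add_right)

lemma ridge_Cauchy_Schwarz:
  assumes C: "psd C" and e: "e > 0"
  shows "(x \<bullet> (ridge C e *v y))\<^sup>2 \<le> (x \<bullet> (ridge C e *v x)) * (y \<bullet> (ridge C e *v y))"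
proof (cases "y = 0")
  case False
  let ?B = "ridge C e"
  let ?a = "x \<bullet> (?B *v x)" and ?b = "x \<bullet> (?B *v y)" and ?c = "y \<bullet> (?B *v y)"
  have c: "?c > 0"
    using ridge_quadratic[OF C, of e y] e False by (smt (verit) inner_gt_zero_iff mult_pos_pos)
  have sym: "y \<bullet> (?B *v x) = ?b"
    using C sym_matrix_inner[of C y x] by (simp add: psd_def ridge_mult inner_add_right inner_commute)
  \<comment> \<open>Residual of x after projection onto y in the form of \<open>?B\<close>; its
    nonnegative square is the claim, multiplied out.\<close>
  let ?z = "x - (?b / ?c) *\<^sub>R y"
  have "0 \<le> ?z \<bullet> (?B *v ?z)"
    using ridge_quadratic[OF C, of e ?z] e by (smt (verit) inner_ge_zero mult_nonneg_nonneg)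
  also have "\<dots> = ?a - (?b / ?c) * ?b - (?b / ?c) * ?b + (?b / ?c) * (?b / ?c) * ?c"
    by (simp add: matrix_vector_mult_diff_distrib matrix_vector_mult_scaleR inner_diff_left inner_diff_right sym)
  also have "\<dots> = ?a - ?b\<^sup>2 / ?c" using c by (simp add: field_simps power2_eq_square)
  finally show ?thesis using c by (simp add: field_simps)
qed simp

lemma ridge_inv_mult:
  assumes C: "psd C" and e: "e > 0"
  shows "ridge C e *v (ridge_inv C e *v x) = x"
proof -
  let ?B = "ridge C e"
  have "inj ((*v) ?B)"
  proof (rule injI)
    fix u v assume "?B *v u = ?B *v v"
    then have "?B *v (u - v) = 0" by (simp add: matrix_vector_mult_diff_distrib)
    then have "e * ((u - v) \<bullet> (u - v)) \<le> 0" using ridge_quadratic[OF C, of e "u - v"] by simp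
    then have "(u - v) \<bullet> (u - v) \<le> 0" using e by (simp add: mult_le_0_iff)
    then show "u = v" by (metis eq_iff_diff_eq_0 inner_eq_zero_iff inner_ge_zero order_antisym)
  qed
  then have d: "det ?B \<noteq> 0" using det_nz_iff_inj[of "(*v) ?B"] by (simp add: matrix_of_matrix_vector_mul)
  \<comment> \<open>The entries of \<open>ridge_inv\<close> in column j are the determinant
    quotients that solve the linear system with right-hand side \<open>axis j 1\<close>.\<close>
  have col: "?B *v column j (ridge_inv C e) = axis j 1" for j
    using cramer[OF d, of "column j (ridge_inv C e)" "axis j 1"]
    by (simp add: column_def ridge_inv_def)
  have "?B ** ridge_inv C e = mat 1"
  proof -
    have "(?B ** ridge_inv C e) $ i $ j = mat 1 $ i $ j" for i j
      using arg_cong[OF col[of j], of "\<lambda>v. v $ i"]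
      by (simp add: matrix_matrix_mult_def matrix_vector_mult_def column_def axis_def mat_def)
    then show ?thesis by (simp add: vec_eq_iff)
  qed
  then show ?thesis by (simp add: matrix_vector_mul_assoc)
qed

text \<open>Write B for \<open>ridge C e\<close> and V for its inverse. The dual inequality is
  Cauchy-Schwarz in the form of B, applied to x and V y. Since B is at least e times the identity, V
  has norm at most 1 / e, which bounds the entries. The trace bound is uniform in e, and this is
  what survives when e tends to 0.\<close>

lemma ridge_inv_bounds:
  fixes C :: "real ^ 'd ^ 'd"
  assumes C: "psd C" and e: "e > 0"
  shows ridge_inv_dual: "(x \<bullet> y)\<^sup>2 \<le> (x \<bullet> (C *v x) + e * (x \<bullet> x)) * (y \<bullet> (ridge_inv C e *v y))"
    and ridge_inv_nonneg: "0 \<le> y \<bullet> (ridge_inv C e *v y)"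
    and ridge_inv_entry: "\<bar>ridge_inv C e $ i $ j\<bar> \<le> 1 / e"
    and ridge_inv_trace: "(\<Sum>i\<in>UNIV. \<Sum>j\<in>UNIV. ridge_inv C e $ i $ j * C $ i $ j) \<le> real CARD('d)"
proof -
  let ?B = "ridge C e" and ?V = "ridge_inv C e"
  note inv = ridge_inv_mult[OF C e]
  show "(x \<bullet> y)\<^sup>2 \<le> (x \<bullet> (C *v x) + e * (x \<bullet> x)) * (y \<bullet> (?V *v y))"
    using ridge_Cauchy_Schwarz[OF C e, of x "?V *v y"]
    by (simp add: inv inner_add_right inner_commute ridge_mult[of C e x])
  have nn: "0 \<le> y \<bullet> (?V *v y)" and ge: "e * ((?V *v y) \<bullet> (?V *v y)) \<le> y \<bullet> (?V *v y)" for y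
  proof -
    show ge: "e * ((?V *v y) \<bullet> (?V *v y)) \<le> y \<bullet> (?V *v y)" 
      using ridge_quadratic[OF C, of e "?V *v y"] by (simp add: inv inner_commute)
    moreover have "0 \<le> e * ((?V *v y) \<bullet> (?V *v y))" using e by simp
    ultimately show "0 \<le> y \<bullet> (?V *v y)" by linarith
  qed
  show "0 \<le> y \<bullet> (?V *v y)" by (rule nn)
  have ent: "?V $ i $ j = (?V *v axis j 1) $ i" for i j
    by (simp add: matrix_vector_mult_basis column_def)
  show "\<bar>?V $ i $ j\<bar> \<le> 1 / e"
  proof -
    let ?v = "?V *v axis j 1"
    have "e * (norm ?v)\<^sup>2 \<le> norm ?v"
      using ge[of "axis j 1"] norm_cauchy_schwarz[of "axis j 1" ?v]
      by (simp add: power2_norm_eq_inner)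
    then have "e * norm ?v \<le> 1"
      using e by (cases "norm ?v = 0") (auto simp: power2_eq_square)
    then have "norm ?v \<le> 1 / e" using e by (simp add: field_simps)
    with component_le_norm_cart[of ?v i] ent[of i j] show ?thesis by simp
  qed
  \<comment> \<open>By symmetry of C this is the j-th diagonal entry of C V = 1 - e V, and V has a
    nonnegative diagonal.\<close>
  have "(\<Sum>i\<in>UNIV. ?V $ i $ j * C $ i $ j) \<le> 1" for j
  proof -
    have "(\<Sum>i\<in>UNIV. ?V $ i $ j * C $ i $ j) = (C *v (?V *v axis j 1)) $ j"
      using C by (simp add: psd_def matrix_vector_mult_def[of C] ent mult.commute)
    also have "\<dots> = (axis j 1 - e *\<^sub>R (?V *v axis j 1)) $ j"
      using inv[of "axis j 1"] by (metis add_diff_cancel_right' ridge_mult)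
    also have "\<dots> \<le> 1"
    proof -
      have "0 \<le> e * (?V *v axis j 1) $ j"
        using nn[of "axis j 1"] e by (simp add: inner_axis')
      then show ?thesis by simp
    qed
    finally show ?thesis .
  qed
  then have "(\<Sum>j\<in>UNIV. \<Sum>i\<in>UNIV. ?V $ i $ j * C $ i $ j) \<le> (\<Sum>j\<in>(UNIV::'d set). 1)"
    by (intro sum_mono) auto
  then show "(\<Sum>i\<in>UNIV. \<Sum>j\<in>UNIV. ?V $ i $ j * C $ i $ j) \<le> real CARD('d)"
    by (subst sum.swap) simp
qed

lemma borel_measurable_det [measurable]:
  assumes [measurable]: "\<And>i j. (\<lambda>\<omega>. A \<omega> $ i $ j) \<in> borel_measurable N"
  shows "(\<lambda>\<omega>. det (A \<omega> :: real ^ 'd ^ 'd)) \<in> borel_measurable N"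
  unfolding det_def by measurable

lemma borel_measurable_ridge_inv [measurable]:
  assumes [measurable]: "\<And>i j. (\<lambda>\<omega>. C \<omega> $ i $ j) \<in> borel_measurable N"
  shows "(\<lambda>\<omega>. ridge_inv (C \<omega>) e $ i $ j) \<in> borel_measurable N"
proof -
  have [measurable]: "(\<lambda>\<omega>. ridge (C \<omega>) e $ i $ j) \<in> borel_measurable N" for i j
    unfolding ridge_def by (simp add: mat_def)
  have [measurable]: "(\<lambda>\<omega>. (\<chi> a c. if c = i then axis j 1 $ a else ridge (C \<omega>) e $ a $ c) $ k $ l) \<in> borel_measurable N" for i j k l
    by simp
  show ?thesis
    unfolding ridge_inv_def vec_lambda_beta by (intro borel_measurable_divide borel_measurable_det) measurable
qed

lemma quadratic_form_sum: "x \<bullet> (C *v y) = (\<Sum>i\<in>UNIV. \<Sum>j\<in>UNIV. x $ i * y $ j * C $ i $ j)"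
  for C :: "real ^ 'd ^ 'd"
  by (simp add: inner_vec_def matrix_vector_mult_def sum_distrib_left mult_ac)

text \<open>Conditional expectations give nonnegativity of the form for each fixed x outside a null
  set depending on x. Restricting x to a countable dense set leaves a single null set, and
  continuity recovers all x.\<close>

lemma psd_dense:
  fixes C :: "real ^ 'd ^ 'd"
  assumes "\<forall>i j. C $ i $ j = C $ j $ i" "closure S = UNIV" "\<And>x. x \<in> S \<Longrightarrow> 0 \<le> x \<bullet> (C *v x)"
  shows "psd C"
proof -
  have "closed {x. 0 \<le> x \<bullet> (C *v x)}"
    unfolding quadratic_form_sum by (intro closed_Collect_le continuous_intros)
  then have "closure S \<subseteq> {x. 0 \<le> x \<bullet> (C *v x)}"
    using assms(3) by (intro closure_minimal) auto
  then show ?thesis using assms unfolding psd_def by auto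
qed

section \<open>Stochastic integrals and convergence in probability\<close>

text \<open>One-sided: \<open>vanish M f\<close> says that the positive parts of \<open>f n\<close> tend to 0 in probability.\<close>

definition vanish :: "'a measure \<Rightarrow> (nat \<Rightarrow> 'a \<Rightarrow> real) \<Rightarrow> bool" where
  "vanish M f \<longleftrightarrow> (\<forall>e>0. (\<lambda>n. measure M {x\<in>space M. e < f n x}) \<longlonglongrightarrow> 0)"

section \<open>Comparison rules for one-sided convergence in probability\<close>

context finite_measure
begin

text \<open>The general comparison principle: the event where h exceeds e is covered by two events
  whose thresholds depend on e but not on n. Taking f and g equal reduces it to a single
  sequence.\<close>

lemma vanish_cases:
  assumes f: "\<And>n. f n \<in> borel_measurable M" "vanish M f"
    and g: "\<And>n. g n \<in> borel_measurable M" "vanish M g"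
    and h: "\<And>n. h n \<in> borel_measurable M"
    and *: "\<And>e. e > 0 \<Longrightarrow> \<exists>a>0. \<exists>b>0. \<forall>n. AE x in M. e < h n x \<longrightarrow> a < f n x \<or> b < g n x"
  shows "vanish M h"
  unfolding vanish_def
proof (intro allI impI)
  fix e :: real assume "e > 0"
  then obtain a b where ab: "a > 0" "b > 0" "\<And>n. AE x in M. e < h n x \<longrightarrow> a < f n x \<or> b < g n x"
    using * by blast
  note [measurable] = f(1) g(1) h
  let ?A = "\<lambda>n. {x\<in>space M. a < f n x}" and ?B = "\<lambda>n. {x\<in>space M. b < g n x}"
  have le: "measure M {x\<in>space M. e < h n x} \<le> measure M (?A n) + measure M (?B n)" for n
  proof -
    have "measure M {x\<in>space M. e < h n x} \<le> measure M (?A n \<union> ?B n)"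
      using ab(3)[of n] by (intro finite_measure_mono_AE) auto
    also have "\<dots> \<le> measure M (?A n) + measure M (?B n)"
      by (intro measure_Un_le) auto
    finally show ?thesis .
  qed
  show "(\<lambda>n. measure M {x\<in>space M. e < h n x}) \<longlonglongrightarrow> 0"
  proof (rule Lim_null_comparison[OF always_eventually])
    show "\<forall>n. norm (measure M {x\<in>space M. e < h n x}) \<le> measure M (?A n) + measure M (?B n)"
      unfolding real_norm_def abs_of_nonneg[OF measure_nonneg] using le by blast
    have "(\<lambda>n. measure M (?A n)) \<longlonglongrightarrow> 0" "(\<lambda>n. measure M (?B n)) \<longlonglongrightarrow> 0"
      using f(2) g(2) ab unfolding vanish_def by blast+
    then show "(\<lambda>n. measure M (?A n) + measure M (?B n)) \<longlonglongrightarrow> 0"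
      by (rule tendsto_add_zero)
  qed
qed

lemma vanish_le_add:
  assumes f: "\<And>n. f n \<in> borel_measurable M" "vanish M f"
    and g: "\<And>n. g n \<in> borel_measurable M" "vanish M g"
    and h: "\<And>n. h n \<in> borel_measurable M"
    and *: "\<And>n. AE x in M. h n x \<le> max 0 (f n x) + max 0 (g n x)"
  shows "vanish M h"
proof (rule vanish_cases[OF f g h])
  fix e :: real assume e: "e > 0"
  have "AE x in M. e < h n x \<longrightarrow> e / 2 < f n x \<or> e / 2 < g n x" for n
    using *[of n]
  proof eventually_elim
    case (elim x) then show ?case using e by linarith
  qed
  with e show "\<exists>a>0. \<exists>b>0. \<forall>n. AE x in M. e < h n x \<longrightarrow> a < f n x \<or> b < g n x"
    by (intro exI[of _ "e / 2"] conjI allI) auto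
qed

lemma vanish_mono:
  assumes "\<And>n. f n \<in> borel_measurable M" "vanish M f" "\<And>n. h n \<in> borel_measurable M"
    and "\<And>n. AE x in M. h n x \<le> max 0 (f n x)"
  shows "vanish M h"
proof (rule vanish_le_add[OF assms(1,2) _ _ assms(3)])
  show "vanish M (\<lambda>_ _. 0)" by (simp add: vanish_def)
qed (use assms(4) in simp_all)

lemma vanish_const:
  assumes v: "vanish M (\<lambda>_. h)" and h [measurable]: "h \<in> borel_measurable M"
  shows "AE x in M. h x \<le> 0"
proof -
  from v have "measure M {x\<in>space M. e < h x} = 0" if "e > 0" for e
    using that LIMSEQ_const_iff[of "measure M {x\<in>space M. e < h x}" 0] by (simp add: vanish_def)
  then have *: "AE x in M. \<not> e < h x" if "e > 0" for e
    using that by (intro AE_I[of _ _ "{x\<in>space M. e < h x}"]) (auto simp: emeasure_eq_measure)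
  have "AE x in M. \<forall>n. \<not> inverse (real (Suc n)) < h x"
    unfolding AE_all_countable by (intro allI *) simp
  then show ?thesis
  proof eventually_elim
    case (elim x)
    show ?case
    proof (rule ccontr)
      assume "\<not> h x \<le> 0"
      then obtain n where "inverse (real (Suc n)) < h x" using reals_Archimedean[of "h x"] by auto
      with elim show False by blast
    qed
  qed
qed

lemma vanish_of_integral:
  assumes i: "\<And>n. integrable M (f n)" and nn: "\<And>n. AE x in M. 0 \<le> f n x"
    and l: "(\<lambda>n. \<integral>x. f n x \<partial>M) \<longlonglongrightarrow> 0"
  shows "vanish M f"
  unfolding vanish_def
proof (intro allI impI)
  fix e :: real assume e: "e > 0"
  have le: "measure M {x\<in>space M. e < f n x} \<le> (\<integral>x. f n x \<partial>M) / e" for n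
  proof -
    note [measurable] = borel_measurable_integrable[OF i]
    have "measure M {x\<in>space M. e < f n x} \<le> measure M {x\<in>space M. e \<le> f n x}"
      by (intro finite_measure_mono) auto
    also have "\<dots> \<le> (\<integral>x. f n x \<partial>M) / e"
      by (rule integral_Markov_inequality_measure[OF i sets.empty_sets nn e])
    finally show ?thesis .
  qed
  show "(\<lambda>n. measure M {x\<in>space M. e < f n x}) \<longlonglongrightarrow> 0"
  proof (rule Lim_null_comparison[OF always_eventually])
    show "\<forall>n. norm (measure M {x\<in>space M. e < f n x}) \<le> (\<integral>x. f n x \<partial>M) / e"
      unfolding real_norm_def abs_of_nonneg[OF measure_nonneg] using le by blast
    show "(\<lambda>n. (\<integral>x. f n x \<partial>M) / e) \<longlonglongrightarrow> 0"
      by (rule tendsto_divide_zero[OF l])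
  qed
qed

text \<open>Dominated convergence when the convergence is only in probability. The integrand is at
  most e, plus k on the event where f n exceeds e, plus the part of R above level k; first k is
  chosen, then e, then n.\<close>

lemma integral_vanish_dominated:
  assumes f: "\<And>n. f n \<in> borel_measurable M" "vanish M f"
    and nn: "\<And>n. AE x in M. 0 \<le> f n x" and R: "integrable M R" and le: "\<And>n. AE x in M. f n x \<le> R x"
  shows "(\<lambda>n. \<integral>x. f n x \<partial>M) \<longlonglongrightarrow> 0"
proof (rule LIMSEQ_I)
  fix r :: real assume r: "r > 0"
  note [measurable] = f(1) borel_measurable_integrable[OF R]
  have i: "integrable M (f n)" for n
    using nn[of n] le[of n] by (intro Bochner_Integration.integrable_bound[OF R]) (auto elim!: eventually_elim2)
  have "(\<lambda>k. \<integral>x. \<bar>R x\<bar> * indicator {x\<in>space M. real k < \<bar>R x\<bar>} x \<partial>M) \<longlonglongrightarrow> (\<integral>x. 0 \<partial>M)"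
  proof (rule integral_dominated_convergence[where w = "\<lambda>x. \<bar>R x\<bar>"])
    show "AE x in M. (\<lambda>k. \<bar>R x\<bar> * indicator {x\<in>space M. real k < \<bar>R x\<bar>} x) \<longlonglongrightarrow> 0"
    proof (intro AE_I2)
      fix x obtain k0 where "\<bar>R x\<bar> \<le> real k0" using real_arch_simple by blast
      then have "\<forall>k\<ge>k0. \<bar>R x\<bar> * indicator {x\<in>space M. real k < \<bar>R x\<bar>} x = (0::real)"
        by (auto simp: indicator_def)
      then show "(\<lambda>k. \<bar>R x\<bar> * indicator {x\<in>space M. real k < \<bar>R x\<bar>} x) \<longlonglongrightarrow> 0"
        by (intro tendsto_eventually) (auto simp: eventually_sequentially)
    qed
  qed (use R in \<open>auto simp: indicator_def\<close>)
  then have "eventually (\<lambda>k. (\<integral>x. \<bar>R x\<bar> * indicator {x\<in>space M. real k < \<bar>R x\<bar>} x \<partial>M) < r / 3) sequentially"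
    using order_tendstoD(2)[of _ "0::real" sequentially "r / 3"] r by simp
  then obtain k :: nat where k: "(\<integral>x. \<bar>R x\<bar> * indicator {x\<in>space M. real k < \<bar>R x\<bar>} x \<partial>M) < r / 3"
    using eventually_happens'[OF sequentially_bot] by blast
  define m where "m = measure M (space M)"
  \<comment> \<open>One third of r for each of the three pieces. The \<open>+ 1\<close> here and in
    \<open>real k + 1\<close> below guards against a total mass 0 or a level k = 0.\<close>
  define e where "e = r / (3 * (m + 1))"
  have m: "m \<ge> 0" by (simp add: m_def)
  have e: "e > 0" "e * m < r / 3"
    using r m by (auto simp: e_def field_simps)
  have "eventually (\<lambda>n. measure M {x\<in>space M. e < f n x} < r / (3 * (real k + 1))) sequentially"
    using f(2) e r by (intro order_tendstoD(2)[of _ 0]) (auto simp: vanish_def)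
  then obtain n0 where n0: "\<And>n. n \<ge> n0 \<Longrightarrow> measure M {x\<in>space M. e < f n x} < r / (3 * (real k + 1))"
    by (auto simp: eventually_sequentially)
  have "(\<integral>x. f n x \<partial>M) < r" if "n \<ge> n0" for n
  proof -
    let ?A = "{x\<in>space M. e < f n x}" and ?K = "{x\<in>space M. real k < \<bar>R x\<bar>}"
    have iK: "integrable M (\<lambda>x. \<bar>R x\<bar> * indicator ?K x)"
      using R by (intro integrable_real_mult_indicator) auto
    have iA: "integrable M (\<lambda>x. real k * indicator ?A x)"
      by (intro integrable_mult_right integrable_real_indicator) (auto simp: emeasure_eq_measure)
    have "(\<integral>x. f n x \<partial>M) \<le> (\<integral>x. e + (real k * indicator ?A x + \<bar>R x\<bar> * indicator ?K x) \<partial>M)"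
    proof (rule integral_mono_AE[OF i])
      show "AE x in M. f n x \<le> e + (real k * indicator ?A x + \<bar>R x\<bar> * indicator ?K x)"
        using le[of n] nn[of n] AE_space
        by eventually_elim (use e in \<open>auto simp: indicator_def\<close>)
    qed (use iA iK in auto)
    also have "\<dots> = e * m + (real k * measure M ?A + (\<integral>x. \<bar>R x\<bar> * indicator ?K x \<partial>M))"
      using iA iK by (simp add: m_def)
    also have "\<dots> < r / 3 + (r / 3 + r / 3)"
    proof -
      have "real k * measure M ?A \<le> (real k + 1) * measure M ?A" by (simp add: mult_right_mono)
      also have "\<dots> \<le> r / 3" using n0[OF that] by (simp add: field_simps)
      finally show ?thesis using e k by linarith
    qed
    finally show ?thesis by simp
  qed
  moreover have "0 \<le> (\<integral>x. f n x \<partial>M)" for n by (rule integral_nonneg_AE[OF nn])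
  ultimately show "\<exists>no. \<forall>n\<ge>no. norm ((\<integral>x. f n x \<partial>M) - 0) < r"
    by (intro exI[of _ n0]) auto
qed

end

lemma sum_UNIV_prod:
  "(\<Sum>p\<in>UNIV. g p) = (\<Sum>i\<in>UNIV. \<Sum>j\<in>UNIV. g (i :: 'i::finite, j :: 'j::finite))"
  by (metis UNIV_Times_UNIV sum.cartesian_product')

section \<open>Conditional expectations and one time step\<close>

context finite_measure_subalgebra
begin

lemma subalg_measurable: "f \<in> borel_measurable F \<Longrightarrow> f \<in> borel_measurable M"
  by (rule measurable_from_subalg[OF subalg])

text \<open>Only the sum is assumed integrable; the single products c i * f i need not be, so they
  cannot be conditioned separately. On the sets \<open>B k\<close> of F, where the coefficients are
  bounded, they can, and these sets exhaust the space.\<close>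

lemma real_cond_exp_sum_mult:
  fixes c f :: "'i \<Rightarrow> 'a \<Rightarrow> real"
  assumes fin: "finite I" and c: "\<And>i. i \<in> I \<Longrightarrow> c i \<in> borel_measurable F"
    and f: "\<And>i. i \<in> I \<Longrightarrow> integrable M (f i)"
    and int: "integrable M (\<lambda>\<omega>. \<Sum>i\<in>I. c i \<omega> * f i \<omega>)"
  shows "AE \<omega> in M. real_cond_exp M F (\<lambda>\<omega>. \<Sum>i\<in>I. c i \<omega> * f i \<omega>) \<omega>
           = (\<Sum>i\<in>I. c i \<omega> * real_cond_exp M F (f i) \<omega>)"
proof -
  define B where "B k = {\<omega>\<in>space F. (\<Sum>i\<in>I. \<bar>c i \<omega>\<bar>) \<le> real k}" for k :: nat
  have B [measurable]: "B k \<in> sets F" for k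
    unfolding B_def using c by measurable
  define J where "J k = (indicator (B k) :: 'a \<Rightarrow> real)" for k
  have J [measurable]: "J k \<in> borel_measurable F" for k unfolding J_def by measurable
  let ?S = "\<lambda>\<omega>. \<Sum>i\<in>I. c i \<omega> * f i \<omega>"
  let ?E = "real_cond_exp M F"
  have *: "AE \<omega> in M. J k \<omega> * ?E ?S \<omega> = J k \<omega> * (\<Sum>i\<in>I. c i \<omega> * ?E (f i) \<omega>)" for k
  proof -
    \<comment> \<open>Both families are extended by 0 outside I because the sum rule for conditional
      expectations asks for integrability at every index.\<close>
    define g where "g i \<omega> = (if i \<in> I then J k \<omega> * c i \<omega> else 0)" for i \<omega>
    define h where "h i = (if i \<in> I then f i else (\<lambda>_. 0))" for i
    have g: "g i \<in> borel_measurable F" for i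
      unfolding g_def using c[of i] by (cases "i \<in> I") auto
    have h: "integrable M (h i)" for i unfolding h_def using f by auto
    have gb: "\<bar>g i \<omega>\<bar> \<le> real k" for i \<omega>
    proof (cases "i \<in> I \<and> \<omega> \<in> B k")
      case True
      then have "\<bar>c i \<omega>\<bar> \<le> (\<Sum>i\<in>I. \<bar>c i \<omega>\<bar>)"
        using fin by (intro member_le_sum) auto
      with True show ?thesis by (simp add: g_def J_def B_def)
    qed (auto simp: g_def J_def)
    have gh: "integrable M (\<lambda>\<omega>. g i \<omega> * h i \<omega>)" for i
    proof (rule Bochner_Integration.integrable_bound[of _ "\<lambda>\<omega>. real k * h i \<omega>"])
      show "(\<lambda>\<omega>. g i \<omega> * h i \<omega>) \<in> borel_measurable M"
        using subalg_measurable[OF g] borel_measurable_integrable[OF h] by measurable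
      show "AE \<omega> in M. norm (g i \<omega> * h i \<omega>) \<le> norm (real k * h i \<omega>)"
        using gb by (auto simp: abs_mult intro!: mult_right_mono)
    qed (use h in simp)
    have JS: "(\<lambda>\<omega>. J k \<omega> * ?S \<omega>) = (\<lambda>\<omega>. \<Sum>i\<in>I. g i \<omega> * h i \<omega>)"
      by (auto simp: fun_eq_iff g_def h_def sum_distrib_left mult.assoc intro!: sum.cong)
    have "integrable M (\<lambda>\<omega>. J k \<omega> * ?S \<omega>)"
      unfolding JS by (intro Bochner_Integration.integrable_sum gh)
    then have "AE \<omega> in M. ?E (\<lambda>\<omega>. J k \<omega> * ?S \<omega>) \<omega> = J k \<omega> * ?E ?S \<omega>"
      by (intro real_cond_exp_mult J borel_measurable_integrable int)
    moreover have "AE \<omega> in M. ?E (\<lambda>\<omega>. \<Sum>i\<in>I. g i \<omega> * h i \<omega>) \<omega> = (\<Sum>i\<in>I. ?E (\<lambda>\<omega>. g i \<omega> * h i \<omega>) \<omega>)"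
      by (rule real_cond_exp_sum[OF gh])
    moreover have "AE \<omega> in M. \<forall>i\<in>I. ?E (\<lambda>\<omega>. g i \<omega> * h i \<omega>) \<omega> = g i \<omega> * ?E (h i) \<omega>"
      using fin by (intro AE_finite_allI real_cond_exp_mult g gh borel_measurable_integrable h)
    ultimately show ?thesis
    proof eventually_elim
      case (elim \<omega>)
      then show ?case by (simp add: JS g_def h_def sum_distrib_left mult.assoc)
    qed
  qed
  have "AE \<omega> in M. \<forall>k. J k \<omega> * ?E ?S \<omega> = J k \<omega> * (\<Sum>i\<in>I. c i \<omega> * ?E (f i) \<omega>)"
    unfolding AE_all_countable using * ..
  with AE_space show ?thesis
  proof eventually_elim
    case (elim \<omega>)
    obtain k :: nat where "(\<Sum>i\<in>I. \<bar>c i \<omega>\<bar>) \<le> real k" using real_arch_simple by blast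
    then have "J k \<omega> = 1" using elim(1) subalg by (simp add: J_def B_def subalgebra_def)
    with spec[OF elim(2), of k] show ?case by simp
  qed
qed

text \<open>The weight \<open>w\<close> makes the entries of the conditional Gram matrix integrable for \<open>D\<close> merely in $L^1$.\<close>

lemma weighted_gram_matrix:
  fixes D :: "'a \<Rightarrow> real ^ 'd"
  assumes D: "integrable M D"
  defines "w \<equiv> \<lambda>\<omega>. 1 / (1 + norm (D \<omega>))"
  defines "C \<equiv> \<lambda>\<omega>. \<chi> i j. real_cond_exp M F (\<lambda>\<omega>. w \<omega> * (D \<omega> $ i * D \<omega> $ j)) \<omega>"
  shows gram_integrable: "integrable M (\<lambda>\<omega>. w \<omega> * (D \<omega> $ i * D \<omega> $ j))"
    and gram_quadratic: "\<zeta> \<in> borel_measurable F \<Longrightarrow> integrable M (\<lambda>\<omega>. w \<omega> * (\<zeta> \<omega> \<bullet> D \<omega>)\<^sup>2) \<Longrightarrow>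
      AE \<omega> in M. real_cond_exp M F (\<lambda>\<omega>. w \<omega> * (\<zeta> \<omega> \<bullet> D \<omega>)\<^sup>2) \<omega> = \<zeta> \<omega> \<bullet> (C \<omega> *v \<zeta> \<omega>)"
    and gram_psd: "AE \<omega> in M. psd (C \<omega>)"
proof -
  have Dm [measurable]: "D \<in> borel_measurable M" using D by auto
  have wm [measurable]: "w \<in> borel_measurable M" unfolding w_def by measurable
  have w: "0 < w \<omega>" "w \<omega> * norm (D \<omega>) \<le> 1" for \<omega>
    unfolding w_def by (auto simp: field_simps add_pos_nonneg)
  \<comment> \<open>The weight absorbs one of the two factors of size norm D.\<close>
  have wx: "\<bar>w \<omega> * (D \<omega> $ i * D \<omega> $ j)\<bar> \<le> norm (D \<omega>)" for \<omega> i j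
  proof -
    have "\<bar>w \<omega> * (D \<omega> $ i * D \<omega> $ j)\<bar> = w \<omega> * (\<bar>D \<omega> $ i\<bar> * \<bar>D \<omega> $ j\<bar>)"
      using w(1)[of \<omega>] by (simp add: abs_mult)
    also have "\<dots> \<le> w \<omega> * (norm (D \<omega>) * norm (D \<omega>))"
      using w(1)[of \<omega>] by (intro mult_left_mono mult_mono component_le_norm_cart) auto
    also have "\<dots> \<le> 1 * norm (D \<omega>)"
      using mult_right_mono[OF w(2)[of \<omega>], of "norm (D \<omega>)"] by (simp add: mult.assoc)
    finally show ?thesis by simp
  qed
  have comp [measurable]: "(\<lambda>\<omega>. D \<omega> $ i) \<in> borel_measurable M" for i
    by (simp add: cart_eq_inner_axis)
  show gi: "integrable M (\<lambda>\<omega>. w \<omega> * (D \<omega> $ i * D \<omega> $ j))" for i j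
    using wx by (intro Bochner_Integration.integrable_bound[OF D]) auto
  \<comment> \<open>Written as one sum over index pairs, so that the products of coordinates of
    \<zeta> become the F-measurable coefficients in \<open>real_cond_exp_sum_mult\<close>.\<close>
  have sq: "w \<omega> * (x \<bullet> D \<omega>)\<^sup>2 = (\<Sum>p\<in>UNIV. (x $ fst p * x $ snd p) * (w \<omega> * (D \<omega> $ fst p * D \<omega> $ snd p)))"
    for x \<omega>
    by (simp add: power2_eq_square inner_vec_def sum_product sum_distrib_left sum_UNIV_prod mult_ac)
  have qC: "x \<bullet> (C \<omega> *v x) = (\<Sum>p\<in>UNIV. (x $ fst p * x $ snd p) *
      real_cond_exp M F (\<lambda>\<omega>. w \<omega> * (D \<omega> $ fst p * D \<omega> $ snd p)) \<omega>)" for x \<omega>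
    by (simp add: quadratic_form_sum C_def sum_UNIV_prod)
  show quad: "AE \<omega> in M. real_cond_exp M F (\<lambda>\<omega>. w \<omega> * (\<zeta> \<omega> \<bullet> D \<omega>)\<^sup>2) \<omega> = \<zeta> \<omega> \<bullet> (C \<omega> *v \<zeta> \<omega>)"
    if z: "\<zeta> \<in> borel_measurable F" and i: "integrable M (\<lambda>\<omega>. w \<omega> * (\<zeta> \<omega> \<bullet> D \<omega>)\<^sup>2)" for \<zeta>
    unfolding qC sq
  proof (rule real_cond_exp_sum_mult)
    have "(\<lambda>\<omega>. \<zeta> \<omega> $ i) \<in> borel_measurable F" for i
      using z by (simp add: cart_eq_inner_axis)
    then show "(\<lambda>\<omega>. \<zeta> \<omega> $ fst p * \<zeta> \<omega> $ snd p) \<in> borel_measurable F" for p by simp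
  qed (use gi i in \<open>simp_all add: sq[symmetric]\<close>)
  obtain S :: "(real ^ 'd) set" where S: "countable S" "\<And>X. open X \<Longrightarrow> X \<noteq> {} \<Longrightarrow> \<exists>x\<in>S. x \<in> X"
    using countable_dense_setE by blast
  have clS: "closure S = UNIV"
  proof -
    have "\<exists>y\<in>S. dist y x < e" if "e > 0" for x e
      using S(2)[of "ball x e"] that by (auto simp: dist_commute)
    then show ?thesis by (auto simp: closure_approachable)
  qed
  have "AE \<omega> in M. 0 \<le> x \<bullet> (C \<omega> *v x)" for x
  proof -
    have i: "integrable M (\<lambda>\<omega>. w \<omega> * (x \<bullet> D \<omega>)\<^sup>2)"
      unfolding sq by (intro Bochner_Integration.integrable_sum integrable_mult_right gi)
    have "AE \<omega> in M. 0 \<le> real_cond_exp M F (\<lambda>\<omega>. w \<omega> * (x \<bullet> D \<omega>)\<^sup>2) \<omega>"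
      using w(1) by (intro real_cond_exp_pos AE_I2) (auto simp: less_imp_le)
    with quad[of "\<lambda>_. x", OF _ i] show ?thesis by auto
  qed
  then have "AE \<omega> in M. \<forall>x\<in>S. 0 \<le> x \<bullet> (C \<omega> *v x)"
    using S by (simp add: AE_ball_countable)
  then show "AE \<omega> in M. psd (C \<omega>)"
  proof eventually_elim
    case (elim \<omega>)
    have "(\<lambda>\<omega>. w \<omega> * (D \<omega> $ i * D \<omega> $ j)) = (\<lambda>\<omega>. w \<omega> * (D \<omega> $ j * D \<omega> $ i))" for i j
      by (intro ext arg_cong[where f="(*) _"] mult.commute)
    then have "C \<omega> $ i $ j = C \<omega> $ j $ i" for i j
      unfolding C_def vec_lambda_beta by (rule arg_cong)
    then show ?case by (intro psd_dense[OF _ clS] allI) (use elim in blast)+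
  qed
qed

text \<open>
  In the non-degenerate case \<open>R\<^sup>2 = D \<bullet> C\<^sup>-\<^sup>1 D\<close>, and \<open>w R\<^sup>2\<close> has mean at most the trace of the identity.  The
  regularised inverses avoid any discussion of the kernel of \<open>C\<close>.
\<close>

lemma gram_domination:
  fixes D :: "'a \<Rightarrow> real ^ 'd"
  assumes D: "integrable M D"
  defines "w \<equiv> \<lambda>x. 1 / (1 + norm (D x))"
  defines "C \<equiv> \<lambda>x. \<chi> i j. real_cond_exp M F (\<lambda>x. w x * (D x $ i * D x $ j)) x"
  obtains R where "\<And>x. 0 \<le> R x" "integrable M R" "integrable M (\<lambda>x. w x * (R x)\<^sup>2)"
    "AE x in M. \<forall>v. (v \<bullet> D x)\<^sup>2 \<le> (v \<bullet> (C x *v v)) * (R x)\<^sup>2"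
proof -
  have Dm [measurable]: "D \<in> borel_measurable M" using D by auto
  have wm [measurable]: "w \<in> borel_measurable M" unfolding w_def by measurable
  have w: "0 < w x" "1 / w x = 1 + norm (D x)" for x
    unfolding w_def by (auto simp: add_pos_nonneg)
  have gi: "integrable M (\<lambda>x. w x * (D x $ i * D x $ j))" for i j
    unfolding w_def by (rule gram_integrable[OF D])
  have psd: "AE x in M. psd (C x)"
    using gram_psd[OF D] unfolding C_def w_def .
  have comp [measurable]: "(\<lambda>x. D x $ i) \<in> borel_measurable M" for i
    by (simp add: cart_eq_inner_axis)
  define e where "e k = 1 / (real k + 1)" for k :: nat
  have e: "e k > 0" for k by (simp add: e_def)
  define V where "V k x = ridge_inv (C x) (e k)" for k x
  define S where "S k x = D x \<bullet> (V k x *v D x)" for k x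
  have VF [measurable]: "(\<lambda>x. V k x $ i $ j) \<in> borel_measurable F" for k i j
    unfolding V_def by (rule borel_measurable_ridge_inv) (simp add: C_def)
  note VM [measurable] = subalg_measurable[OF VF]
  have Ssum: "w x * S k x = (\<Sum>i\<in>UNIV. \<Sum>j\<in>UNIV. V k x $ i $ j * (w x * (D x $ i * D x $ j)))" for k x
    unfolding S_def quadratic_form_sum by (simp add: sum_distrib_left mult_ac)
  have Sm [measurable]: "S k \<in> borel_measurable M" for k
    unfolding S_def quadratic_form_sum by measurable
  have Snn: "AE x in M. \<forall>k. 0 \<le> S k x"
    using psd by eventually_elim (simp add: S_def V_def ridge_inv_nonneg e)
  have Vi: "integrable M (\<lambda>x. V k x $ i $ j * (w x * (D x $ i * D x $ j)))" for k i j
  proof (rule Bochner_Integration.integrable_bound[where f = "\<lambda>x. 1 / e k * (w x * (D x $ i * D x $ j))"])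
    show "AE x in M. norm (V k x $ i $ j * (w x * (D x $ i * D x $ j)))
        \<le> norm (1 / e k * (w x * (D x $ i * D x $ j)))"
      using psd
    proof eventually_elim
      case (elim x)
      have "\<bar>V k x $ i $ j\<bar> \<le> \<bar>1 / e k\<bar>" using ridge_inv_entry[OF elim e] e[of k] unfolding V_def by simp
      then show ?case unfolding real_norm_def abs_mult by (rule mult_right_mono) simp
    qed
  qed (rule integrable_mult_right[OF gi], measurable)
  \<comment> \<open>\<open>V k\<close> is F-measurable, so under the integral each product w D_i D_j
    may be replaced by its conditional expectation C_ij. The trace bound then gives a constant that
    does not depend on k.\<close>
  have Sbound: "(\<integral>\<^sup>+x. ennreal (w x * S k x) \<partial>M) \<le> ennreal (real CARD('d) * measure M (space M))" for k
  proof -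
    have i: "integrable M (\<lambda>x. w x * S k x)"
      unfolding Ssum by (intro Bochner_Integration.integrable_sum Vi)
    have VC: "integrable M (\<lambda>x. V k x $ i $ j * C x $ i $ j)"
      "(\<integral>x. V k x $ i $ j * (w x * (D x $ i * D x $ j)) \<partial>M) = (\<integral>x. V k x $ i $ j * C x $ i $ j \<partial>M)" for i j
      using real_cond_exp_intg[OF Vi[of k i j] VF] by (simp_all add: C_def)
    have "(\<integral>x. w x * S k x \<partial>M) = (\<Sum>i\<in>UNIV. \<Sum>j\<in>UNIV. \<integral>x. V k x $ i $ j * C x $ i $ j \<partial>M)"
      unfolding Ssum by (simp add: Vi VC)
    also have "\<dots> = (\<integral>x. (\<Sum>i\<in>UNIV. \<Sum>j\<in>UNIV. V k x $ i $ j * C x $ i $ j) \<partial>M)"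
      by (simp add: VC)
    also have "\<dots> \<le> (\<integral>x. real CARD('d) \<partial>M)"
    proof (rule integral_mono_AE)
      show "AE x in M. (\<Sum>i\<in>UNIV. \<Sum>j\<in>UNIV. V k x $ i $ j * C x $ i $ j) \<le> real CARD('d)"
        using psd by eventually_elim (simp add: V_def ridge_inv_trace e)
    qed (auto intro!: Bochner_Integration.integrable_sum VC)
    also have "\<dots> = real CARD('d) * measure M (space M)" by simp
    finally have "(\<integral>x. w x * S k x \<partial>M) \<le> real CARD('d) * measure M (space M)" .
    moreover have "AE x in M. 0 \<le> w x * S k x"
      using Snn by eventually_elim (simp add: w(1) less_imp_le)
    ultimately show ?thesis
      by (subst nn_integral_eq_integral[OF i]) (auto intro: ennreal_leI)
  qed
  \<comment> \<open>Fatou's lemma carries the uniform bound over to the liminf without any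
    monotonicity in k. R is then chosen so that w R^2 = L.\<close>
  define L where "L x = liminf (\<lambda>k. ennreal (w x * S k x))" for x
  have Lm [measurable]: "L \<in> borel_measurable M" unfolding L_def by measurable
  have "(\<integral>\<^sup>+x. L x \<partial>M) \<le> liminf (\<lambda>k. \<integral>\<^sup>+x. ennreal (w x * S k x) \<partial>M)"
    unfolding L_def by (intro nn_integral_liminf) measurable
  also have "\<dots> \<le> limsup (\<lambda>k. \<integral>\<^sup>+x. ennreal (w x * S k x) \<partial>M)"
    by (intro Liminf_le_Limsup) simp
  also have "\<dots> \<le> ennreal (real CARD('d) * measure M (space M))"
    by (intro Limsup_bounded always_eventually allI Sbound)
  also have "\<dots> < \<infinity>" by simp
  finally have Lfin: "(\<integral>\<^sup>+x. L x \<partial>M) < \<infinity>" .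
  define R where "R x = sqrt (enn2real (L x) / w x)" for x
  have R0: "0 \<le> R x" for x using w(1)[of x] by (simp add: R_def less_imp_le)
  have R2: "w x * (R x)\<^sup>2 = enn2real (L x)" for x using w(1)[of x] by (simp add: R_def less_imp_le)
  have AL: "AE x in M. L x \<noteq> \<infinity>"
    using Lfin by (intro nn_integral_PInf_AE) auto
  have iL: "integrable M (\<lambda>x. enn2real (L x))"
  proof (rule integrableI_bounded)
    have "(\<integral>\<^sup>+x. ennreal (norm (enn2real (L x))) \<partial>M) \<le> (\<integral>\<^sup>+x. L x \<partial>M)"
      by (intro nn_integral_mono) (simp add: ennreal_enn2real_if)
    with Lfin show "(\<integral>\<^sup>+x. ennreal (norm (enn2real (L x))) \<partial>M) < \<infinity>" by (rule le_less_trans[rotated])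
  qed measurable
  have Rm: "R \<in> borel_measurable M" unfolding R_def by measurable
  have iR: "integrable M R"
  proof (rule Bochner_Integration.integrable_bound[where f = "\<lambda>x. enn2real (L x) + (1 + norm (D x))"])
    show "AE x in M. norm (R x) \<le> norm (enn2real (L x) + (1 + norm (D x)))"
    proof (intro AE_I2)
      fix x
      \<comment> \<open>Expanded, this is 2 R \<le> w R^2 + 1 / w. Since 1 / w = 1 + norm D is
        integrable, integrability passes from w R^2 to R.\<close>
      have "0 \<le> (sqrt (w x) * R x - sqrt (1 / w x))\<^sup>2" by simp
      also have "\<dots> = w x * (R x)\<^sup>2 + 1 / w x - 2 * R x"
        using w(1)[of x] by (simp add: power2_diff power_mult_distrib real_sqrt_divide power_divide less_imp_le)
      finally have "2 * R x \<le> enn2real (L x) + (1 + norm (D x))"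
        using R2[of x] w(2)[of x] by simp
      with R0[of x] show "norm (R x) \<le> norm (enn2real (L x) + (1 + norm (D x)))" by simp
    qed
  qed (use iL D Rm in auto)
  have "AE x in M. \<forall>v. (v \<bullet> D x)\<^sup>2 \<le> (v \<bullet> (C x *v v)) * (R x)\<^sup>2"
    using psd Snn AL
  proof eventually_elim
    case (elim x)
    show ?case
    proof
      fix v
      define q where "q = v \<bullet> (C x *v v)"
      define s where "s = enn2real (L x)"
      have q: "0 \<le> q" using elim by (simp add: q_def psd_def)
      have s: "0 \<le> s" "L x = ennreal s" using elim by (simp_all add: s_def ennreal_enn2real_if)
      have dual: "w x * (v \<bullet> D x)\<^sup>2 \<le> (q + e k * (v \<bullet> v)) * (w x * S k x)" for k
        using mult_left_mono[OF ridge_inv_dual[OF elim(1) e[of k], of v "D x"], of "w x"] w(1)[of x]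
        by (simp add: q_def S_def V_def mult_ac)
      \<comment> \<open>As s is the liminf, w S k cannot eventually stay above s + r, so some k with
        e k \<le> r has w S k \<le> s + r. Letting r decrease to 0 removes both errors, also where C
        is singular.\<close>
      have le: "w x * (v \<bullet> D x)\<^sup>2 \<le> (q + r * (v \<bullet> v)) * (s + r)" if r: "r > 0" for r
      proof -
        have "\<not> eventually (\<lambda>k. ennreal (s + r) \<le> ennreal (w x * S k x)) sequentially"
        proof
          assume "eventually (\<lambda>k. ennreal (s + r) \<le> ennreal (w x * S k x)) sequentially"
          then have "ennreal (s + r) \<le> L x" unfolding L_def by (rule Liminf_bounded)
          with s r show False by simp
        qed
        moreover have "eventually (\<lambda>k. e k \<le> r) sequentially"
        proof -
          have "e \<longlonglongrightarrow> 0" unfolding e_def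
            using LIMSEQ_inverse_real_of_nat by (simp add: inverse_eq_divide add.commute)
          from order_tendstoD(2)[OF this r] show ?thesis by eventually_elim simp
        qed
        ultimately have "\<exists>k. e k \<le> r \<and> \<not> ennreal (s + r) \<le> ennreal (w x * S k x)"
          by (metis (mono_tags, lifting) eventually_mono)
        then obtain k where k: "e k \<le> r" "\<not> ennreal (s + r) \<le> ennreal (w x * S k x)" by blast
        then have "w x * S k x \<le> s + r" by (meson ennreal_leI linear)
        then have "(q + e k * (v \<bullet> v)) * (w x * S k x) \<le> (q + r * (v \<bullet> v)) * (s + r)"
          using k(1) q s(1) r e[of k] elim(2) w(1)[of x]
          by (intro mult_mono add_mono mult_right_mono) (auto simp: less_imp_le)
        with dual[of k] show ?thesis by linarith
      qed
      have "((\<lambda>r. (q + r * (v \<bullet> v)) * (s + r)) \<longlongrightarrow> (q + 0 * (v \<bullet> v)) * (s + 0)) (at_right 0)"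
        by (intro tendsto_intros)
      then have "w x * (v \<bullet> D x)\<^sup>2 \<le> (q + 0 * (v \<bullet> v)) * (s + 0)"
        by (rule tendsto_lowerbound) (auto intro: eventually_mono[OF eventually_at_right_less[of 0]] le)
      also have "\<dots> = w x * (q * (R x)\<^sup>2)" using R2[of x] by (simp add: s_def mult_ac)
      finally show "(v \<bullet> D x)\<^sup>2 \<le> v \<bullet> (C x *v v) * (R x)\<^sup>2"
        using w(1)[of x] by (simp add: q_def)
    qed
  qed
  with R0 iR show ?thesis using iL by (intro that[of R]) (simp_all add: R2)
qed

lemma real_cond_exp_inner_zero:
  fixes D :: "'a \<Rightarrow> real ^ 'd"
  assumes D: "integrable M D" and mart: "\<And>i. AE x in M. real_cond_exp M F (\<lambda>x. D x $ i) x = 0"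
    and z: "\<zeta> \<in> borel_measurable F" and zi: "integrable M (\<lambda>x. \<zeta> x \<bullet> D x)"
  shows "AE x in M. real_cond_exp M F (\<lambda>x. \<zeta> x \<bullet> D x) x = 0"
    and "(\<integral>x. \<zeta> x \<bullet> D x \<partial>M) = 0"
proof -
  have "AE x in M. real_cond_exp M F (\<lambda>x. \<zeta> x \<bullet> D x) x = (\<Sum>i\<in>UNIV. \<zeta> x $ i * real_cond_exp M F (\<lambda>x. D x $ i) x)"
    unfolding inner_vec_def inner_real_def
  proof (rule real_cond_exp_sum_mult)
    show "(\<lambda>x. \<zeta> x $ i) \<in> borel_measurable F" for i
      using z by (simp add: cart_eq_inner_axis)
    show "integrable M (\<lambda>x. D x $ i)" for i
      using integrable_inner_left[OF D, of "axis i 1"] by (simp add: cart_eq_inner_axis)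
  qed (use zi in \<open>simp_all add: inner_vec_def\<close>)
  moreover have "AE x in M. \<forall>i\<in>UNIV. real_cond_exp M F (\<lambda>x. D x $ i) x = 0"
    by (intro AE_finite_allI mart) simp
  ultimately show *: "AE x in M. real_cond_exp M F (\<lambda>x. \<zeta> x \<bullet> D x) x = 0"
    by eventually_elim simp
  then have "(\<integral>x. real_cond_exp M F (\<lambda>x. \<zeta> x \<bullet> D x) x \<partial>M) = 0"
    by (rule integral_eq_zero_AE)
  with real_cond_exp_int(2)[OF zi] show "(\<integral>x. \<zeta> x \<bullet> D x \<partial>M) = 0" by simp
qed

text \<open>
  The integrands are normalised by their conditional standard deviation, which makes the
  normalised increments uniformly integrable however large the integrands are.
\<close>

lemma one_step_vanish:
  fixes D :: "'a \<Rightarrow> real ^ 'd"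
  assumes D: "integrable M D" and mart: "\<And>i. AE x in M. real_cond_exp M F (\<lambda>x. D x $ i) x = 0"
    and \<eta>: "\<And>n. \<eta> n \<in> borel_measurable F"
    and neg: "vanish M (\<lambda>n x. - (\<eta> n x \<bullet> D x))"
  shows "vanish M (\<lambda>n x. \<eta> n x \<bullet> D x)"
proof -
  define w where "w x = 1 / (1 + norm (D x))" for x
  define C where "C x = (\<chi> i j. real_cond_exp M F (\<lambda>x. w x * (D x $ i * D x $ j)) x)" for x
  obtain R where R: "\<And>x. 0 \<le> R x" "integrable M R" "integrable M (\<lambda>x. w x * (R x)\<^sup>2)"
    "AE x in M. \<forall>v. (v \<bullet> D x)\<^sup>2 \<le> (v \<bullet> (C x *v v)) * (R x)\<^sup>2"
    using gram_domination[OF D] unfolding C_def w_def by blast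
  have psd: "AE x in M. psd (C x)"
    using gram_psd[OF D] unfolding C_def w_def .
  note quad = gram_quadratic[OF D, folded w_def, folded C_def]
  have Dm [measurable]: "D \<in> borel_measurable M" using D by auto
  have Rm [measurable]: "R \<in> borel_measurable M" using R by auto
  have wm [measurable]: "w \<in> borel_measurable M" unfolding w_def by measurable
  have w: "0 < w x" "w x \<le> 1" for x
    unfolding w_def by (auto simp: add_pos_nonneg)
  note [measurable] = \<eta>
  have comp [measurable]: "(\<lambda>x. \<eta> n x $ i) \<in> borel_measurable F" for n i
    using \<eta>[of n] by (simp add: cart_eq_inner_axis)
  define q where "q n x = sqrt (\<eta> n x \<bullet> (C x *v \<eta> n x))" for n x
  have qm [measurable]: "q n \<in> borel_measurable F" for n
    unfolding q_def quadratic_form_sum C_def by simp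
  \<comment> \<open>Dividing by max 1 q instead of q leaves small integrands untouched and avoids
    the case q = 0; the conditional standard deviation becomes min 1 q.\<close>
  define \<zeta> where "\<zeta> n x = (1 / max 1 (q n x)) *\<^sub>R \<eta> n x" for n x
  have zm [measurable]: "\<zeta> n \<in> borel_measurable F" for n
    unfolding \<zeta>_def by measurable
  note [measurable] = subalg_measurable[OF zm] subalg_measurable[OF qm] subalg_measurable[OF \<eta>]
  have zq: "\<zeta> n x \<bullet> (C x *v \<zeta> n x) = (min 1 (q n x))\<^sup>2" if "psd (C x)" for n x
  proof -
    have "(q n x)\<^sup>2 = \<eta> n x \<bullet> (C x *v \<eta> n x)" using that by (simp add: q_def psd_def)
    then have "\<zeta> n x \<bullet> (C x *v \<zeta> n x) = (q n x / max 1 (q n x))\<^sup>2"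
      by (simp add: \<zeta>_def matrix_vector_mult_scaleR power_divide power2_eq_square)
    also have "q n x / max 1 (q n x) = min 1 (q n x)" by (simp add: max_def min_def)
    finally show ?thesis .
  qed
  have q0: "AE x in M. \<forall>n. 0 \<le> q n x"
    using psd by eventually_elim (simp add: q_def psd_def)
  have zR2: "AE x in M. (\<zeta> n x \<bullet> D x)\<^sup>2 \<le> (R x)\<^sup>2" for n
    using R(4) psd q0
  proof eventually_elim
    case (elim x)
    have "(\<zeta> n x \<bullet> D x)\<^sup>2 \<le> (min 1 (q n x))\<^sup>2 * (R x)\<^sup>2"
      using elim(1) zq[OF elim(2), of n] by metis
    also have "\<dots> \<le> 1 * (R x)\<^sup>2"
      using elim(3) by (intro mult_right_mono) (auto simp: power_le_one)
    finally show ?case by simp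
  qed
  have zR: "AE x in M. \<bar>\<zeta> n x \<bullet> D x\<bar> \<le> R x" for n
    using zR2[of n] by eventually_elim (metis R(1) abs_le_square_iff abs_of_nonneg)
  have zi: "integrable M (\<lambda>x. \<zeta> n x \<bullet> D x)" for n
    using zR[of n] by (intro Bochner_Integration.integrable_bound[OF R(2)]) (auto elim!: eventually_mono)
  have z0: "(\<integral>x. \<zeta> n x \<bullet> D x \<partial>M) = 0" for n
    by (rule real_cond_exp_inner_zero(2)[OF D mart zm zi])
  \<comment> \<open>Multiplication by a factor in (0, 1] can only shrink the negative part.\<close>
  have vn: "vanish M (\<lambda>n x. max 0 (- (\<zeta> n x \<bullet> D x)))"
  proof (rule vanish_mono[OF _ neg])
    fix n show "AE x in M. max 0 (- (\<zeta> n x \<bullet> D x)) \<le> max 0 (- (\<eta> n x \<bullet> D x))"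
    proof (intro AE_I2)
      fix x
      have m: "0 < max 1 (q n x)" "1 / max 1 (q n x) \<le> 1" by auto
      have "- (\<zeta> n x \<bullet> D x) = (1 / max 1 (q n x)) * - (\<eta> n x \<bullet> D x)" by (simp add: \<zeta>_def)
      also have "\<dots> \<le> (1 / max 1 (q n x)) * max 0 (- (\<eta> n x \<bullet> D x))"
        using m by (intro mult_left_mono) auto
      also have "\<dots> \<le> 1 * max 0 (- (\<eta> n x \<bullet> D x))"
        using m by (intro mult_right_mono) auto
      finally show "max 0 (- (\<zeta> n x \<bullet> D x)) \<le> max 0 (- (\<eta> n x \<bullet> D x))" by simp
    qed
  qed measurable
  have "(\<lambda>n. \<integral>x. max 0 (- (\<zeta> n x \<bullet> D x)) \<partial>M) \<longlonglongrightarrow> 0"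
  proof (rule integral_vanish_dominated[OF _ vn _ R(2)])
    show "AE x in M. max 0 (- (\<zeta> n x \<bullet> D x)) \<le> R x" for n
      using zR[of n] by eventually_elim (use R(1) in auto)
  qed auto
  \<comment> \<open>Mean zero equates the positive and the negative part in expectation. This is
    where one-sided control becomes two-sided.\<close>
  moreover have "(\<integral>x. \<bar>\<zeta> n x \<bullet> D x\<bar> \<partial>M) = 2 * (\<integral>x. max 0 (- (\<zeta> n x \<bullet> D x)) \<partial>M)" for n
  proof -
    have "(\<integral>x. \<bar>\<zeta> n x \<bullet> D x\<bar> \<partial>M) = (\<integral>x. \<zeta> n x \<bullet> D x + 2 * max 0 (- (\<zeta> n x \<bullet> D x)) \<partial>M)"
      by (rule Bochner_Integration.integral_cong) auto
    also have "\<dots> = 2 * (\<integral>x. max 0 (- (\<zeta> n x \<bullet> D x)) \<partial>M)"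
      using zi[of n] by (subst Bochner_Integration.integral_add) (auto simp: z0)
    finally show ?thesis .
  qed
  ultimately have "(\<lambda>n. \<integral>x. \<bar>\<zeta> n x \<bullet> D x\<bar> \<partial>M) \<longlonglongrightarrow> 0"
    using tendsto_mult_right_zero[of _ sequentially 2] by simp
  then have vabs: "vanish M (\<lambda>n x. \<bar>\<zeta> n x \<bullet> D x\<bar>)"
    using zi by (intro vanish_of_integral) auto
  have vsq: "vanish M (\<lambda>n x. w x * (\<zeta> n x \<bullet> D x)\<^sup>2)"
  proof (rule vanish_cases[OF _ vabs _ vabs])
    fix e :: real assume e: "e > 0"
    have "sqrt e < \<bar>\<zeta> n x \<bullet> D x\<bar>" if "e < w x * (\<zeta> n x \<bullet> D x)\<^sup>2" for n x
    proof -
      have "w x * (\<zeta> n x \<bullet> D x)\<^sup>2 \<le> 1 * (\<zeta> n x \<bullet> D x)\<^sup>2" using w by (intro mult_right_mono) auto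
      with that have "e < (\<zeta> n x \<bullet> D x)\<^sup>2" by simp
      then show ?thesis by (metis real_sqrt_abs real_sqrt_less_mono)
    qed
    with e show "\<exists>a>0. \<exists>b>0. \<forall>n. AE x in M. e < w x * (\<zeta> n x \<bullet> D x)\<^sup>2 \<longrightarrow>
        a < \<bar>\<zeta> n x \<bullet> D x\<bar> \<or> b < \<bar>\<zeta> n x \<bullet> D x\<bar>"
      by (intro exI[of _ "sqrt e"] conjI allI AE_I2) auto
  qed measurable
  have sqR: "AE x in M. w x * (\<zeta> n x \<bullet> D x)\<^sup>2 \<le> w x * (R x)\<^sup>2" for n
    using zR2[of n] by eventually_elim (use w(1) in \<open>auto intro!: mult_left_mono simp: less_imp_le\<close>)
  have sqnn: "0 \<le> w x * (\<zeta> n x \<bullet> D x)\<^sup>2" for n x using w(1)[of x] by (simp add: less_imp_le)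
  have isq: "integrable M (\<lambda>x. w x * (\<zeta> n x \<bullet> D x)\<^sup>2)" for n
  proof (rule Bochner_Integration.integrable_bound[OF R(3)])
    show "AE x in M. norm (w x * (\<zeta> n x \<bullet> D x)\<^sup>2) \<le> norm (w x * (R x)\<^sup>2)"
      using sqR[of n] by eventually_elim (smt (verit) real_norm_def sqnn)
  qed measurable
  have "(\<lambda>n. \<integral>x. w x * (\<zeta> n x \<bullet> D x)\<^sup>2 \<partial>M) \<longlonglongrightarrow> 0"
    by (rule integral_vanish_dominated[OF _ vsq _ R(3) sqR]) (auto simp: sqnn)
  \<comment> \<open>Conditioning the weighted square recovers q: its mean tends to 0, so min 1 (q n)
    tends to 0 in probability, and the normalisation is inactive with probability tending to that of
    the whole space.\<close>
  moreover have AEq: "AE x in M. real_cond_exp M F (\<lambda>x. w x * (\<zeta> n x \<bullet> D x)\<^sup>2) x = (min 1 (q n x))\<^sup>2" for n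
    using quad[OF zm[of n] isq[of n]] psd by eventually_elim (simp add: zq)
  moreover have "(\<integral>x. w x * (\<zeta> n x \<bullet> D x)\<^sup>2 \<partial>M) = (\<integral>x. (min 1 (q n x))\<^sup>2 \<partial>M)" for n
    using real_cond_exp_int(2)[OF isq[of n]] integral_cong_AE[OF _ _ AEq[of n]] by simp
  ultimately have "(\<lambda>n. \<integral>x. (min 1 (q n x))\<^sup>2 \<partial>M) \<longlonglongrightarrow> 0" by simp
  then have vq: "vanish M (\<lambda>n x. (min 1 (q n x))\<^sup>2)"
  proof (intro vanish_of_integral)
    fix n show "integrable M (\<lambda>x. (min 1 (q n x))\<^sup>2)"
      using integrable_cong_AE_imp[OF real_cond_exp_int(1)[OF isq[of n]], of "\<lambda>x. (min 1 (q n x))\<^sup>2"] AEq[of n]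
      by (auto elim!: eventually_mono)
  qed auto
  show ?thesis
  proof (rule vanish_cases[OF _ vabs _ vq])
    fix e :: real assume e: "e > 0"
    \<comment> \<open>For q at most 1 the two integrands agree; otherwise min 1 q = 1, and any
      threshold below 1 would serve in place of 1 / 2.\<close>
    have "e < \<bar>\<zeta> n x \<bullet> D x\<bar> \<or> 1 / 2 < (min 1 (q n x))\<^sup>2" if "e < \<eta> n x \<bullet> D x" for n x
    proof (cases "q n x \<le> 1")
      case True
      then have "\<zeta> n x = \<eta> n x" by (simp add: \<zeta>_def max_def)
      with that have "e < \<bar>\<zeta> n x \<bullet> D x\<bar>" by simp
      then show ?thesis ..
    qed simp
    with e show "\<exists>a>0. \<exists>b>0. \<forall>n. AE x in M. e < \<eta> n x \<bullet> D x \<longrightarrow>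
        a < \<bar>\<zeta> n x \<bullet> D x\<bar> \<or> b < (min 1 (q n x))\<^sup>2"
      by (intro exI[of _ e] exI[of _ "1 / 2"] conjI allI AE_I2) auto
  qed measurable
qed

end

lemma integrable_Fatou:
  fixes f :: "nat \<Rightarrow> 'a \<Rightarrow> real"
  assumes f: "\<And>n. integrable M (f n)" "\<And>n. AE x in M. 0 \<le> f n x" "\<And>n. (\<integral>x. f n x \<partial>M) \<le> B"
    and g: "g \<in> borel_measurable M" "AE x in M. (\<lambda>n. f n x) \<longlonglongrightarrow> g x"
  shows "integrable M g" "(\<integral>x. g x \<partial>M) \<le> B"
proof -
  note [measurable] = borel_measurable_integrable[OF f(1)] g(1)
  have B: "0 \<le> B" using integral_nonneg_AE[OF f(2)[of 0]] f(3)[of 0] by linarith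
  have nn: "AE x in M. 0 \<le> g x"
  proof -
    have "AE x in M. \<forall>n. 0 \<le> f n x" unfolding AE_all_countable using f(2) ..
    with g(2) show ?thesis
      by eventually_elim (auto intro: LIMSEQ_le_const)
  qed
  have "(\<integral>\<^sup>+x. ennreal (g x) \<partial>M) = (\<integral>\<^sup>+x. liminf (\<lambda>n. ennreal (f n x)) \<partial>M)"
  proof (rule nn_integral_cong_AE)
    show "AE x in M. ennreal (g x) = liminf (\<lambda>n. ennreal (f n x))"
      using g(2)
    proof eventually_elim
      case (elim x)
      then have "(\<lambda>n. ennreal (f n x)) \<longlonglongrightarrow> ennreal (g x)" by (rule tendsto_ennrealI)
      then show ?case by (simp add: lim_imp_Liminf)
    qed
  qed
  also have "\<dots> \<le> liminf (\<lambda>n. \<integral>\<^sup>+x. ennreal (f n x) \<partial>M)" by (intro nn_integral_liminf) measurable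
  also have "\<dots> \<le> limsup (\<lambda>n. \<integral>\<^sup>+x. ennreal (f n x) \<partial>M)" by (intro Liminf_le_Limsup) simp
  also have "\<dots> \<le> ennreal B"
  proof (intro Limsup_bounded always_eventually allI)
    fix n show "(\<integral>\<^sup>+x. ennreal (f n x) \<partial>M) \<le> ennreal B"
      using nn_integral_eq_integral[OF f(1,2)[of n]] f(3)[of n] by (simp add: ennreal_leI)
  qed
  finally have le: "(\<integral>\<^sup>+x. ennreal (g x) \<partial>M) \<le> ennreal B" .
  show i: "integrable M g"
    using le nn by (intro integrableI_nonneg) (auto intro: le_less_trans)
  show "(\<integral>x. g x \<partial>M) \<le> B"
    using le nn_integral_eq_integral[OF i nn] B by (simp add: ennreal_le_iff)
qed

lemma integrable_bounded_inner:
  fixes D \<zeta> :: "'a \<Rightarrow> real ^ 'd"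
  assumes D: "integrable M D" and z [measurable]: "\<zeta> \<in> borel_measurable M" and b: "\<And>x. norm (\<zeta> x) \<le> k"
  shows "integrable M (\<lambda>x. \<zeta> x \<bullet> D x)"
proof (rule Bochner_Integration.integrable_bound[where f = "\<lambda>x. k * norm (D x)"])
  show "AE x in M. norm (\<zeta> x \<bullet> D x) \<le> norm (k * norm (D x))"
  proof (intro AE_I2)
    fix x
    have "norm (\<zeta> x \<bullet> D x) \<le> norm (\<zeta> x) * norm (D x)"
      unfolding real_norm_def by (rule Cauchy_Schwarz_ineq2)
    also have "\<dots> \<le> k * norm (D x)" using b by (intro mult_right_mono) auto
    also have "\<dots> \<le> norm (k * norm (D x))" by simp
    finally show "norm (\<zeta> x \<bullet> D x) \<le> norm (k * norm (D x))" .
  qed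
qed (use D in auto)

context finite_measure_subalgebra
begin

text \<open>The increment \<eta> \<bullet> D need not be integrable, so the assumed inequality
  cannot be conditioned directly. Multiplied by the indicator of the F-event where W and \<eta> are
  bounded by k, it can; the events increase to the whole space.\<close>

lemma one_step_lower_bound:
  fixes D :: "'a \<Rightarrow> real ^ 'd"
  assumes D: "integrable M D" and mart: "\<And>i. AE x in M. real_cond_exp M F (\<lambda>x. D x $ i) x = 0"
    and W: "W \<in> borel_measurable F" and \<eta>: "\<eta> \<in> borel_measurable F"
    and Y: "integrable M Y" "AE x in M. Y x \<le> W x + \<eta> x \<bullet> D x"
  shows "AE x in M. real_cond_exp M F Y x \<le> W x"
proof -
  note [measurable] = W \<eta>
  define J where "J k = (indicator {x\<in>space F. \<bar>W x\<bar> \<le> real k \<and> norm (\<eta> x) \<le> real k} :: 'a \<Rightarrow> real)" for k :: nat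
  have J [measurable]: "J k \<in> borel_measurable F" for k unfolding J_def by measurable
  have J01: "0 \<le> J k x" "J k x \<le> 1" "\<bar>J k x * W x\<bar> \<le> real k" "norm (J k x *\<^sub>R \<eta> x) \<le> real k" for k x
    by (auto simp: J_def indicator_def)
  note [measurable] = subalg_measurable[OF J] subalg_measurable[OF W] subalg_measurable[OF \<eta>]
    borel_measurable_integrable[OF Y(1)]
  have Dm [measurable]: "D \<in> borel_measurable M" using D by auto
  have *: "AE x in M. J k x * real_cond_exp M F Y x \<le> J k x * W x" for k
  proof -
    have iW: "integrable M (\<lambda>x. J k x * W x)"
      using J01(3) by (intro integrable_const_bound[of _ "real k"]) auto
    have iD: "integrable M (\<lambda>x. (J k x *\<^sub>R \<eta> x) \<bullet> D x)"
      using J01(4) by (intro integrable_bounded_inner[OF D]) auto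
    have iY: "integrable M (\<lambda>x. J k x * Y x)"
      using J01 by (intro Bochner_Integration.integrable_bound[OF Y(1)])
        (auto simp: abs_mult mult_left_le_one_le)
    have le: "AE x in M. J k x * Y x \<le> J k x * W x + (J k x *\<^sub>R \<eta> x) \<bullet> D x"
      using Y(2)
    proof eventually_elim
      case (elim x)
      from mult_left_mono[OF elim J01(1)[of k x]] show ?case by (simp add: distrib_left)
    qed
    have iS: "integrable M (\<lambda>x. J k x * W x + (J k x *\<^sub>R \<eta> x) \<bullet> D x)"
      by (intro Bochner_Integration.integrable_add iW iD)
    have zm: "(\<lambda>x. J k x *\<^sub>R \<eta> x) \<in> borel_measurable F" by measurable
    have WF: "(\<lambda>x. J k x * W x) \<in> borel_measurable F" by measurable
    show ?thesis
      using real_cond_exp_mono[OF le iY iS] real_cond_exp_add[OF iW iD]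
        real_cond_exp_F_meas[OF iW WF] real_cond_exp_inner_zero(1)[OF D mart zm iD]
        real_cond_exp_mult[OF J borel_measurable_integrable[OF Y(1)] iY]
      by eventually_elim simp
  qed
  have "AE x in M. \<forall>k. J k x * real_cond_exp M F Y x \<le> J k x * W x"
    unfolding AE_all_countable using * ..
  with AE_space show ?thesis
  proof eventually_elim
    case (elim x)
    obtain k :: nat where "max \<bar>W x\<bar> (norm (\<eta> x)) \<le> real k" using real_arch_simple by blast
    then have "J k x = 1" using elim(1) subalg by (simp add: J_def subalgebra_def)
    with spec[OF elim(2), of k] show ?case by simp
  qed
qed

text \<open>The truncations of \<eta> \<bullet> D have mean 0, so the nonnegative truncations of
  \<eta> \<bullet> D - Y have means bounded by the L1-norm of Y. Fatou's lemma passes to the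
  limit.\<close>

lemma one_step_integrable:
  fixes D :: "'a \<Rightarrow> real ^ 'd"
  assumes D: "integrable M D" and mart: "\<And>i. AE x in M. real_cond_exp M F (\<lambda>x. D x $ i) x = 0"
    and \<eta>: "\<eta> \<in> borel_measurable F"
    and Y: "integrable M Y" "AE x in M. Y x \<le> \<eta> x \<bullet> D x"
  shows "integrable M (\<lambda>x. \<eta> x \<bullet> D x)"
proof -
  note [measurable] = \<eta>
  define J where "J k = (indicator {x\<in>space F. norm (\<eta> x) \<le> real k} :: 'a \<Rightarrow> real)" for k :: nat
  have J [measurable]: "J k \<in> borel_measurable F" for k unfolding J_def by measurable
  have J01: "0 \<le> J k x" "J k x \<le> 1" "norm (J k x *\<^sub>R \<eta> x) \<le> real k" for k x
    by (auto simp: J_def indicator_def)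
  note [measurable] = subalg_measurable[OF J] subalg_measurable[OF \<eta>] borel_measurable_integrable[OF Y(1)]
  have Dm [measurable]: "D \<in> borel_measurable M" using D by auto
  have iD: "integrable M (\<lambda>x. (J k x *\<^sub>R \<eta> x) \<bullet> D x)" for k
    using J01(3) by (intro integrable_bounded_inner[OF D]) auto
  have JY: "norm (J k x * Y x) \<le> norm (Y x)" for k x
    using J01[of k x] by (simp add: abs_mult mult_left_le_one_le)
  have iY: "integrable M (\<lambda>x. J k x * Y x)" for k
    using JY by (intro Bochner_Integration.integrable_bound[OF Y(1)]) auto
  have z: "(\<integral>x. (J k x *\<^sub>R \<eta> x) \<bullet> D x \<partial>M) = 0" for k
    by (rule real_cond_exp_inner_zero(2)[OF D mart _ iD]) measurable
  let ?f = "\<lambda>k x. (J k x *\<^sub>R \<eta> x) \<bullet> D x - J k x * Y x"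
  have "integrable M (\<lambda>x. \<eta> x \<bullet> D x - Y x)"
  proof (rule integrable_Fatou(1)[where f = ?f])
    show "integrable M (?f k)" for k by (intro Bochner_Integration.integrable_diff iD iY)
    show "AE x in M. 0 \<le> ?f k x" for k
      using Y(2)
    proof eventually_elim
      case (elim x)
      from mult_left_mono[OF elim J01(1)[of k x]] show ?case by simp
    qed
    show "(\<integral>x. ?f k x \<partial>M) \<le> (\<integral>x. \<bar>Y x\<bar> \<partial>M)" for k
    proof -
      have "(\<integral>x. ?f k x \<partial>M) = (\<integral>x. - (J k x * Y x) \<partial>M)" using iD iY z by simp
      also have "\<dots> \<le> (\<integral>x. \<bar>Y x\<bar> \<partial>M)"
      proof (rule integral_mono)
        show "- (J k x * Y x) \<le> \<bar>Y x\<bar>" for x using JY[of k x] by simp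
      qed (use iY Y(1) in auto)
      finally show ?thesis .
    qed
    show "AE x in M. (\<lambda>k. ?f k x) \<longlonglongrightarrow> \<eta> x \<bullet> D x - Y x"
    proof (intro AE_I2)
      fix x assume w: "x \<in> space M"
      obtain k0 :: nat where "norm (\<eta> x) \<le> real k0" using real_arch_simple by blast
      with w subalg have "\<forall>k\<ge>k0. J k x = 1" by (auto simp: J_def subalgebra_def)
      then have "\<forall>k\<ge>k0. ?f k x = \<eta> x \<bullet> D x - Y x" by simp
      then show "(\<lambda>k. ?f k x) \<longlonglongrightarrow> \<eta> x \<bullet> D x - Y x"
        by (intro tendsto_eventually) (auto simp: eventually_sequentially)
    qed
  qed measurable
  from Bochner_Integration.integrable_add[OF this Y(1)] show ?thesis by simp
qed

end

section \<open>Discrete stochastic integrals\<close>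

definition stoch_int :: "(nat \<Rightarrow> 'a \<Rightarrow> real ^ 'd) \<Rightarrow> (nat \<Rightarrow> 'a \<Rightarrow> real ^ 'd) \<Rightarrow> nat \<Rightarrow> 'a \<Rightarrow> real" where
  "stoch_int \<eta> Z t x = (\<Sum>s<t. \<eta> s x \<bullet> (Z (Suc s) x - Z s x))"

lemma stoch_int_0 [simp]: "stoch_int \<eta> Z 0 = (\<lambda>_. 0)"
  by (simp add: stoch_int_def fun_eq_iff)

lemma stoch_int_Suc:
  "stoch_int \<eta> Z (Suc t) = (\<lambda>x. stoch_int \<eta> Z t x + \<eta> t x \<bullet> (Z (Suc t) x - Z t x))"
  by (simp add: stoch_int_def fun_eq_iff)

text \<open>The integrand is the position accumulated up to and including t. It is known at t, which
  matches the convention that \<open>\<eta> s\<close> multiplies the increment from s to Suc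
  s.\<close>

lemma inner_sum_by_parts:
  "Z T x \<bullet> (\<Sum>t\<le>T. \<xi> t x) = (\<Sum>t\<le>T. Z t x \<bullet> \<xi> t x) + stoch_int (\<lambda>t x. \<Sum>s\<le>t. \<xi> s x) Z T x"
  for Z \<xi> :: "nat \<Rightarrow> 'a \<Rightarrow> real ^ 'd"
  by (induction T) (simp_all add: stoch_int_Suc inner_add_right inner_diff_right inner_commute)

lemma filtration_measurable:
  assumes "discrete_filtration M F T" "s \<le> t" "t \<le> T" "f \<in> borel_measurable (F s)"
  shows "f \<in> borel_measurable (F t)"
  using assms measurable_from_subalg unfolding discrete_filtration_def by blast

context finite_measure
begin

lemma filtration_subalgebra:
  assumes "discrete_filtration M F T" "t \<le> T"
  shows "finite_measure_subalgebra M (F t)"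
  using assms by unfold_locales (auto simp: discrete_filtration_def)

lemma martingale_increment:
  fixes Z :: "nat \<Rightarrow> 'a \<Rightarrow> real ^ 'd"
  assumes F: "discrete_filtration M F T" and Z: "is_martingale M F T Z" and t: "t < T"
  shows "integrable M (\<lambda>x. Z (Suc t) x - Z t x)"
    and "AE x in M. real_cond_exp M (F t) (\<lambda>x. (Z (Suc t) x - Z t x) $ i) x = 0"
proof -
  interpret finite_measure_subalgebra M "F t" using filtration_subalgebra[OF F] t by simp
  have i: "integrable M (Z t)" "integrable M (Z (Suc t))"
    using Z t by (auto simp: is_martingale_def)
  then show "integrable M (\<lambda>x. Z (Suc t) x - Z t x)" by simp
  have ax: "axis i (1::real) \<in> Basis" by (simp add: axis_in_Basis_iff)
  have "AE x in M. real_cond_exp M (F t) (\<lambda>x. Z s x $ i) x = Z t x $ i" if "t \<le> s" "s \<le> T" for s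
    using Z ax that unfolding is_martingale_def cart_eq_inner_axis by blast
  then have "AE x in M. real_cond_exp M (F t) (\<lambda>x. Z t x $ i) x = Z t x $ i"
    "AE x in M. real_cond_exp M (F t) (\<lambda>x. Z (Suc t) x $ i) x = Z t x $ i" using t by simp_all
  moreover have "AE x in M. real_cond_exp M (F t) (\<lambda>x. Z (Suc t) x $ i - Z t x $ i) x
      = real_cond_exp M (F t) (\<lambda>x. Z (Suc t) x $ i) x - real_cond_exp M (F t) (\<lambda>x. Z t x $ i) x"
    using integrable_inner_left[OF i(1), of "axis i 1"] integrable_inner_left[OF i(2), of "axis i 1"]
    by (intro real_cond_exp_diff) (simp_all add: cart_eq_inner_axis)
  ultimately show "AE x in M. real_cond_exp M (F t) (\<lambda>x. (Z (Suc t) x - Z t x) $ i) x = 0"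
    unfolding vector_minus_component by eventually_elim simp
qed

lemma stoch_int_measurable:
  assumes F: "discrete_filtration M F T" and Z: "\<And>s. s \<le> T \<Longrightarrow> Z s \<in> borel_measurable (F s)"
    and \<eta>: "\<And>s. s < T \<Longrightarrow> \<eta> s \<in> borel_measurable (F s)" and t: "t \<le> T"
  shows "stoch_int \<eta> Z t \<in> borel_measurable (F t)"
  unfolding stoch_int_def
proof (intro borel_measurable_sum borel_measurable_inner borel_measurable_diff)
  fix s assume "s \<in> {..<t}"
  then show "\<eta> s \<in> borel_measurable (F t)" "Z (Suc s) \<in> borel_measurable (F t)" "Z s \<in> borel_measurable (F t)"
    using \<eta> Z t by (auto intro: filtration_measurable[OF F _ t, of s] filtration_measurable[OF F _ t, of "Suc s"])
qed

text \<open>Induction on t; the point is to push the control of the negative part one step back. If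
  the integral at t lies below -e, then either a loss remains at t + 1 or the last increment has
  recovered a definite part of it. Holding the last position only on that event gives increments
  with vanishing negative part, hence vanishing by \<open>one_step_vanish\<close>, so recoveries are
  improbable as well.\<close>

lemma stoch_int_vanish:
  fixes Z :: "nat \<Rightarrow> 'a \<Rightarrow> real ^ 'd"
  assumes F: "discrete_filtration M F T" and Z: "is_martingale M F T Z"
    and "t \<le> T" and "\<And>n s. s < T \<Longrightarrow> \<eta> n s \<in> borel_measurable (F s)"
    and "vanish M (\<lambda>n x. - stoch_int (\<eta> n) Z t x)"
  shows "vanish M (\<lambda>n. stoch_int (\<eta> n) Z t)"
  using assms(3-5)
proof (induction t)
  case 0 then show ?case by simp
next
  case (Suc t)
  interpret S: finite_measure_subalgebra M "F t" using filtration_subalgebra[OF F] Suc.prems by simp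
  let ?D = "\<lambda>x. Z (Suc t) x - Z t x"
  note D = martingale_increment[OF F Z Suc_le_lessD[OF Suc.prems(1)]]
  have Dm [measurable]: "?D \<in> borel_measurable M" using D(1) by auto
  have ZF: "Z s \<in> borel_measurable (F s)" if "s \<le> T" for s using Z that by (auto simp: is_martingale_def)
  have WF [measurable]: "stoch_int (\<eta> n) Z t \<in> borel_measurable (F t)" for n
    using Suc.prems by (intro stoch_int_measurable[OF F ZF]) auto
  have hF [measurable]: "\<eta> n t \<in> borel_measurable (F t)" for n using Suc.prems by simp
  note [measurable] = S.subalg_measurable[OF WF] S.subalg_measurable[OF hF]
  have neg: "vanish M (\<lambda>n x. - (stoch_int (\<eta> n) Z t x + \<eta> n t x \<bullet> ?D x))"
    using Suc.prems(3) by (simp add: stoch_int_Suc)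
  have "vanish M (\<lambda>n x. - stoch_int (\<eta> n) Z t x)"
    unfolding vanish_def
  proof (intro allI impI)
    fix e :: real assume e: "e > 0"
    \<comment> \<open>On this event the earlier loss exceeds e, so a loss in the last increment
      makes the total at t + 1 even more negative; the negative part of \<theta> \<bullet> D is
      dominated by that of the total.\<close>
    define \<theta> where "\<theta> n x = indicator {x\<in>space (F t). e < - stoch_int (\<eta> n) Z t x} x *\<^sub>R \<eta> n t x" for n x
    have \<theta>F: "\<theta> n \<in> borel_measurable (F t)" for n unfolding \<theta>_def by measurable
    note [measurable] = S.subalg_measurable[OF \<theta>F]
    have "vanish M (\<lambda>n x. - (\<theta> n x \<bullet> ?D x))"
    proof (rule vanish_mono[OF _ neg])
      show "AE x in M. - (\<theta> n x \<bullet> ?D x) \<le> max 0 (- (stoch_int (\<eta> n) Z t x + \<eta> n t x \<bullet> ?D x))" for n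
        using e by (intro AE_I2) (auto simp: \<theta>_def indicator_def)
    qed measurable
    then have v: "vanish M (\<lambda>n x. \<theta> n x \<bullet> ?D x)"
      by (rule S.one_step_vanish[OF D \<theta>F])
    \<comment> \<open>The factor 2 e lets the event be read off again at the level e once
      \<open>vanish\<close> is unfolded.\<close>
    have "vanish M (\<lambda>n x. 2 * e * indicator {x\<in>space M. e < - stoch_int (\<eta> n) Z t x} x)"
    proof (rule vanish_cases[OF _ v _ neg])
      fix a :: real assume a: "a > 0"
      \<comment> \<open>Any two fractions of e with sum below e would do: if both alternatives
        failed, the integral at t would be at least -e / 2 - e / 3, hence above -e.\<close>
      have "e / 2 < \<theta> n x \<bullet> ?D x \<or> e / 3 < - (stoch_int (\<eta> n) Z t x + \<eta> n t x \<bullet> ?D x)"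
        if "a < 2 * e * indicator {x\<in>space M. e < - stoch_int (\<eta> n) Z t x} x" for n x
      proof -
        have "x \<in> space M \<and> e < - stoch_int (\<eta> n) Z t x"
          using that a by (cases "x \<in> space M \<and> e < - stoch_int (\<eta> n) Z t x") auto
        then have "x \<in> space (F t)" "e < - stoch_int (\<eta> n) Z t x"
          using S.subalg by (auto simp: subalgebra_def)
        then have "\<theta> n x = \<eta> n t x" by (simp add: \<theta>_def)
        then show ?thesis using \<open>e < _\<close> e by (simp only:) linarith
      qed
      then show "\<exists>c>0. \<exists>b>0. \<forall>n. AE x in M. a < 2 * e * indicator {x\<in>space M. e < - stoch_int (\<eta> n) Z t x} x \<longrightarrow>
          c < \<theta> n x \<bullet> ?D x \<or> b < - (stoch_int (\<eta> n) Z t x + \<eta> n t x \<bullet> ?D x)"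
        using e by (intro exI[of _ "e / 2"] exI[of _ "e / 3"] conjI allI AE_I2) auto
    qed measurable
    then have "(\<lambda>n. measure M {x\<in>space M. e < 2 * e * indicator {x\<in>space M. e < - stoch_int (\<eta> n) Z t x} x}) \<longlonglongrightarrow> 0"
      using e unfolding vanish_def by blast
    also have "(\<lambda>n. {x\<in>space M. e < 2 * e * indicator {x\<in>space M. e < - stoch_int (\<eta> n) Z t x} x})
        = (\<lambda>n. {x\<in>space M. e < - stoch_int (\<eta> n) Z t x})"
      using e by (auto simp: indicator_def fun_eq_iff)
    finally show "(\<lambda>n. measure M {x\<in>space M. e < - stoch_int (\<eta> n) Z t x}) \<longlonglongrightarrow> 0" .
  qed
  then have W: "vanish M (\<lambda>n. stoch_int (\<eta> n) Z t)"
    using Suc.IH Suc.prems by simp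
  \<comment> \<open>The last increment is the difference of the integrals at t + 1 and t: the former
    has small negative part by assumption, the latter small positive part by induction.\<close>
  have "vanish M (\<lambda>n x. - (\<eta> n t x \<bullet> ?D x))"
    by (rule vanish_le_add[OF _ W _ neg]) auto
  then have v: "vanish M (\<lambda>n x. \<eta> n t x \<bullet> ?D x)"
    by (rule S.one_step_vanish[OF D hF])
  show ?case
    unfolding stoch_int_Suc by (rule vanish_le_add[OF _ W _ v]) auto
qed

text \<open>Conditional expectation carries the lower bound backwards from T to every t
  (\<open>lower\<close>). With lower bounds at all times, integrability follows forwards in time,
  increment by increment. Only then may the increments be conditioned, and the tower property gives
  the martingale identity backwards again.\<close>

lemma stoch_int_martingale:
  fixes Z :: "nat \<Rightarrow> 'a \<Rightarrow> real ^ 'd"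
  assumes F: "discrete_filtration M F T" and Z: "is_martingale M F T Z"
    and \<eta>: "\<And>s. s < T \<Longrightarrow> \<eta> s \<in> borel_measurable (F s)"
    and Y: "integrable M Y" "AE x in M. Y x \<le> stoch_int \<eta> Z T x"
    and t: "t \<le> T"
  shows "integrable M (stoch_int \<eta> Z t)"
    and "AE x in M. real_cond_exp M (F t) (stoch_int \<eta> Z T) x = stoch_int \<eta> Z t x"
proof -
  have ZF: "Z s \<in> borel_measurable (F s)" if "s \<le> T" for s using Z that by (auto simp: is_martingale_def)
  have WF: "stoch_int \<eta> Z t \<in> borel_measurable (F t)" if "t \<le> T" for t
    using that by (intro stoch_int_measurable[OF F ZF \<eta>]) auto
  have lower: "\<exists>Y. integrable M Y \<and> (AE x in M. Y x \<le> stoch_int \<eta> Z t x)" if "t \<le> T" for t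
    using that
  proof (induction t rule: inc_induct)
    case base then show ?case using Y by blast
  next
    case (step t)
    interpret S: finite_measure_subalgebra M "F t" using filtration_subalgebra[OF F] step by simp
    obtain Y where Y: "integrable M Y" "AE x in M. Y x \<le> stoch_int \<eta> Z (Suc t) x" using step.IH by blast
    have "AE x in M. real_cond_exp M (F t) Y x \<le> stoch_int \<eta> Z t x"
      using step Y by (intro S.one_step_lower_bound[OF martingale_increment[OF F Z] WF \<eta>])
        (auto simp: stoch_int_Suc)
    with S.real_cond_exp_int(1)[OF Y(1)] show ?case by blast
  qed
  have int: "integrable M (stoch_int \<eta> Z t)" if "t \<le> T" for t
    using that
  proof (induction t)
    case (Suc t)
    interpret S: finite_measure_subalgebra M "F t" using filtration_subalgebra[OF F] Suc by simp
    obtain Y where Y: "integrable M Y" "AE x in M. Y x \<le> stoch_int \<eta> Z (Suc t) x" using lower Suc by blast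
    have W: "integrable M (stoch_int \<eta> Z t)" using Suc by simp
    have "integrable M (\<lambda>x. \<eta> t x \<bullet> (Z (Suc t) x - Z t x))"
    proof (rule S.one_step_integrable[OF martingale_increment[OF F Z] \<eta>])
      show "integrable M (\<lambda>x. Y x - stoch_int \<eta> Z t x)" using Y W by simp
      show "AE x in M. Y x - stoch_int \<eta> Z t x \<le> \<eta> t x \<bullet> (Z (Suc t) x - Z t x)"
        using Y(2) by eventually_elim (simp add: stoch_int_Suc)
    qed (use Suc in auto)
    with W show ?case unfolding stoch_int_Suc by (rule Bochner_Integration.integrable_add)
  qed simp
  show "integrable M (stoch_int \<eta> Z t)" using int t .
  show "AE x in M. real_cond_exp M (F t) (stoch_int \<eta> Z T) x = stoch_int \<eta> Z t x"
    using t
  proof (induction t rule: inc_induct)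
    case base
    interpret S: finite_measure_subalgebra M "F T" using filtration_subalgebra[OF F] by simp
    show ?case by (rule S.real_cond_exp_F_meas[OF int WF]) simp_all
  next
    case (step t)
    interpret S: finite_measure_subalgebra M "F t" using filtration_subalgebra[OF F] step by simp
    have W: "integrable M (stoch_int \<eta> Z t)" "integrable M (stoch_int \<eta> Z (Suc t))" using int step by auto
    have i: "integrable M (\<lambda>x. \<eta> t x \<bullet> (Z (Suc t) x - Z t x))"
      using Bochner_Integration.integrable_diff[OF W(2,1)] by (simp add: stoch_int_Suc)
    have 1: "AE x in M. real_cond_exp M (F t) (stoch_int \<eta> Z (Suc t)) x = stoch_int \<eta> Z t x"
      using S.real_cond_exp_add[OF W(1) i] S.real_cond_exp_F_meas[OF W(1) WF]
        S.real_cond_exp_inner_zero(1)[OF martingale_increment[OF F Z] \<eta> i] step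
      by (auto simp: stoch_int_Suc)
    have 2: "AE x in M. real_cond_exp M (F t) (real_cond_exp M (F (Suc t)) (stoch_int \<eta> Z T)) x
        = real_cond_exp M (F t) (stoch_int \<eta> Z T) x"
      using F step int by (intro S.real_cond_exp_nested_subalg) (auto simp: discrete_filtration_def)
    have 3: "AE x in M. real_cond_exp M (F t) (real_cond_exp M (F (Suc t)) (stoch_int \<eta> Z T)) x
        = real_cond_exp M (F t) (stoch_int \<eta> Z (Suc t)) x"
      using step W by (intro S.real_cond_exp_cong) auto
    from 1 2 3 show ?case by eventually_elim simp
  qed
qed

end

section \<open>The Kreps--Yan theorem\<close>

definition L2 :: "'a measure \<Rightarrow> ('a \<Rightarrow> 'b::euclidean_space) set" where
  "L2 M = {f \<in> borel_measurable M. integrable M (\<lambda>x. (norm (f x))\<^sup>2)}"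

abbreviation sqdist :: "'a measure \<Rightarrow> ('a \<Rightarrow> 'b::euclidean_space) \<Rightarrow> ('a \<Rightarrow> 'b) \<Rightarrow> real" where
  "sqdist M f g \<equiv> \<integral>x. (norm (f x - g x))\<^sup>2 \<partial>M"

abbreviation pairing :: "'a measure \<Rightarrow> ('a \<Rightarrow> 'b::euclidean_space) \<Rightarrow> ('a \<Rightarrow> 'b) \<Rightarrow> real" where
  "pairing M f g \<equiv> \<integral>x. f x \<bullet> g x \<partial>M"

lemma L2_measurable [measurable_dest]: "f \<in> L2 M \<Longrightarrow> f \<in> borel_measurable M"
  and L2_integrable: "f \<in> L2 M \<Longrightarrow> integrable M (\<lambda>x. (norm (f x))\<^sup>2)"
  by (auto simp: L2_def)

lemma L2_inner:
  assumes "f \<in> L2 M" "g \<in> L2 M"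
  shows "integrable M (\<lambda>x. f x \<bullet> g x)"
proof (rule Bochner_Integration.integrable_bound)
  show "integrable M (\<lambda>x. (norm (f x))\<^sup>2 + (norm (g x))\<^sup>2)" using assms by (auto simp: L2_def)
  show "(\<lambda>x. f x \<bullet> g x) \<in> borel_measurable M" using assms by (auto simp: L2_def)
  show "AE x in M. norm (f x \<bullet> g x) \<le> norm ((norm (f x))\<^sup>2 + (norm (g x))\<^sup>2)"
  proof (intro AE_I2)
    fix x
    have "\<bar>f x \<bullet> g x\<bar> \<le> norm (f x) * norm (g x)" by (rule Cauchy_Schwarz_ineq2)
    also have "\<dots> \<le> (norm (f x))\<^sup>2 + (norm (g x))\<^sup>2"
      using sum_squares_bound[of "norm (f x)" "norm (g x)"] mult_nonneg_nonneg[of "norm (f x)" "norm (g x)"]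
      unfolding mult.assoc by (smt (verit) norm_ge_zero)
    finally show "norm (f x \<bullet> g x) \<le> norm ((norm (f x))\<^sup>2 + (norm (g x))\<^sup>2)" by simp
  qed
qed

lemma norm_add_scaleR_square: "(norm (x + t *\<^sub>R y))\<^sup>2 = (norm x)\<^sup>2 + 2 * t * (x \<bullet> y) + t\<^sup>2 * (norm y)\<^sup>2"
  unfolding power2_norm_eq_inner
  by (simp add: inner_add_left inner_add_right inner_commute[of y x] power2_eq_square algebra_simps)

lemma L2_add_scaleR:
  assumes "f \<in> L2 M" "g \<in> L2 M"
  shows "(\<lambda>x. f x + t *\<^sub>R g x) \<in> L2 M"
    and "(\<integral>x. (norm (f x + t *\<^sub>R g x))\<^sup>2 \<partial>M)
      = (\<integral>x. (norm (f x))\<^sup>2 \<partial>M) + 2 * t * pairing M f g + t\<^sup>2 * (\<integral>x. (norm (g x))\<^sup>2 \<partial>M)"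
  using assms L2_inner[OF assms] by (auto simp: L2_def norm_add_scaleR_square)

lemma L2_zero [simp]: "(\<lambda>_. 0) \<in> L2 M"
  by (simp add: L2_def)

lemma L2_scaleR: "f \<in> L2 M \<Longrightarrow> (\<lambda>x. t *\<^sub>R f x) \<in> L2 M"
  using L2_add_scaleR(1)[OF L2_zero, of f M t] by simp

lemma L2_add: "f \<in> L2 M \<Longrightarrow> g \<in> L2 M \<Longrightarrow> (\<lambda>x. f x + g x) \<in> L2 M"
  using L2_add_scaleR(1)[of f M g 1] by simp

lemma L2_diff: "f \<in> L2 M \<Longrightarrow> g \<in> L2 M \<Longrightarrow> (\<lambda>x. f x - g x) \<in> L2 M"
  using L2_add_scaleR(1)[of f M g "-1"] by simp

lemma L2_sum: "(\<And>i. i \<in> I \<Longrightarrow> f i \<in> L2 M) \<Longrightarrow> (\<lambda>x. \<Sum>i\<in>I. f i x) \<in> L2 M"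
  by (induction I rule: infinite_finite_induct) (auto intro: L2_add)

context finite_measure
begin

lemma L2_bounded:
  assumes "f \<in> borel_measurable M" "\<And>x. norm (f x) \<le> B"
  shows "f \<in> L2 M"
  using assms by (auto simp: L2_def intro!: integrable_const_bound[of _ "B\<^sup>2"] AE_I2 power_mono)

text \<open>Rests on x \<le> a + x^2 / a. The free parameter replaces a square root: a is fixed
  small first, then the squared distance is made small relative to a.\<close>

lemma L2_L1:
  assumes f: "f \<in> L2 M" and a: "a > 0"
  shows "integrable M f"
    and "(\<integral>x. norm (f x) \<partial>M) \<le> a * measure M (space M) + (\<integral>x. (norm (f x))\<^sup>2 \<partial>M) / a"
proof -
  have le: "x \<le> a + x\<^sup>2 / a" for x :: real
  proof (cases "x \<le> a")
    case True then show ?thesis using a by (simp add: add_increasing2)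
  next
    case False
    then have "x * a \<le> x * x" using a by (intro mult_left_mono) auto
    then have "x \<le> x\<^sup>2 / a" using a by (simp add: field_simps power2_eq_square)
    then show ?thesis using a by linarith
  qed
  have i: "integrable M (\<lambda>x. a + (norm (f x))\<^sup>2 / a)" using L2_integrable[OF f] by simp
  show i2: "integrable M f"
  proof (rule Bochner_Integration.integrable_bound[OF i])
    show "AE x in M. norm (f x) \<le> norm (a + (norm (f x))\<^sup>2 / a)"
      using le a by (auto intro!: AE_I2 order_trans[OF le])
  qed (use f in measurable)
  have "(\<integral>x. norm (f x) \<partial>M) \<le> (\<integral>x. a + (norm (f x))\<^sup>2 / a \<partial>M)"
    using i i2 le by (intro integral_mono) auto
  also have "\<dots> = a * measure M (space M) + (\<integral>x. (norm (f x))\<^sup>2 \<partial>M) / a"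
    using L2_integrable[OF f] by simp
  finally show "(\<integral>x. norm (f x) \<partial>M) \<le> a * measure M (space M) + (\<integral>x. (norm (f x))\<^sup>2 \<partial>M) / a" .
qed

text \<open>Closeness in L2 gives closeness in L1, hence a subsequence converging a.e. to some g,
  and Fatou's lemma along it bounds the L2 distance to g. The subsequence is part of the conclusion
  because later arguments also use the pointwise limit.\<close>

lemma L2_complete:
  fixes f :: "nat \<Rightarrow> 'a \<Rightarrow> 'b::euclidean_space"
  assumes f: "\<And>n. f n \<in> L2 M"
    and C: "\<And>e. e > 0 \<Longrightarrow> \<exists>N. \<forall>m\<ge>N. \<forall>n\<ge>N. sqdist M (f m) (f n) \<le> e"
  obtains g r where "g \<in> L2 M" "strict_mono r" "AE x in M. (\<lambda>n. f (r n) x) \<longlonglongrightarrow> g x"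
    "\<And>e. e > 0 \<Longrightarrow> \<exists>N. \<forall>n\<ge>N. sqdist M (f n) g \<le> e"
proof -
  have d: "(\<lambda>x. f m x - f n x) \<in> L2 M" for m n by (intro L2_diff f)
  note [measurable] = L2_measurable[OF f]
  have L1: "\<exists>N. \<forall>i\<ge>N. \<forall>j\<ge>N. (\<integral>x. norm (f i x - f j x) \<partial>M) < e" if e: "e > 0" for e :: real
  proof -
    define \<mu> where "\<mu> = measure M (space M)"
    define a where "a = e / (3 * (\<mu> + 1))"
    have mu: "\<mu> \<ge> 0" by (simp add: \<mu>_def)
    have a: "a > 0" "a * \<mu> \<le> e / 3" using e mu by (auto simp: a_def field_simps)
    obtain N where N: "\<forall>m\<ge>N. \<forall>n\<ge>N. sqdist M (f m) (f n) \<le> a * (e / 3)"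
      using C[of "a * (e / 3)"] a e by auto
    show ?thesis
    proof (intro exI[of _ N] allI impI)
      fix i j assume "i \<ge> N" "j \<ge> N"
      then have "sqdist M (f i) (f j) / a \<le> e / 3"
        using N a(1) by (auto simp: field_simps)
      with L2_L1(2)[OF d a(1), of i j] a(2) e show "(\<integral>x. norm (f i x - f j x) \<partial>M) < e"
        unfolding \<mu>_def by linarith
    qed
  qed
  obtain r where r: "strict_mono r" "AE x in M. Cauchy (\<lambda>i. f (r i) x)"
    using cauchy_L1_AE_cauchy_subseq[of M f] L2_L1(1)[OF f zero_less_one] L1 by blast
  define g where "g x = lim (\<lambda>i. f (r i) x)" for x
  have gm [measurable]: "g \<in> borel_measurable M" unfolding g_def by measurable
  have AEg: "AE x in M. (\<lambda>i. f (r i) x) \<longlonglongrightarrow> g x"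
    using r(2) by eventually_elim (simp add: g_def Cauchy_convergent_iff convergent_LIMSEQ_iff)
  have fat: "integrable M (\<lambda>x. (norm (f n x - g x))\<^sup>2) \<and> sqdist M (f n) g \<le> e"
    if N: "\<forall>m\<ge>N. \<forall>n\<ge>N. sqdist M (f m) (f n) \<le> e" and n: "n \<ge> N" for n N e
  proof (intro conjI)
    have rN: "r (i + N) \<ge> N" for i using seq_suble[OF r(1), of "i + N"] by linarith
    have lim: "AE x in M. (\<lambda>i. (norm (f n x - f (r (i + N)) x))\<^sup>2) \<longlonglongrightarrow> (norm (f n x - g x))\<^sup>2"
      using AEg by eventually_elim (intro tendsto_intros LIMSEQ_ignore_initial_segment)
    note * = integrable_Fatou[where f = "\<lambda>i x. (norm (f n x - f (r (i + N)) x))\<^sup>2" and B = e,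
        OF L2_integrable[OF d] AE_I2[OF zero_le_power2] _ _ lim]
    show "integrable M (\<lambda>x. (norm (f n x - g x))\<^sup>2)" "sqdist M (f n) g \<le> e"
      using n N rN by (auto intro!: *)
  qed
  obtain N where N: "\<forall>m\<ge>N. \<forall>n\<ge>N. sqdist M (f m) (f n) \<le> 1" using C[of 1] by auto
  have "(\<lambda>x. f N x - g x) \<in> L2 M" using fat[OF N order_refl] by (simp add: L2_def)
  from L2_diff[OF f[of N] this] have "g \<in> L2 M" by simp
  moreover have "\<exists>N. \<forall>n\<ge>N. sqdist M (f n) g \<le> e" if "e > 0" for e
    using C[OF that] fat by meson
  ultimately show ?thesis using that r(1) AEg by blast
qed

text \<open>The parallelogram identity makes a minimising sequence Cauchy, since midpoints stay in
  K. Perturbing the minimiser p to p + t k and to p - t p gives the two inequalities; together they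
  say that the residual is orthogonal to p.\<close>

lemma L2_projection:
  assumes K: "K \<subseteq> L2 M" and K0: "(\<lambda>_. 0) \<in> K"
    and add: "\<And>f g. f \<in> K \<Longrightarrow> g \<in> K \<Longrightarrow> (\<lambda>x. f x + g x) \<in> K"
    and scale: "\<And>f c. f \<in> K \<Longrightarrow> 0 \<le> c \<Longrightarrow> (\<lambda>x. c *\<^sub>R f x) \<in> K"
    and closed: "\<And>f. f \<in> L2 M \<Longrightarrow> (\<And>e. e > 0 \<Longrightarrow> \<exists>g\<in>K. sqdist M f g \<le> e) \<Longrightarrow> f \<in> K"
    and h: "h \<in> L2 M"
  obtains p where "p \<in> K" "\<And>k. k \<in> K \<Longrightarrow> (\<integral>x. (h x - p x) \<bullet> k x \<partial>M) \<le> 0" "0 \<le> (\<integral>x. (h x - p x) \<bullet> p x \<partial>M)"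
proof -
  define \<Phi> where "\<Phi> k = sqdist M h k" for k
  define \<delta> where "\<delta> = Inf (\<Phi> ` K)"
  have \<Phi>0: "0 \<le> \<Phi> k" for k unfolding \<Phi>_def by simp
  have \<delta>: "\<delta> \<le> \<Phi> k" if "k \<in> K" for k
    unfolding \<delta>_def using that \<Phi>0 by (intro cInf_lower bdd_belowI[of _ 0]) auto
  have "\<exists>k\<in>K. \<Phi> k < \<delta> + 1 / real (Suc n)" for n
    using cInf_lessD[of "\<Phi> ` K" "\<delta> + 1 / real (Suc n)"] K0 by (auto simp: \<delta>_def)
  then obtain b where b: "\<And>n. b n \<in> K" "\<And>n. \<Phi> (b n) < \<delta> + 1 / real (Suc n)" by metis
  have bL: "b n \<in> L2 M" for n using b K by blast
  have hb: "(\<lambda>x. h x - b n x) \<in> L2 M" for n by (intro L2_diff h bL)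
  have par: "sqdist M (b m) (b n) \<le> 2 / real (Suc m) + 2 / real (Suc n)" for m n
  proof -
    have "(\<lambda>x. (1/2) *\<^sub>R (b m x + b n x)) \<in> K" by (intro scale add b) simp
    from \<delta>[OF this] have mid: "\<delta> \<le> \<Phi> (\<lambda>x. (1/2) *\<^sub>R (b m x + b n x))" .
    have id: "(norm (b m x - b n x))\<^sup>2 = 2 * (norm (h x - b m x))\<^sup>2 + 2 * (norm (h x - b n x))\<^sup>2
        - 4 * (norm (h x - (1/2) *\<^sub>R (b m x + b n x)))\<^sup>2" for x
      by (simp add: power2_norm_eq_inner inner_add_left inner_add_right inner_diff_left inner_diff_right
          inner_commute algebra_simps)
    have "(\<lambda>x. h x - (1/2) *\<^sub>R (b m x + b n x)) \<in> L2 M" by (intro L2_diff L2_scaleR L2_add h bL)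
    note i = L2_integrable[OF this] L2_integrable[OF hb]
    have "sqdist M (b m) (b n) = 2 * \<Phi> (b m) + 2 * \<Phi> (b n) - 4 * \<Phi> (\<lambda>x. (1/2) *\<^sub>R (b m x + b n x))"
      unfolding id \<Phi>_def using i by simp
    with mid b(2)[of m] b(2)[of n] show ?thesis by simp
  qed
  obtain p r where p: "p \<in> L2 M" "strict_mono r" "AE x in M. (\<lambda>n. b (r n) x) \<longlonglongrightarrow> p x"
    "\<And>e. e > 0 \<Longrightarrow> \<exists>N. \<forall>n\<ge>N. sqdist M (b n) p \<le> e"
  proof (rule L2_complete[of b])
    fix e :: real assume e: "e > 0"
    then obtain N where N: "inverse (real (Suc N)) < e / 4" using reals_Archimedean[of "e / 4"] by auto
    have "2 / real (Suc m) \<le> e / 2" if "m \<ge> N" for m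
    proof -
      have "2 / real (Suc m) \<le> 2 / real (Suc N)" using that by (intro divide_left_mono) auto
      with N show ?thesis by (simp add: inverse_eq_divide)
    qed
    then show "\<exists>N. \<forall>m\<ge>N. \<forall>n\<ge>N. sqdist M (b m) (b n) \<le> e"
      using par by (intro exI[of _ N]) (smt (verit) field_sum_of_halves)
  qed (use bL in auto)
  have pK: "p \<in> K"
  proof (rule closed[OF p(1)])
    fix e :: real assume "e > 0"
    from p(4)[OF this] b(1) show "\<exists>g\<in>K. sqdist M p g \<le> e"
      by (metis (no_types, lifting) norm_minus_commute order_refl Bochner_Integration.integral_cong)
  qed
  have hp: "(\<lambda>x. h x - p x) \<in> L2 M" by (intro L2_diff h p)
  have min: "\<Phi> p \<le> \<delta>"
  proof (rule field_le_epsilon)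
    fix e :: real assume e: "e > 0"
    then obtain N where N: "inverse (real (Suc N)) < e" using reals_Archimedean by blast
    show "\<Phi> p \<le> \<delta> + e"
      unfolding \<Phi>_def
    proof (rule integrable_Fatou(2)[where f = "\<lambda>i x. (norm (h x - b (r (i + N)) x))\<^sup>2"])
      show "AE x in M. (\<lambda>i. (norm (h x - b (r (i + N)) x))\<^sup>2) \<longlonglongrightarrow> (norm (h x - p x))\<^sup>2"
        using p(3) by eventually_elim (intro tendsto_intros LIMSEQ_ignore_initial_segment)
      show "(\<integral>x. (norm (h x - b (r (i + N)) x))\<^sup>2 \<partial>M) \<le> \<delta> + e" for i
      proof -
        have "r (i + N) \<ge> N" using seq_suble[OF p(2), of "i + N"] by linarith
        then have "1 / real (Suc (r (i + N))) \<le> 1 / real (Suc N)" by (intro divide_left_mono) auto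
        with b(2)[of "r (i + N)"] N show ?thesis by (simp add: \<Phi>_def inverse_eq_divide)
      qed
    qed (use hb L2_integrable[OF hb] L2_measurable[OF hp] in auto)
  qed
  have var: "sqdist M h p \<le> (\<integral>x. (norm ((h x - p x) + t *\<^sub>R k x))\<^sup>2 \<partial>M)"
    if "(\<lambda>x. p x - t *\<^sub>R k x) \<in> K" for t k
    using \<delta>[OF that] min by (simp add: \<Phi>_def algebra_simps)
  have lim0: "c \<le> 0" if "\<And>t. 0 < t \<Longrightarrow> t < 1 \<Longrightarrow> 2 * c \<le> t * d" for c d :: real
  proof -
    have "((\<lambda>t. t * d) \<longlongrightarrow> 0 * d) (at_right 0)" by (intro tendsto_intros)
    moreover have "eventually (\<lambda>t. 2 * c \<le> t * d) (at_right (0::real))"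
      unfolding eventually_at_right_field using that by (intro exI[of _ 1]) auto
    ultimately have "2 * c \<le> 0 * d" by (intro tendsto_lowerbound) auto
    then show ?thesis by simp
  qed
  have le: "(\<integral>x. (h x - p x) \<bullet> k x \<partial>M) \<le> 0" if k: "k \<in> K" for k
  proof (rule lim0)
    fix t :: real assume t: "0 < t"
    have kL: "k \<in> L2 M" using k K by blast
    have "(\<lambda>x. p x - (- t) *\<^sub>R k x) \<in> K" using add[OF pK scale[OF k, of t]] t by simp
    from var[OF this] have "t * (2 * (\<integral>x. (h x - p x) \<bullet> k x \<partial>M)) \<le> t * (t * (\<integral>x. (norm (k x))\<^sup>2 \<partial>M))"
      unfolding L2_add_scaleR(2)[OF hp kL] by (simp add: power2_eq_square mult_ac)
    with t show "2 * (\<integral>x. (h x - p x) \<bullet> k x \<partial>M) \<le> t * (\<integral>x. (norm (k x))\<^sup>2 \<partial>M)" by simp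
  qed
  have "- (\<integral>x. (h x - p x) \<bullet> p x \<partial>M) \<le> 0"
  proof (rule lim0)
    fix t :: real assume t: "0 < t" "t < 1"
    have "(\<lambda>x. p x - t *\<^sub>R p x) \<in> K" using scale[OF pK, of "1 - t"] t by (simp add: scaleR_left_diff_distrib)
    from var[OF this] have "t * (2 * - (\<integral>x. (h x - p x) \<bullet> p x \<partial>M)) \<le> t * (t * (\<integral>x. (norm (p x))\<^sup>2 \<partial>M))"
      unfolding L2_add_scaleR(2)[OF hp p(1)] by (simp add: power2_eq_square mult_ac)
    then show "2 * - (\<integral>x. (h x - p x) \<bullet> p x \<partial>M) \<le> t * (\<integral>x. (norm (p x))\<^sup>2 \<partial>M)"
      unfolding mult_le_cancel_left_pos[OF t(1)] .
  qed
  with le pK show ?thesis using that[of p] by simp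
qed

end

section \<open>Dual cones and separation\<close>

definition dual_cone :: "'a measure \<Rightarrow> ('a \<Rightarrow> real ^ 'd) set \<Rightarrow> ('a \<Rightarrow> real ^ 'd) set" where
  "dual_cone M B = {z \<in> L2 M. (AE x in M. \<forall>i. 0 \<le> z x $ i) \<and> (\<forall>b\<in>B \<inter> L2 M. pairing M z b \<le> 0)}"

abbreviation dist_prob :: "'a measure \<Rightarrow> real \<Rightarrow> ('a \<Rightarrow> 'b::euclidean_space) \<Rightarrow> ('a \<Rightarrow> 'b) \<Rightarrow> real" where
  "dist_prob M e f g \<equiv> measure M {x\<in>space M. dist (f x) (g x) > e}"

lemma sum_half_powers: "m \<le> k \<Longrightarrow> (\<Sum>n\<in>{m..<k}. (1/2) ^ n) = 2 * (1/2) ^ m - 2 * (1/2 :: real) ^ k"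
  by (induction k rule: dec_induct) simp_all

lemma dual_cone_add:
  assumes "y \<in> dual_cone M B" "z \<in> dual_cone M B"
  shows "(\<lambda>x. y x + z x) \<in> dual_cone M B"
proof -
  have "(\<integral>x. (y x + z x) \<bullet> b x \<partial>M) \<le> 0" if "b \<in> B \<inter> L2 M" for b
  proof -
    have "(\<integral>x. (y x + z x) \<bullet> b x \<partial>M) = pairing M y b + pairing M z b"
      using assms that by (simp add: inner_add_left dual_cone_def L2_inner)
    moreover have "pairing M y b \<le> 0" "pairing M z b \<le> 0"
      using assms that unfolding dual_cone_def by blast+
    ultimately show ?thesis by linarith
  qed
  with assms show ?thesis by (auto simp: dual_cone_def L2_add)
qed

context finite_measure
begin

lemma L2_limit_inner_le:
  assumes f: "\<And>n. f n \<in> L2 M" "\<And>n. pairing M (f n) b \<le> 0" and g: "g \<in> L2 M" and b: "b \<in> L2 M"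
    and lim: "\<And>e. e > 0 \<Longrightarrow> \<exists>n. sqdist M (f n) g \<le> e"
  shows "pairing M g b \<le> 0"
proof (rule field_le_epsilon)
  fix e :: real assume e: "e > 0"
  define B where "B = (\<integral>x. (norm (b x))\<^sup>2 \<partial>M)"
  have B: "0 \<le> B" by (simp add: B_def)
  \<comment> \<open>Expanding the square of (f n - g) + a b bounds the pairing of the error with b
    from below. With squared error at most a^2 every term carries a factor a, and a (B + 1) = e
    remains.\<close>
  define a where "a = e / (B + 1)"
  have a: "a > 0" "a * (B + 1) = e" using e B by (auto simp: a_def)
  obtain n where n: "sqdist M (f n) g \<le> a\<^sup>2"
    using lim[of "a\<^sup>2"] a by auto
  have d: "(\<lambda>x. f n x - g x) \<in> L2 M" by (intro L2_diff f g)
  have "0 \<le> (\<integral>x. (norm ((f n x - g x) + a *\<^sub>R b x))\<^sup>2 \<partial>M)" by simp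
  also have "\<dots> \<le> a\<^sup>2 + 2 * a * (\<integral>x. (f n x - g x) \<bullet> b x \<partial>M) + a\<^sup>2 * B"
    unfolding L2_add_scaleR(2)[OF d b] B_def using n by simp
  also have "\<dots> = a * (a * (B + 1) + 2 * (\<integral>x. (f n x - g x) \<bullet> b x \<partial>M))"
    by (simp add: power2_eq_square algebra_simps)
  finally have "0 \<le> e + 2 * (\<integral>x. (f n x - g x) \<bullet> b x \<partial>M)"
    using a by (simp add: zero_le_mult_iff)
  moreover have "(\<integral>x. (f n x - g x) \<bullet> b x \<partial>M) = pairing M (f n) b - pairing M g b"
    by (simp add: inner_diff_left L2_inner[OF f(1) b] L2_inner[OF g b])
  ultimately show "pairing M g b \<le> 0 + e" using f(2)[of n] e by linarith
qed

text \<open>The element is a weighted series of the z n. As all terms are nonnegative it dominates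
  each of them, so it is positive wherever any of them is.\<close>

lemma dual_cone_countable_sum:
  assumes z: "\<And>n::nat. z n \<in> dual_cone M B"
  obtains y where "y \<in> dual_cone M B" "\<And>n. AE x in M. \<forall>i. 0 < z n x $ i \<longrightarrow> 0 < y x $ i"
proof -
  have zL: "z n \<in> L2 M" for n using z by (auto simp: dual_cone_def)
  define I where "I n = (\<integral>x. (norm (z n x))\<^sup>2 \<partial>M)" for n
  have I: "0 \<le> I n" for n by (simp add: I_def)
  \<comment> \<open>Both c n and c n * I n are at most (1/2)^n. Splitting c n into two square roots,
    Cauchy-Schwarz bounds the squared tail by the product of the sums of these two
    sequences.\<close>
  define c where "c n = (1/2) ^ n / (1 + I n)" for n
  have c: "0 < c n" "c n \<le> (1/2) ^ n" "c n * I n \<le> (1/2) ^ n" for n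
    using I[of n] by (auto simp: c_def field_simps add_pos_nonneg)
  define S where "S m x = (\<Sum>n<m. c n *\<^sub>R z n x)" for m x
  have SL: "S m \<in> L2 M" for m unfolding S_def by (intro L2_sum L2_scaleR zL)
  have zAE: "AE x in M. \<forall>n i. 0 \<le> z n x $ i"
    unfolding AE_all_countable[where 'i=nat] using z by (auto simp: dual_cone_def)
  have Cau: "sqdist M (S m) (S k) \<le> 4 * (1/2) ^ m" if "m \<le> k" for m k
  proof -
    have half: "(\<Sum>n\<in>{m..<k}. (1/2) ^ n) \<le> 2 * (1/2 :: real) ^ m"
      using sum_half_powers[OF that] by simp
    have "S k x - S m x = (\<Sum>n\<in>{m..<k}. c n *\<^sub>R z n x)" for x
      unfolding S_def using sum_diff_nat_ivl[of 0 m k "\<lambda>n. c n *\<^sub>R z n x"] that by (simp add: atLeast0LessThan)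
    then have "norm (S m x - S k x) \<le> (\<Sum>n\<in>{m..<k}. sqrt (c n) * (sqrt (c n) * norm (z n x)))" for x
      using norm_sum[of "\<lambda>n. c n *\<^sub>R z n x" "{m..<k}"] c(1)
      by (simp add: norm_minus_commute[of "S m x"] less_imp_le flip: mult.assoc)
    then have "(norm (S m x - S k x))\<^sup>2 \<le> (\<Sum>n\<in>{m..<k}. sqrt (c n) * (sqrt (c n) * norm (z n x)))\<^sup>2" for x
      by (intro power_mono) auto
    also have "\<dots> x \<le> (\<Sum>n\<in>{m..<k}. (sqrt (c n))\<^sup>2) * (\<Sum>n\<in>{m..<k}. (sqrt (c n) * norm (z n x))\<^sup>2)" for x
      by (rule Cauchy_Schwarz_ineq_sum)
    finally have le: "(norm (S m x - S k x))\<^sup>2 \<le> (\<Sum>n\<in>{m..<k}. c n) * (\<Sum>n\<in>{m..<k}. c n * (norm (z n x))\<^sup>2)" for x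
      using c(1) by (simp add: power_mult_distrib less_imp_le)
    have i: "integrable M (\<lambda>x. c n * (norm (z n x))\<^sup>2)" for n using L2_integrable[OF zL] by simp
    have "sqdist M (S m) (S k)
        \<le> (\<integral>x. (\<Sum>n\<in>{m..<k}. c n) * (\<Sum>n\<in>{m..<k}. c n * (norm (z n x))\<^sup>2) \<partial>M)"
      using L2_integrable[OF L2_diff[OF SL SL]] i le by (intro integral_mono) auto
    also have "\<dots> = (\<Sum>n\<in>{m..<k}. c n) * (\<Sum>n\<in>{m..<k}. c n * I n)"
      using i L2_integrable[OF zL] by (simp add: I_def)
    also have "\<dots> \<le> (2 * (1/2) ^ m) * 2"
    proof (rule mult_mono)
      show "(\<Sum>n\<in>{m..<k}. c n) \<le> 2 * (1/2) ^ m" by (rule order_trans[OF sum_mono half]) (rule c(2))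
      have "(\<Sum>n\<in>{m..<k}. c n * I n) \<le> 2 * (1/2) ^ m" by (rule order_trans[OF sum_mono half]) (rule c(3))
      also have "\<dots> \<le> 2" by (simp add: power_le_one)
      finally show "(\<Sum>n\<in>{m..<k}. c n * I n) \<le> 2" .
    qed (use c(1) I in \<open>auto intro!: sum_nonneg mult_nonneg_nonneg simp: less_imp_le\<close>)
    finally show ?thesis by simp
  qed
  obtain y r where y: "y \<in> L2 M" "strict_mono r" "AE x in M. (\<lambda>n. S (r n) x) \<longlonglongrightarrow> y x"
    "\<And>e. e > 0 \<Longrightarrow> \<exists>N. \<forall>n\<ge>N. sqdist M (S n) y \<le> e"
  proof (rule L2_complete[of S])
    fix e :: real assume e: "e > 0"
    have "\<exists>N. (1/2 :: real) ^ N < e / 4" using e by (intro real_arch_pow_inv) auto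
    then obtain N where N: "(1/2 :: real) ^ N < e / 4" by blast
    have *: "sqdist M (S m) (S k) \<le> e" if "m \<le> k" "m \<ge> N" for m k
    proof -
      have "(1/2 :: real) ^ m \<le> (1/2) ^ N" using that by (intro power_decreasing) auto
      with Cau[OF that(1)] N show ?thesis by linarith
    qed
    show "\<exists>N. \<forall>m\<ge>N. \<forall>n\<ge>N. sqdist M (S m) (S n) \<le> e"
    proof (intro exI[of _ N] allI impI)
      fix m n assume "m \<ge> N" "n \<ge> N"
      with *[of m n] *[of n m] show "sqdist M (S m) (S n) \<le> e"
        by (cases "m \<le> n") (simp_all add: norm_minus_commute[of "S m _"])
    qed
  qed (use SL in auto)
  have dom: "AE x in M. \<forall>n i. c n * z n x $ i \<le> y x $ i"
    using zAE y(3)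
  proof eventually_elim
    case (elim x)
    show ?case
    proof (intro allI)
      fix n i
      have "(\<lambda>k. S (r k) x $ i) \<longlonglongrightarrow> y x $ i" by (intro tendsto_intros elim)
      moreover have "c n * z n x $ i \<le> S (r k) x $ i" if "k \<ge> Suc n" for k
      proof -
        have "n < r k" using seq_suble[OF y(2), of k] that by linarith
        then have "c n * z n x $ i \<le> (\<Sum>j<r k. c j * z j x $ i)"
          using elim(1) c(1) by (intro member_le_sum) (auto simp: less_imp_le)
        then show ?thesis by (simp add: S_def)
      qed
      ultimately show "c n * z n x $ i \<le> y x $ i" by (intro LIMSEQ_le_const) blast+
    qed
  qed
  show ?thesis
  proof (rule that[of y])
    show "AE x in M. \<forall>i. 0 < z n x $ i \<longrightarrow> 0 < y x $ i" for n
      using dom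
    proof eventually_elim
      case (elim x)
      show ?case
      proof (intro allI impI)
        fix i assume "0 < z n x $ i"
        with c(1)[of n] have "0 < c n * z n x $ i" by simp
        also have "\<dots> \<le> y x $ i" using elim by blast
        finally show "0 < y x $ i" .
      qed
    qed
    have "pairing M y b \<le> 0" if b: "b \<in> B \<inter> L2 M" for b
    proof (rule L2_limit_inner_le[of S, OF SL _ y(1)])
      show "pairing M (S m) b \<le> 0" for m
      proof -
        have "pairing M (S m) b = (\<Sum>n<m. c n * pairing M (z n) b)"
          using L2_inner[OF zL, of b] b by (simp add: S_def inner_sum_left)
        also have "\<dots> \<le> 0"
          using z b c(1) by (intro sum_nonpos mult_nonneg_nonpos) (auto simp: dual_cone_def less_imp_le)
        finally show ?thesis .
      qed
      show "\<exists>n. sqdist M (S n) y \<le> e" if "e > 0" for e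
        using y(4)[OF that] by blast
    qed (use b in auto)
    moreover have "AE x in M. \<forall>i. 0 \<le> y x $ i"
      using dom zAE
    proof eventually_elim
      case (elim x)
      show ?case
      proof
        fix i
        have "0 \<le> c 0 * z 0 x $ i" using c(1)[of 0] elim(2) by simp
        also have "\<dots> \<le> y x $ i" using elim(1) by blast
        finally show "0 \<le> y x $ i" .
      qed
    qed
    ultimately show "y \<in> dual_cone M B" using y(1) by (auto simp: dual_cone_def)
  qed
qed

end

context prob_space
begin

text \<open>Separation handles one nonnegative nonzero h at a time: the residual of h after
  projection is an element of the dual cone that charges h. Exhaustion then yields one element
  positive in all coordinates: a maximiser of the total probability of positivity exists, and a
  coordinate that failed to be positive could be improved by adding a separator.\<close>

lemma Kreps_Yan:
  fixes B :: "('a \<Rightarrow> real ^ 'd) set"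
  assumes B: "B \<subseteq> borel_measurable M"
    and add: "\<And>f g. f \<in> B \<Longrightarrow> g \<in> B \<Longrightarrow> (\<lambda>x. f x + g x) \<in> B"
    and scale: "\<And>f c. f \<in> B \<Longrightarrow> 0 \<le> c \<Longrightarrow> (\<lambda>x. c *\<^sub>R f x) \<in> B"
    and closed: "\<And>f. f \<in> borel_measurable M \<Longrightarrow>
      (\<And>e. e > 0 \<Longrightarrow> \<exists>g\<in>B. dist_prob M e f g < e) \<Longrightarrow> f \<in> B"
    and neg: "\<And>f. f \<in> borel_measurable M \<Longrightarrow> (\<And>x i. f x $ i \<le> 0) \<Longrightarrow> f \<in> B"
    and arb: "\<And>f. f \<in> B \<Longrightarrow> AE x in M. \<forall>i. 0 \<le> f x $ i \<Longrightarrow> AE x in M. f x = 0"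
  obtains z where "z \<in> L2 M" "AE x in M. \<forall>i. 0 < z x $ i" "\<And>b. b \<in> B \<Longrightarrow> b \<in> L2 M \<Longrightarrow> pairing M z b \<le> 0"
proof -
  define K where "K = B \<inter> L2 M"
  have sep: "\<exists>z\<in>dual_cone M B. 0 < pairing M z h"
    if h: "h \<in> L2 M" "AE x in M. \<forall>i. 0 \<le> h x $ i" "\<not> (AE x in M. h x = 0)" for h
  proof -
    obtain p where p: "p \<in> K" "\<And>k. k \<in> K \<Longrightarrow> (\<integral>x. (h x - p x) \<bullet> k x \<partial>M) \<le> 0"
      "0 \<le> (\<integral>x. (h x - p x) \<bullet> p x \<partial>M)"
    proof (rule L2_projection[of K h])
      fix f assume f: "f \<in> L2 M" and c: "\<And>e. e > 0 \<Longrightarrow> \<exists>g\<in>K. sqdist M f g \<le> e"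
      have "f \<in> B"
      proof (rule closed)
        fix e :: real assume e: "e > 0"
        \<comment> \<open>Chebyshev's inequality divides by e^2, leaving e / 2, which is strictly
          below e.\<close>
        then obtain g where g: "g \<in> K" "sqdist M f g \<le> e\<^sup>2 * (e / 2)"
          using c[of "e\<^sup>2 * (e / 2)"] by auto
        have gL: "g \<in> L2 M" using g by (simp add: K_def)
        have d: "(\<lambda>x. f x - g x) \<in> L2 M" by (intro L2_diff f gL)
        have [measurable]: "f \<in> borel_measurable M" "g \<in> borel_measurable M" using f gL by (auto simp: L2_def)
        have "dist_prob M e f g \<le> prob {x\<in>space M. e\<^sup>2 \<le> (norm (f x - g x))\<^sup>2}"
          using e by (intro finite_measure_mono) (auto simp: dist_norm intro!: power_mono)
        also have "\<dots> \<le> sqdist M f g / e\<^sup>2"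
          by (rule integral_Markov_inequality_measure[OF L2_integrable[OF d] sets.empty_sets]) (use e in auto)
        also have "\<dots> \<le> e / 2" using g(2) e by (simp add: field_simps)
        also have "\<dots> < e" using e by simp
        finally show "\<exists>g\<in>B. dist_prob M e f g < e" using g(1) by (auto simp: K_def)
      qed (use f in \<open>auto simp: L2_def\<close>)
      with f show "f \<in> K" by (simp add: K_def)
    qed (use h(1) add scale neg in \<open>auto simp: K_def L2_add L2_scaleR\<close>)
    define z where "z x = h x - p x" for x
    have pL: "p \<in> L2 M" using p by (simp add: K_def)
    have zL: "z \<in> L2 M" unfolding z_def by (intro L2_diff h pL)
    have [measurable]: "z \<in> borel_measurable M" using zL by (auto simp: L2_def)
    have comp [measurable]: "(\<lambda>x. z x $ i) \<in> borel_measurable M" for i by (simp add: cart_eq_inner_axis)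
    have zK: "pairing M z k \<le> 0" if "k \<in> K" for k using p(2)[OF that] by (simp add: z_def)
    have "AE x in M. 0 \<le> z x $ i" for i
    proof -
      \<comment> \<open>A nonpositive bounded test vector, hence in K by \<open>neg\<close>; its
        pairing with z integrates the negative part of coordinate i.\<close>
      define u where "u x = (if z x $ i < 0 then - 1 else 0 :: real) *\<^sub>R (axis i 1 :: real ^ 'd)" for x
      have um: "u \<in> borel_measurable M" unfolding u_def by measurable
      have "u \<in> K"
        unfolding K_def
      proof (intro IntI neg um)
        show "u x $ j \<le> 0" for x j by (simp add: u_def axis_def)
        show "u \<in> L2 M" by (rule L2_bounded[OF um, of 1]) (simp add: u_def)
      qed
      then have le: "pairing M z u \<le> 0" and uL: "u \<in> L2 M" using zK by (auto simp: K_def)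
      have zu: "z x \<bullet> u x = max 0 (- (z x $ i))" for x by (simp add: u_def inner_axis)
      have "pairing M z u = 0"
        using le by (intro antisym) (auto simp: zu)
      then have "AE x in M. z x \<bullet> u x = 0"
        using integral_nonneg_eq_0_iff_AE[OF L2_inner[OF zL uL]] by (auto simp: zu)
      then show ?thesis by eventually_elim (simp add: zu max_def split: if_splits)
    qed
    then have zd: "z \<in> dual_cone M B"
      using zL zK by (auto simp: dual_cone_def K_def AE_all_countable)
    \<comment> \<open>The pairing with h is at least the squared norm of the residual z. That norm
      is positive: otherwise h = p would be a nonzero nonnegative member of B.\<close>
    have "pairing M z h = (\<integral>x. (norm (z x))\<^sup>2 + z x \<bullet> p x \<partial>M)"
      by (intro Bochner_Integration.integral_cong refl) (simp add: z_def power2_norm_eq_inner inner_diff_right)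
    also have "\<dots> = (\<integral>x. (norm (z x))\<^sup>2 \<partial>M) + pairing M z p"
      by (intro Bochner_Integration.integral_add L2_integrable zL L2_inner pL)
    finally have "(\<integral>x. (norm (z x))\<^sup>2 \<partial>M) \<le> pairing M z h" using p(3) by (simp add: z_def)
    moreover have "(\<integral>x. (norm (z x))\<^sup>2 \<partial>M) \<noteq> 0"
    proof
      assume "(\<integral>x. (norm (z x))\<^sup>2 \<partial>M) = 0"
      then have eq: "AE x in M. h x = p x"
        using integral_nonneg_eq_0_iff_AE[OF L2_integrable[OF zL]] by (simp add: z_def)
      with h(2) have "AE x in M. \<forall>i. 0 \<le> p x $ i" by eventually_elim simp
      then have "AE x in M. p x = 0" using p(1) by (intro arb) (auto simp: K_def)
      with eq have "AE x in M. h x = 0" by eventually_elim simp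
      with h(3) show False ..
    qed
    moreover have "0 \<le> (\<integral>x. (norm (z x))\<^sup>2 \<partial>M)" by simp
    ultimately show ?thesis using zd by (intro bexI[of _ z]) linarith+
  qed
  \<comment> \<open>The functional for the exhaustion. It is bounded by the number of coordinates,
    and its supremum is attained because a countable combination y stays in the dual cone and is
    positive wherever some z n is.\<close>
  define \<phi> where "\<phi> z = (\<Sum>i\<in>UNIV. prob {x\<in>space M. 0 < z x $ i})" for z :: "'a \<Rightarrow> real ^ 'd"
  have zero: "(\<lambda>_. 0) \<in> dual_cone M B" by (simp add: dual_cone_def)
  have bdd: "bdd_above (\<phi> ` dual_cone M B)"
    by (intro bdd_aboveI[of _ "real CARD('d)"])
      (auto simp: \<phi>_def intro!: order_trans[OF sum_bounded_above[where K = 1]])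
  define s where "s = Sup (\<phi> ` dual_cone M B)"
  have "\<forall>n. \<exists>z. z \<in> dual_cone M B \<and> s - 1 / real (Suc n) < \<phi> z"
  proof
    fix n
    have "s - 1 / real (Suc n) < Sup (\<phi> ` dual_cone M B)" unfolding s_def by simp
    then obtain u where "u \<in> \<phi> ` dual_cone M B" "s - 1 / real (Suc n) < u"
      using zero by (rule_tac less_cSupE[of "s - 1 / real (Suc n)" "\<phi> ` dual_cone M B"]) blast+
    then show "\<exists>z. z \<in> dual_cone M B \<and> s - 1 / real (Suc n) < \<phi> z" by blast
  qed
  from choice[OF this] obtain z where z': "\<forall>n. z n \<in> dual_cone M B \<and> s - 1 / real (Suc n) < \<phi> (z n)" ..
  have z: "\<And>n. z n \<in> dual_cone M B" "\<And>n. s - 1 / real (Suc n) < \<phi> (z n)"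
    using z' by blast+
  obtain y where y: "y \<in> dual_cone M B" "\<And>n. AE x in M. \<forall>i. 0 < z n x $ i \<longrightarrow> 0 < y x $ i"
    by (rule dual_cone_countable_sum[OF z(1)]) (rule that)
  have compm: "(\<lambda>x. f x $ i) \<in> borel_measurable M" if "f \<in> dual_cone M B" for f i
    using that by (auto simp: dual_cone_def L2_def cart_eq_inner_axis)
  have mono: "prob {x\<in>space M. 0 < f x $ i} \<le> prob {x\<in>space M. 0 < g x $ i}"
    if "AE x in M. \<forall>i. 0 < f x $ i \<longrightarrow> 0 < g x $ i" "g \<in> dual_cone M B" for f g i
    using that(1) compm[OF that(2), of i] by (intro finite_measure_mono_AE) auto
  have ys: "s \<le> \<phi> y"
  proof (rule field_le_epsilon)
    fix e :: real assume "e > 0"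
    then obtain n where n: "inverse (real (Suc n)) < e" using reals_Archimedean by blast
    have "\<phi> (z n) \<le> \<phi> y" unfolding \<phi>_def by (intro sum_mono mono y)
    with z(2)[of n] n show "s \<le> \<phi> y + e" by (simp add: inverse_eq_divide)
  qed
  have "AE x in M. 0 < y x $ i" for i
  proof (rule ccontr)
    assume na: "\<not> (AE x in M. 0 < y x $ i)"
    note [measurable] = compm[OF y(1)]
    define h where "h x = (if y x $ i \<le> 0 then 1 else 0 :: real) *\<^sub>R (axis i 1 :: real ^ 'd)" for x
    have hm: "h \<in> borel_measurable M" unfolding h_def by measurable
    have hL: "h \<in> L2 M" by (rule L2_bounded[OF hm, of 1]) (simp add: h_def)
    have hn: "\<not> (AE x in M. h x = 0)"
    proof
      assume "AE x in M. h x = 0"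
      then have "AE x in M. 0 < y x $ i"
        by eventually_elim (auto simp: h_def axis_eq_0_iff split: if_splits)
      with na show False ..
    qed
    obtain v where v: "v \<in> dual_cone M B" "0 < pairing M v h"
      using sep[OF hL _ hn] by (auto simp: h_def axis_def)
    note [measurable] = compm[OF v(1)]
    let ?g = "\<lambda>x. y x + v x"
    have g: "?g \<in> dual_cone M B" by (rule dual_cone_add[OF y(1) v(1)])
    have nn: "AE x in M. \<forall>i. 0 \<le> v x $ i" "AE x in M. \<forall>i. 0 \<le> y x $ i"
      using v(1) y(1) by (auto simp: dual_cone_def)
    have gm: "AE x in M. \<forall>i. 0 < y x $ i \<longrightarrow> 0 < ?g x $ i"
      using nn(1) by eventually_elim (auto intro: add_pos_nonneg)
    \<comment> \<open>The set where v adds positivity that y lacks. Were it null, v would pair to 0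
      with h, the unit vector i on the event where coordinate i of y is not positive.\<close>
    let ?A = "{x\<in>space M. y x $ i \<le> 0 \<and> 0 < v x $ i}"
    have "prob ?A \<noteq> 0"
    proof
      assume "prob ?A = 0"
      then have "AE x in M. x \<notin> ?A"
        by (intro AE_not_in) (auto simp: null_sets_def emeasure_eq_measure)
      then have "AE x in M. v x \<bullet> h x = 0"
        using nn(1) AE_space
        by eventually_elim (auto simp: h_def inner_axis antisym_conv not_less)
      then have "pairing M v h = 0" by (rule integral_eq_zero_AE)
      with v(2) show False by simp
    qed
    then have "0 < prob ?A" by (simp add: zero_less_measure_iff)
    moreover have "prob {x\<in>space M. 0 < y x $ i} + prob ?A \<le> prob {x\<in>space M. 0 < ?g x $ i}"
    proof -
      have "prob {x\<in>space M. 0 < y x $ i} + prob ?A = prob ({x\<in>space M. 0 < y x $ i} \<union> ?A)"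
        by (rule finite_measure_Union[symmetric]) auto
      also have "\<dots> \<le> prob {x\<in>space M. 0 < ?g x $ i}"
        using nn by (intro finite_measure_mono_AE) (auto intro: add_pos_nonneg add_nonneg_pos)
      finally show ?thesis .
    qed
    ultimately have "prob {x\<in>space M. 0 < y x $ i} < prob {x\<in>space M. 0 < ?g x $ i}" by linarith
    then have "\<phi> y < \<phi> ?g"
      unfolding \<phi>_def by (intro sum_strict_mono_ex1 ballI mono gm g) auto
    moreover have "\<phi> ?g \<le> s" unfolding s_def by (intro cSup_upper imageI g bdd)
    ultimately show False using ys by linarith
  qed
  then have "AE x in M. \<forall>i. 0 < y x $ i" by (simp add: AE_all_countable)
  with y(1) show ?thesis by (intro that[of y]) (auto simp: dual_cone_def)
qed

end

section \<open>Closed cones of random vectors\<close>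

context finite_measure
begin

lemma measure_tail:
  fixes R :: "'a \<Rightarrow> real"
  assumes [measurable]: "R \<in> borel_measurable M" and e: "e > 0"
  obtains k :: nat where "measure M {x\<in>space M. real k < \<bar>R x\<bar>} < e"
proof -
  let ?A = "\<lambda>k::nat. {x\<in>space M. real k < \<bar>R x\<bar>}"
  have "(\<lambda>k. measure M (?A k)) \<longlonglongrightarrow> measure M (\<Inter>k. ?A k)"
    by (rule finite_Lim_measure_decseq) (auto simp: decseq_def)
  also have "(\<Inter>k. ?A k) = {}"
  proof -
    have "x \<notin> (\<Inter>k. ?A k)" for x
    proof -
      obtain k :: nat where "\<bar>R x\<bar> \<le> real k" using real_arch_simple by blast
      then show ?thesis by (auto intro: exI[of _ k] simp: not_less)
    qed
    then show ?thesis by blast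
  qed
  finally have "(\<lambda>k. measure M (?A k)) \<longlonglongrightarrow> 0" by simp
  from order_tendstoD(2)[OF this e] show ?thesis
    using that by (auto simp: eventually_sequentially)
qed

text \<open>R needs no integrability: its large values sit on a set of small measure, and off that
  set a fixed threshold for f n suffices. It is meant for the unbounded factor norm (Z T).\<close>

lemma vanish_mult:
  fixes R :: "'a \<Rightarrow> real"
  assumes R [measurable]: "R \<in> borel_measurable M" and f [measurable]: "\<And>n. f n \<in> borel_measurable M"
    and v: "vanish M f" and nn: "\<And>n x. 0 \<le> f n x"
  shows "vanish M (\<lambda>n x. R x * f n x)"
  unfolding vanish_def
proof (intro allI impI LIMSEQ_I)
  fix e a :: real assume e: "e > 0" and a: "a > 0"
  obtain k :: nat where k: "measure M {x\<in>space M. real k < \<bar>R x\<bar>} < a / 2"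
    using measure_tail[OF R, of "a / 2"] a by auto
  have "(\<lambda>n. measure M {x\<in>space M. e / (real k + 1) < f n x}) \<longlonglongrightarrow> 0"
    using v e unfolding vanish_def by simp
  from order_tendstoD(2)[OF this, of "a / 2"] a
  obtain N where N: "\<And>n. n \<ge> N \<Longrightarrow> measure M {x\<in>space M. e / (real k + 1) < f n x} < a / 2"
    by (auto simp: eventually_sequentially)
  show "\<exists>N. \<forall>n\<ge>N. norm (measure M {x\<in>space M. e < R x * f n x} - 0) < a"
  proof (intro exI[of _ N] allI impI)
    fix n assume n: "n \<ge> N"
    let ?A = "{x\<in>space M. real k < \<bar>R x\<bar>}" and ?B = "{x\<in>space M. e / (real k + 1) < f n x}"
    have "measure M {x\<in>space M. e < R x * f n x} \<le> measure M (?A \<union> ?B)"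
    proof (intro finite_measure_mono subsetI)
      fix x assume w: "x \<in> {x\<in>space M. e < R x * f n x}"
      show "x \<in> ?A \<union> ?B"
      proof (rule ccontr)
        assume "x \<notin> ?A \<union> ?B"
        with w have "R x \<le> real k + 1" "f n x \<le> e / (real k + 1)" by (auto simp: not_less)
        then have "R x * f n x \<le> (real k + 1) * (e / (real k + 1))"
          using nn by (intro mult_mono) auto
        with w show False by simp
      qed
    qed measurable
    also have "\<dots> \<le> measure M ?A + measure M ?B" by (intro measure_Un_le) auto
    also have "\<dots> < a" using k N[OF n] by simp
    finally show "norm (measure M {x\<in>space M. e < R x * f n x} - 0) < a" by simp
  qed
qed

end

context prob_space
begin

lemma L0_closure_iff:
  fixes S :: "('a \<Rightarrow> 'b::euclidean_space) set"
  assumes S: "S \<subseteq> borel_measurable M"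
  shows "f \<in> L0_topology M closure_of S \<longleftrightarrow>
    f \<in> borel_measurable M \<and> (\<forall>e>0. \<exists>g\<in>S. dist_prob M e f g < e)"
proof (intro iffI conjI allI impI)
  assume f: "f \<in> L0_topology M closure_of S"
  then show fm: "f \<in> borel_measurable M" by (auto simp: in_closure_of topspace_L0_topology)
  fix e :: real assume e: "e > 0"
  show "\<exists>g\<in>S. dist_prob M e f g < e"
  proof (rule ccontr)
    assume *: "\<not> ?thesis"
    \<comment> \<open>The functions at positive distance from S. \<open>L0_open\<close> provides no
      open balls directly, so this set is shown to be open by halving the radius in the triangle
      inequality.\<close>
    define U where "U = {g \<in> borel_measurable M. \<exists>e>0. \<forall>h\<in>S. e \<le> dist_prob M e g h}"
    have "L0_open M U"
      unfolding L0_open_def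
    proof (intro conjI ballI)
      show "U \<subseteq> borel_measurable M" by (auto simp: U_def)
      fix g assume "g \<in> U"
      then obtain d where g: "g \<in> borel_measurable M" and d: "d > 0"
        "\<And>h. h \<in> S \<Longrightarrow> d \<le> dist_prob M d g h" by (auto simp: U_def)
      show "\<exists>e>0. \<forall>k\<in>borel_measurable M. dist_prob M e g k < e \<longrightarrow> k \<in> U"
      proof (intro exI[of _ "d / 2"] conjI ballI impI)
        fix k assume k: "k \<in> borel_measurable M" and p: "dist_prob M (d / 2) g k < d / 2"
        have "d / 2 \<le> dist_prob M (d / 2) k h" if h: "h \<in> S" for h
        proof -
          have "h \<in> borel_measurable M" using h S by blast
          from dist_prob_triangle[OF g k this, of "d / 2" "d / 2"] d(2)[OF h] p show ?thesis by simp
        qed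
        with k d(1) show "k \<in> U" unfolding U_def by (auto intro!: exI[of _ "d / 2"])
      qed (use d in simp)
    qed
    moreover have "f \<in> U" using * e fm unfolding U_def by (auto simp: not_less)
    ultimately obtain g where g: "g \<in> S" "g \<in> U"
      using f unfolding in_closure_of openin_L0_topology by blast
    then show False by (force simp: U_def)
  qed
next
  assume *: "f \<in> borel_measurable M \<and> (\<forall>e>0. \<exists>g\<in>S. dist_prob M e f g < e)"
  show "f \<in> L0_topology M closure_of S"
    unfolding in_closure_of topspace_L0_topology openin_L0_topology
  proof (intro conjI allI impI)
    fix U assume "f \<in> U \<and> L0_open M U"
    then obtain e where "e > 0"
      "\<And>g. g \<in> borel_measurable M \<Longrightarrow> dist_prob M e f g < e \<Longrightarrow> g \<in> U"
      unfolding L0_open_def by blast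
    with * S show "\<exists>y. y \<in> S \<and> y \<in> U" by (metis subsetD)
  qed (use * in blast)
qed

context
  fixes S :: "('a \<Rightarrow> 'b::euclidean_space) set"
  assumes S: "S \<subseteq> borel_measurable M"
begin

lemma L0_closure_measurable: "f \<in> L0_topology M closure_of S \<Longrightarrow> f \<in> borel_measurable M"
  using L0_closure_iff[OF S] by blast

text \<open>Allows a random vector to be replaced by a version measurable for a smaller
  sigma-algebra without leaving the closure.\<close>

lemma L0_closure_AE:
  assumes f: "f \<in> L0_topology M closure_of S" and g: "g \<in> borel_measurable M" and ae: "AE x in M. g x = f x"
  shows "g \<in> L0_topology M closure_of S"
  unfolding L0_closure_iff[OF S]
proof (intro conjI allI impI g)
  fix e :: real assume "e > 0"
  then obtain h where h: "h \<in> S" "dist_prob M e f h < e"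
    using f unfolding L0_closure_iff[OF S] by blast
  note [measurable] = L0_closure_measurable[OF f] g
  have [measurable]: "h \<in> borel_measurable M" using h(1) S by blast
  have "dist_prob M e g h = dist_prob M e f h"
    using ae by (intro finite_measure_eq_AE) auto
  with h show "\<exists>h\<in>S. dist_prob M e g h < e"
    by (intro bexI[of _ h]) simp_all
qed

lemma L0_closure_closed:
  assumes f: "f \<in> borel_measurable M"
    and *: "\<And>e. e > 0 \<Longrightarrow> \<exists>g\<in>L0_topology M closure_of S. dist_prob M e f g < e"
  shows "f \<in> L0_topology M closure_of S"
  unfolding L0_closure_iff[OF S]
proof (intro conjI allI impI f)
  fix e :: real assume e: "e > 0"
  then obtain g where g: "g \<in> L0_topology M closure_of S" "dist_prob M (e / 2) f g < e / 2"
    using *[of "e / 2"] by auto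
  obtain h where h: "h \<in> S" "dist_prob M (e / 2) g h < e / 2"
    using g(1) e unfolding L0_closure_iff[OF S] by (meson half_gt_zero)
  have "h \<in> borel_measurable M" using h(1) S by blast
  from dist_prob_triangle[OF f L0_closure_measurable[OF g(1)] this, of "e / 2" "e / 2"] g(2) h
  show "\<exists>h\<in>S. dist_prob M e f h < e" by (intro bexI[of _ h]) auto
qed

lemma L0_closure_add:
  assumes add: "\<And>f g. f \<in> S \<Longrightarrow> g \<in> S \<Longrightarrow> (\<lambda>x. f x + g x) \<in> S"
    and f: "f \<in> L0_topology M closure_of S" and g: "g \<in> L0_topology M closure_of S"
  shows "(\<lambda>x. f x + g x) \<in> L0_topology M closure_of S"
  unfolding L0_closure_iff[OF S]
proof (intro conjI allI impI)
  note [measurable] = L0_closure_measurable[OF f] L0_closure_measurable[OF g]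
  show "(\<lambda>x. f x + g x) \<in> borel_measurable M" by measurable
  fix e :: real assume e: "e > 0"
  obtain f' where f': "f' \<in> S" "dist_prob M (e / 2) f f' < e / 2"
    using f e unfolding L0_closure_iff[OF S] by (meson half_gt_zero)
  obtain g' where g': "g' \<in> S" "dist_prob M (e / 2) g g' < e / 2"
    using g e unfolding L0_closure_iff[OF S] by (meson half_gt_zero)
  have [measurable]: "f' \<in> borel_measurable M" "g' \<in> borel_measurable M" using f'(1) g'(1) S by auto
  let ?A = "{x\<in>space M. dist (f x) (f' x) > e / 2}" and ?B = "{x\<in>space M. dist (g x) (g' x) > e / 2}"
  have "prob {x\<in>space M. dist (f x + g x) (f' x + g' x) > e} \<le> prob (?A \<union> ?B)"
  proof (intro finite_measure_mono subsetI)
    fix x assume "x \<in> {x\<in>space M. dist (f x + g x) (f' x + g' x) > e}"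
    with dist_triangle_add[of "f x" "g x" "f' x" "g' x"] show "x \<in> ?A \<union> ?B" by auto
  qed measurable
  also have "\<dots> \<le> prob ?A + prob ?B" by (intro measure_Un_le) measurable
  finally have "prob {x\<in>space M. dist (f x + g x) (f' x + g' x) > e} < e" using f'(2) g'(2) by simp
  with add[OF f'(1) g'(1)] show "\<exists>h\<in>S. prob {x\<in>space M. dist (f x + g x) (h x) > e} < e"
    by (intro bexI[of _ "\<lambda>x. f' x + g' x"]) simp_all
qed

lemma L0_closure_scaleR:
  assumes scale: "\<And>f c. f \<in> S \<Longrightarrow> 0 \<le> c \<Longrightarrow> (\<lambda>x. c *\<^sub>R f x) \<in> S"
    and f: "f \<in> L0_topology M closure_of S" and c: "0 \<le> c"
  shows "(\<lambda>x. c *\<^sub>R f x) \<in> L0_topology M closure_of S"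
  unfolding L0_closure_iff[OF S]
proof (intro conjI allI impI)
  note [measurable] = L0_closure_measurable[OF f]
  show "(\<lambda>x. c *\<^sub>R f x) \<in> borel_measurable M" by measurable
  fix e :: real assume e: "e > 0"
  define d where "d = min e (e / (c + 1))"
  have d: "d > 0" "d \<le> e" using e c by (auto simp: d_def)
  have cd: "c * d \<le> e"
  proof -
    have "c * d \<le> c * (e / (c + 1))" using c by (intro mult_left_mono) (auto simp: d_def)
    also have "\<dots> \<le> e" using c e by (simp add: field_simps)
    finally show ?thesis .
  qed
  obtain g where g: "g \<in> S" "dist_prob M d f g < d"
    using f d(1) unfolding L0_closure_iff[OF S] by blast
  have [measurable]: "g \<in> borel_measurable M" using g(1) S by auto
  have "prob {x\<in>space M. dist (c *\<^sub>R f x) (c *\<^sub>R g x) > e} \<le> dist_prob M d f g"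
  proof (intro finite_measure_mono subsetI)
    fix x assume w: "x \<in> {x\<in>space M. dist (c *\<^sub>R f x) (c *\<^sub>R g x) > e}"
    then have "c * d < c * dist (f x) (g x)"
      using cd c by (simp add: dist_norm flip: scaleR_diff_right)
    with c have "d < dist (f x) (g x)" by (simp add: mult_less_cancel_left)
    with w show "x \<in> {x\<in>space M. dist (f x) (g x) > d}" by simp
  qed measurable
  with g(2) d(2) scale[OF g(1) c] show "\<exists>h\<in>S. prob {x\<in>space M. dist (c *\<^sub>R f x) (h x) > e} < e"
    by (intro bexI[of _ "\<lambda>x. c *\<^sub>R g x"]) auto
qed

end

end

section \<open>Generated cones and their decompositions\<close>

lemma gen_cone_add:
  assumes "f \<in> gen_cone M N G" "g \<in> gen_cone M N G"
  shows "(\<lambda>x. f x + g x) \<in> gen_cone M N G"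
proof -
  obtain a where a: "\<forall>g\<in>G. a g \<in> borel_measurable N \<and> (\<forall>x\<in>space N. 0 \<le> (a g x :: real))"
    "AE x in M. f x = (\<Sum>g\<in>G. a g x *\<^sub>R g x)" using assms(1) by (auto simp: gen_cone_def)
  obtain b where b: "\<forall>g\<in>G. b g \<in> borel_measurable N \<and> (\<forall>x\<in>space N. 0 \<le> (b g x :: real))"
    "AE x in M. g x = (\<Sum>g\<in>G. b g x *\<^sub>R g x)" using assms(2) by (auto simp: gen_cone_def)
  have "AE x in M. f x + g x = (\<Sum>g\<in>G. (a g x + b g x) *\<^sub>R g x)"
    using a(2) b(2) by eventually_elim (simp add: scaleR_add_left sum.distrib)
  moreover have "(\<lambda>x. f x + g x) \<in> borel_measurable M" using assms by (auto simp: gen_cone_def)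
  ultimately show ?thesis
    using a(1) b(1) unfolding gen_cone_def by (auto intro!: exI[of _ "\<lambda>g x. a g x + b g x"] borel_measurable_add)
qed

lemma gen_cone_scaleR:
  assumes "f \<in> gen_cone M N G" "0 \<le> c"
  shows "(\<lambda>x. c *\<^sub>R f x) \<in> gen_cone M N G"
proof -
  obtain a where a: "\<forall>g\<in>G. a g \<in> borel_measurable N \<and> (\<forall>x\<in>space N. 0 \<le> (a g x :: real))"
    "AE x in M. f x = (\<Sum>g\<in>G. a g x *\<^sub>R g x)" using assms(1) by (auto simp: gen_cone_def)
  have "AE x in M. c *\<^sub>R f x = (\<Sum>g\<in>G. (c * a g x) *\<^sub>R g x)"
    using a(2) by eventually_elim (simp add: scaleR_sum_right)
  moreover have "(\<lambda>x. c *\<^sub>R f x) \<in> borel_measurable M" using assms by (auto simp: gen_cone_def)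
  ultimately show ?thesis
    using a(1) assms(2) unfolding gen_cone_def by (auto intro!: exI[of _ "\<lambda>g x. c * a g x"])
qed

lemma gen_cone_zero: "(\<lambda>_. 0) \<in> gen_cone M N G"
  unfolding gen_cone_def by (auto intro!: exI[of _ "\<lambda>_ _. 0"])

lemma gen_cone_sum:
  "finite I \<Longrightarrow> (\<And>i. i \<in> I \<Longrightarrow> f i \<in> gen_cone M N G) \<Longrightarrow> (\<lambda>x. \<Sum>i\<in>I. f i x) \<in> gen_cone M N G"
  by (induction I rule: finite_induct) (auto intro: gen_cone_add gen_cone_zero)

lemma gen_cone_ray:
  assumes G: "finite G" "g \<in> G" "g \<in> borel_measurable M" and N: "subalgebra M N"
    and a: "a \<in> borel_measurable N" "\<And>x. 0 \<le> a x"
  shows "(\<lambda>x. a x *\<^sub>R g x) \<in> gen_cone M N G"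
proof -
  have "a x *\<^sub>R g x = (\<Sum>h\<in>G. (if h = g then a x else 0) *\<^sub>R h x)" for x
    using G by (subst sum.remove[of G g]) auto
  moreover have "(\<lambda>x. if h = g then a x else 0) \<in> borel_measurable N" for h
    using a by (cases "h = g") auto
  moreover have "(\<lambda>x. a x *\<^sub>R g x) \<in> borel_measurable M"
    using measurable_from_subalg[OF N a(1)] G by measurable
  ultimately show ?thesis
    using a unfolding gen_cone_def by (auto intro!: exI[of _ "\<lambda>h x. if h = g then a x else 0"])
qed

lemma cone_sum_add:
  assumes K: "\<And>t f g. t \<le> T \<Longrightarrow> f \<in> K t \<Longrightarrow> g \<in> K t \<Longrightarrow> (\<lambda>x. f x + g x) \<in> K t"
    and "f \<in> cone_sum M T K" "g \<in> cone_sum M T K"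
  shows "(\<lambda>x. f x + g x) \<in> cone_sum M T K"
proof -
  obtain a where a: "\<forall>t\<le>T. a t \<in> K t" "AE x in M. f x = (\<Sum>t\<le>T. a t x)"
    using assms(2) by (auto simp: cone_sum_def)
  obtain b where b: "\<forall>t\<le>T. b t \<in> K t" "AE x in M. g x = (\<Sum>t\<le>T. b t x)"
    using assms(3) by (auto simp: cone_sum_def)
  have "AE x in M. f x + g x = (\<Sum>t\<le>T. a t x + b t x)"
    using a(2) b(2) by eventually_elim (simp add: sum.distrib)
  then show ?thesis
    using assms(2,3) a(1) b(1) K unfolding cone_sum_def by (auto intro!: exI[of _ "\<lambda>t x. a t x + b t x"])
qed

lemma cone_sum_scaleR:
  assumes K: "\<And>t f. t \<le> T \<Longrightarrow> f \<in> K t \<Longrightarrow> (\<lambda>x. c *\<^sub>R f x) \<in> K t" and "f \<in> cone_sum M T K"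
  shows "(\<lambda>x. c *\<^sub>R f x) \<in> cone_sum M T K"
proof -
  obtain a where a: "\<forall>t\<le>T. a t \<in> K t" "AE x in M. f x = (\<Sum>t\<le>T. a t x)"
    using assms(2) by (auto simp: cone_sum_def)
  have "AE x in M. c *\<^sub>R f x = (\<Sum>t\<le>T. c *\<^sub>R a t x)"
    using a(2) by eventually_elim (simp add: scaleR_sum_right)
  then show ?thesis
    using assms(2) a(1) K unfolding cone_sum_def by (auto intro!: exI[of _ "\<lambda>t x. c *\<^sub>R a t x"])
qed

lemma cone_sum_superset:
  assumes K: "\<And>t. t \<le> T \<Longrightarrow> (\<lambda>_. 0) \<in> K t" and t: "t \<le> T" and f: "f \<in> K t" "f \<in> borel_measurable M"
  shows "f \<in> cone_sum M T K"
proof -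
  have "f x = (\<Sum>s\<le>T. (if s = t then f else (\<lambda>_. 0)) x)" for x
    using t by (subst sum.remove[of _ t]) auto
  with K f t show ?thesis
    unfolding cone_sum_def by (auto intro!: exI[of _ "\<lambda>s. if s = t then f else (\<lambda>_. 0)"])
qed

text \<open>The event where the conditional expectation is positive belongs to F, so it may itself
  be used as the test set.\<close>

lemma (in finite_measure_subalgebra) real_cond_exp_nonpos:
  assumes Y: "integrable M Y" and le: "\<And>A. A \<in> sets F \<Longrightarrow> (\<integral>x. indicator A x * Y x \<partial>M) \<le> (0::real)"
  shows "AE x in M. real_cond_exp M F Y x \<le> 0"
proof -
  define A where "A = {x\<in>space F. 0 < real_cond_exp M F Y x}"
  have A [measurable]: "A \<in> sets F" unfolding A_def by measurable
  then have AM: "A \<in> sets M" using subalg by (auto simp: subalgebra_def)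
  have "integrable M (\<lambda>x. indicator A x * Y x)"
    using integrable_mult_indicator[OF AM Y] by simp
  note * = real_cond_exp_intg[OF this _ borel_measurable_integrable[OF Y]]
  have i: "integrable M (\<lambda>x. indicator A x * real_cond_exp M F Y x)" by (rule *(1)) measurable
  have "(\<integral>x. indicator A x * real_cond_exp M F Y x \<partial>M) \<le> 0"
    using le[OF A] by (subst *(2)) auto
  moreover have nn: "0 \<le> indicator A x * real_cond_exp M F Y x" for x by (auto simp: A_def indicator_def)
  ultimately have "(\<integral>x. indicator A x * real_cond_exp M F Y x \<partial>M) = 0"
    by (intro antisym) (auto intro: integral_nonneg_AE)
  then have "AE x in M. indicator A x * real_cond_exp M F Y x = 0"
    using integral_nonneg_eq_0_iff_AE[OF i] nn by simp
  with AE_space show ?thesis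
  proof eventually_elim
    case (elim x)
    then have "x \<in> space F" using subalg by (simp add: subalgebra_def)
    with elim(2) show ?case by (auto simp: A_def indicator_def split: if_splits)
  qed
qed

text \<open>The summands given by \<open>cone_sum\<close> are M-measurable and only a.e. equal to
  combinations of generators. Replacing them by those combinations makes them
  \<open>F t\<close>-measurable, as integrands must be, and makes the polar inequality hold
  pointwise.\<close>

lemma cone_sum_decompose:
  assumes F: "discrete_filtration M F T"
    and G: "\<And>t. t \<le> T \<Longrightarrow> G t \<subseteq> borel_measurable (F t)"
    and a: "a \<in> cone_sum M T (\<lambda>t. gen_cone M (F t) (G t))"
  obtains \<xi> where "\<And>t. t \<le> T \<Longrightarrow> \<xi> t \<in> borel_measurable (F t)"
    "\<And>t x z. t \<le> T \<Longrightarrow> x \<in> space M \<Longrightarrow> z \<in> polar_cone (G t) x \<Longrightarrow> z \<bullet> \<xi> t x \<le> 0"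
    "AE x in M. a x = (\<Sum>t\<le>T. \<xi> t x)"
proof -
  obtain \<zeta> where \<zeta>: "\<forall>t\<le>T. \<zeta> t \<in> gen_cone M (F t) (G t)" "AE x in M. a x = (\<Sum>t\<le>T. \<zeta> t x)"
    using a by (auto simp: cone_sum_def)
  have "\<forall>t. \<exists>\<alpha>. t \<le> T \<longrightarrow> (\<forall>g\<in>G t. \<alpha> g \<in> borel_measurable (F t) \<and> (\<forall>x\<in>space (F t). 0 \<le> (\<alpha> g x :: real)))
      \<and> (AE x in M. \<zeta> t x = (\<Sum>g\<in>G t. \<alpha> g x *\<^sub>R g x))"
  proof
    fix t
    show "\<exists>\<alpha>. t \<le> T \<longrightarrow> (\<forall>g\<in>G t. \<alpha> g \<in> borel_measurable (F t) \<and> (\<forall>x\<in>space (F t). 0 \<le> (\<alpha> g x :: real)))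
      \<and> (AE x in M. \<zeta> t x = (\<Sum>g\<in>G t. \<alpha> g x *\<^sub>R g x))"
    proof (cases "t \<le> T")
      case True
      then have "\<zeta> t \<in> gen_cone M (F t) (G t)" using \<zeta>(1) by blast
      then show ?thesis unfolding gen_cone_def by blast
    qed simp
  qed
  from choice[OF this] obtain \<alpha> where \<alpha>: "\<And>t. t \<le> T \<Longrightarrow> (\<forall>g\<in>G t. \<alpha> t g \<in> borel_measurable (F t) \<and>
      (\<forall>x\<in>space (F t). 0 \<le> (\<alpha> t g x :: real))) \<and> (AE x in M. \<zeta> t x = (\<Sum>g\<in>G t. \<alpha> t g x *\<^sub>R g x))" by blast
  define \<xi> where "\<xi> t x = (\<Sum>g\<in>G t. \<alpha> t g x *\<^sub>R g x)" for t x
  show ?thesis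
  proof (rule that[of \<xi>])
    fix t assume t: "t \<le> T"
    show "\<xi> t \<in> borel_measurable (F t)"
      unfolding \<xi>_def using \<alpha>[OF t] G[OF t] by (intro borel_measurable_sum borel_measurable_scaleR) auto
    fix x z assume w: "x \<in> space M" and z: "z \<in> polar_cone (G t) x"
    have "x \<in> space (F t)" using F t w by (auto simp: discrete_filtration_def subalgebra_def)
    then show "z \<bullet> \<xi> t x \<le> 0"
      using \<alpha>[OF t] z by (auto simp: \<xi>_def inner_sum_right polar_cone_def intro!: sum_nonpos mult_nonneg_nonpos)
  next
    have "AE x in M. \<forall>t\<in>{..T}. \<zeta> t x = \<xi> t x"
      unfolding \<xi>_def using \<alpha> by (intro AE_finite_allI) auto
    with \<zeta>(2) show "AE x in M. a x = (\<Sum>t\<le>T. \<xi> t x)"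
      by eventually_elim simp
  qed
qed

text \<open>Stated for an arbitrary finite measure because it is applied twice: under M, where the
  third conclusion makes the terms Z t \<bullet> \<xi> t vanish, and under each pricing measure,
  where the first two make the same integral a martingale. The claim itself serves as the integrable
  lower bound.\<close>

lemma (in finite_measure) price_decomposition:
  fixes Z :: "nat \<Rightarrow> 'a \<Rightarrow> real ^ 'd"
  assumes F: "discrete_filtration M F T" and Z: "is_martingale M F T Z"
    and \<xi>: "\<And>t. t \<le> T \<Longrightarrow> \<xi> t \<in> borel_measurable (F t)" "\<And>t. t \<le> T \<Longrightarrow> AE x in M. Z t x \<bullet> \<xi> t x \<le> 0"
    and X: "AE x in M. X x = (\<Sum>t\<le>T. \<xi> t x)"
    and int: "integrable M (\<lambda>x. Z T x \<bullet> X x)"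
  defines "I \<equiv> stoch_int (\<lambda>t x. \<Sum>s\<le>t. \<xi> s x) Z"
  shows "t \<le> T \<Longrightarrow> integrable M (I t)"
    and "t \<le> T \<Longrightarrow> AE x in M. real_cond_exp M (F t) (I T) x = I t x"
    and "pairing M (Z T) X = 0 \<Longrightarrow> AE x in M. \<forall>t\<le>T. Z t x \<bullet> \<xi> t x = 0"
proof -
  have \<eta>: "(\<lambda>x. \<Sum>s\<le>t. \<xi> s x) \<in> borel_measurable (F t)" if "t < T" for t
    using that \<xi>(1) by (intro borel_measurable_sum) (auto intro: filtration_measurable[OF F])
  have eq: "AE x in M. Z T x \<bullet> X x = (\<Sum>t\<le>T. Z t x \<bullet> \<xi> t x) + I T x"
    using X by eventually_elim (simp add: I_def inner_sum_by_parts)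
  have np: "AE x in M. \<forall>t\<in>{..T}. Z t x \<bullet> \<xi> t x \<le> 0"
    using \<xi>(2) by (intro AE_finite_allI) auto
  have le: "AE x in M. Z T x \<bullet> X x \<le> I T x"
    using eq np
  proof eventually_elim
    case (elim x)
    then have "(\<Sum>t\<le>T. Z t x \<bullet> \<xi> t x) \<le> 0" by (intro sum_nonpos) auto
    with elim(1) show ?case by simp
  qed
  note mart = stoch_int_martingale[OF F Z \<eta> int le[unfolded I_def], folded I_def]
  show iI: "t \<le> T \<Longrightarrow> integrable M (I t)" for t using mart(1) by blast
  show ce: "t \<le> T \<Longrightarrow> AE x in M. real_cond_exp M (F t) (I T) x = I t x" for t using mart(2) by blast
  interpret F0: finite_measure_subalgebra M "F 0" using filtration_subalgebra[OF F] by simp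
  have "(\<integral>x. I T x \<partial>M) = 0"
  proof -
    have "AE x in M. real_cond_exp M (F 0) (I T) x = 0" using ce[of 0] by (simp add: I_def)
    then have "(\<integral>x. real_cond_exp M (F 0) (I T) x \<partial>M) = 0" by (rule integral_eq_zero_AE)
    with F0.real_cond_exp_int(2)[OF iI[OF order_refl]] show ?thesis by simp
  qed
  moreover assume "pairing M (Z T) X = 0"
  ultimately have "(\<integral>x. I T x - Z T x \<bullet> X x \<partial>M) = 0" using int iI by simp
  moreover have "integrable M (\<lambda>x. I T x - Z T x \<bullet> X x)" using int iI by simp
  moreover have "AE x in M. 0 \<le> I T x - Z T x \<bullet> X x" using le by eventually_elim simp
  ultimately have "AE x in M. I T x - Z T x \<bullet> X x = 0"
    using integral_nonneg_eq_0_iff_AE by blast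
  with eq np show "AE x in M. \<forall>t\<le>T. Z t x \<bullet> \<xi> t x = 0"
  proof eventually_elim
    case (elim x)
    then have "(\<Sum>t\<le>T. - (Z t x \<bullet> \<xi> t x)) = 0" by (simp add: sum_negf)
    then show ?case using elim(2) by (subst (asm) sum_nonneg_eq_0_iff) auto
  qed
qed

lemma finite_trading_generators: "finite (trading_generators p)"
proof (rule finite_subset)
  show "trading_generators p \<subseteq> range (\<lambda>(i, j) x. axis j 1 - p x $ i $ j *\<^sub>R axis i 1) \<union> range (\<lambda>k x. - axis k 1)"
    by (auto simp: trading_generators_def)
qed simp

section \<open>Consistent prices and proper maximality\<close>

locale reduced_market = prob_space M for M :: "'a measure" +
  fixes F :: "nat \<Rightarrow> 'a measure" and T :: nat and \<pi> :: "nat \<Rightarrow> 'a \<Rightarrow> real ^ 'd ^ 'd"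
    and G :: "nat \<Rightarrow> ('a \<Rightarrow> real ^ 'd) set"
  assumes filtration: "discrete_filtration M F T"
    and bid_ask: "bid_ask_process M F T \<pi>"
    and no_arbitrage: "arbitrage_free M (attainable M F T \<pi>)"
    and reduced: "reduced_generators M F T \<pi> G"
begin

lemma generators:
  assumes "t \<le> T" shows "finite (G t)" "G t \<subseteq> borel_measurable (F t)"
  using reduced assms by (auto simp: reduced_generators_def)

lemma subalg: "t \<le> T \<Longrightarrow> subalgebra M (F t)"
  using filtration by (simp add: discrete_filtration_def)

lemma trading_generator_measurable:
  assumes "p \<in> trading_generators (\<pi> T)" shows "p \<in> borel_measurable (F T)"
proof -
  have [measurable]: "\<pi> T \<in> borel_measurable (F T)" using bid_ask by (auto simp: bid_ask_process_def)
  have [measurable]: "(\<lambda>x. \<pi> T x $ i $ j) \<in> borel_measurable (F T)" for i j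
  proof -
    have "(\<lambda>x. \<pi> T x \<bullet> axis i (axis j 1)) \<in> borel_measurable (F T)" by measurable
    then show ?thesis by (simp add: inner_axis)
  qed
  from assms show ?thesis unfolding trading_generators_def by auto
qed

lemma terminal_ray:
  assumes "p \<in> trading_generators (\<pi> T)" "a \<in> borel_measurable (F T)" "\<And>x. 0 \<le> a x"
  shows "(\<lambda>x. a x *\<^sub>R p x) \<in> gen_cone M (F T) (G T)"
proof -
  have "p \<in> borel_measurable M"
    using measurable_from_subalg[OF subalg trading_generator_measurable] assms(1) by blast
  then have "(\<lambda>x. a x *\<^sub>R p x) \<in> trading_cone M F \<pi> T"
    unfolding trading_cone_def using assms by (intro gen_cone_ray finite_trading_generators subalg) auto
  then show ?thesis using reduced by (simp add: reduced_generators_def)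
qed

text \<open>Disposal of asset k gives z_k \<ge> 0, and an exchange generator gives z_j \<le>
  \<pi>_ij z_i, so one positive coordinate makes all others positive. The trading generators need
  not belong to \<open>G T\<close>; each is only a.e. a nonnegative combination of it, whence the
  exceptional null set.\<close>

lemma terminal_polar_positive: "AE x in M. \<forall>z\<in>polar_cone (G T) x - {0}. \<forall>i. 0 < z $ i"
proof -
  have pol: "AE x in M. \<forall>z\<in>polar_cone (G T) x. z \<bullet> p x \<le> 0" if p: "p \<in> trading_generators (\<pi> T)" for p
  proof -
    have "(\<lambda>x. 1 *\<^sub>R p x) \<in> gen_cone M (F T) (G T)" by (rule terminal_ray[OF p]) auto
    then obtain \<alpha> where \<alpha>: "\<forall>g\<in>G T. \<alpha> g \<in> borel_measurable (F T) \<and> (\<forall>x\<in>space (F T). 0 \<le> (\<alpha> g x :: real))"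
      "AE x in M. p x = (\<Sum>g\<in>G T. \<alpha> g x *\<^sub>R g x)" by (auto simp: gen_cone_def)
    from \<alpha>(2) AE_space show ?thesis
    proof eventually_elim
      case (elim x)
      have "x \<in> space (F T)" using elim(2) subalg[of T] by (simp add: subalgebra_def)
      then show ?case
        using \<alpha>(1) unfolding elim(1) inner_sum_right polar_cone_def
        by (auto intro!: sum_nonpos mult_nonneg_nonpos)
    qed
  qed
  have "AE x in M. \<forall>p\<in>trading_generators (\<pi> T). \<forall>z\<in>polar_cone (G T) x. z \<bullet> p x \<le> 0"
    by (intro AE_finite_allI finite_trading_generators pol)
  then show ?thesis
  proof eventually_elim
    case (elim x)
    show ?case
    proof (intro ballI allI)
      fix z i assume z: "z \<in> polar_cone (G T) x - {0}"
      have nn: "0 \<le> z $ k" for k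
      proof -
        have "(\<lambda>x. - axis k 1) \<in> trading_generators (\<pi> T)" by (auto simp: trading_generators_def)
        from bspec[OF bspec[OF elim this], of z] z show ?thesis by (simp add: inner_axis)
      qed
      have "\<exists>j. z $ j \<noteq> 0" using z by (auto simp: vec_eq_iff)
      then obtain j where "z $ j \<noteq> 0" ..
      with nn[of j] have j: "0 < z $ j" by simp
      show "0 < z $ i"
      proof (cases "i = j")
        case False
        then have "(\<lambda>x. axis j 1 - \<pi> T x $ i $ j *\<^sub>R axis i 1) \<in> trading_generators (\<pi> T)"
          by (auto simp: trading_generators_def)
        from bspec[OF bspec[OF elim this], of z] z have "z $ j \<le> \<pi> T x $ i $ j * z $ i"
          by (simp add: inner_axis inner_diff_right)
        with j have "z $ i \<noteq> 0" by auto
        with nn[of i] show ?thesis by simp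
      qed (use j in simp)
    qed
  qed
qed

abbreviation A :: "('a \<Rightarrow> real ^ 'd) set" where "A \<equiv> attainable M F T \<pi>"

abbreviation claim :: "(nat \<Rightarrow> 'a \<Rightarrow> real ^ 'd) \<Rightarrow> ('a \<Rightarrow> real ^ 'd) \<Rightarrow> 'a \<Rightarrow> real" where
  "claim Z X \<equiv> \<lambda>\<omega>. Z T \<omega> \<bullet> X \<omega>"

lemma attainable_eq: "A = cone_sum M T (\<lambda>t. gen_cone M (F t) (G t))"
  using reduced by (simp add: reduced_generators_def)

lemma attainable_measurable: "A \<subseteq> borel_measurable M"
  by (auto simp: attainable_def cone_sum_def)

lemma attainable_add: "f \<in> A \<Longrightarrow> g \<in> A \<Longrightarrow> (\<lambda>x. f x + g x) \<in> A"
  unfolding attainable_eq by (rule cone_sum_add) (rule gen_cone_add)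

lemma attainable_scaleR: "f \<in> A \<Longrightarrow> 0 \<le> c \<Longrightarrow> (\<lambda>x. c *\<^sub>R f x) \<in> A"
  unfolding attainable_eq by (rule cone_sum_scaleR) (rule gen_cone_scaleR)

lemma attainable_gen_cone: "t \<le> T \<Longrightarrow> f \<in> gen_cone M (F t) (G t) \<Longrightarrow> f \<in> A"
  unfolding attainable_eq by (rule cone_sum_superset[OF gen_cone_zero]) (auto simp: gen_cone_def)

lemma attainable_ray:
  assumes t: "t \<le> T" and g: "g \<in> G t" and a: "a \<in> borel_measurable (F t)" "\<And>x. 0 \<le> a x"
  shows "(\<lambda>x. a x *\<^sub>R g x) \<in> A"
proof (rule attainable_gen_cone[OF t gen_cone_ray])
  show "g \<in> borel_measurable M"
    using measurable_from_subalg[OF subalg[OF t]] generators(2)[OF t] g by blast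
qed (use generators[OF t] g subalg[OF t] a in auto)

text \<open>Such a claim is a combination of disposals at T, whose coefficients are its negated
  coordinates and must be \<open>F T\<close>-measurable. This is why separation is carried out on
  \<open>F T\<close> and not on M.\<close>

lemma attainable_nonpos:
  assumes f: "f \<in> borel_measurable (F T)" "\<And>x i. f x $ i \<le> 0"
  shows "f \<in> A"
proof -
  have "(\<lambda>x. \<Sum>k\<in>UNIV. (- (f x $ k)) *\<^sub>R - axis k 1) \<in> gen_cone M (F T) (G T)"
  proof (intro gen_cone_sum terminal_ray)
    show "(\<lambda>x. - (f x $ k)) \<in> borel_measurable (F T)" for k
      using f(1) by (simp add: cart_eq_inner_axis)
  qed (use f(2) in \<open>auto simp: trading_generators_def\<close>)
  moreover have "(\<lambda>x. \<Sum>k\<in>UNIV. (- (f x $ k)) *\<^sub>R - axis k 1) = f"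
  proof
    fix x
    have "(\<Sum>k\<in>UNIV. f x $ k *\<^sub>R axis k (1::real)) = f x"
      using basis_expansion[of "f x"] by (simp add: scalar_mult_eq_scaleR)
    then show "(\<Sum>k\<in>UNIV. (- (f x $ k)) *\<^sub>R - axis k 1) = f x" by simp
  qed
  ultimately show ?thesis using attainable_gen_cone[of T f] by simp
qed

lemma attainable_decompose:
  assumes "a \<in> A"
  obtains \<xi> where "\<And>t. t \<le> T \<Longrightarrow> \<xi> t \<in> borel_measurable (F t)"
    "\<And>t x z. t \<le> T \<Longrightarrow> x \<in> space M \<Longrightarrow> z \<in> polar_cone (G t) x \<Longrightarrow> z \<bullet> \<xi> t x \<le> 0"
    "AE x in M. a x = (\<Sum>t\<le>T. \<xi> t x)"
  using cone_sum_decompose[OF filtration generators(2), of a] assms unfolding attainable_eq by blast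

lemma adjoin_measurable: "X \<in> A \<Longrightarrow> cone_adjoin_neg A X \<subseteq> borel_measurable M"
  using attainable_measurable
  by (auto simp: cone_adjoin_neg_def intro!: borel_measurable_diff borel_measurable_scaleR)

lemma adjoin_superset: "A \<subseteq> cone_adjoin_neg A X"
proof
  fix a assume "a \<in> A"
  moreover have "a = (\<lambda>x. a x - 0 *\<^sub>R X x)" by simp
  ultimately show "a \<in> cone_adjoin_neg A X" unfolding cone_adjoin_neg_def by fastforce
qed

lemma attainable_zero: "(\<lambda>_. 0) \<in> A"
  by (rule attainable_nonpos) auto

lemma adjoin_neg: "(\<lambda>x. - X x) \<in> cone_adjoin_neg A X"
proof -
  have "(\<lambda>x. - X x) = (\<lambda>x. 0 - 1 *\<^sub>R X x)" by simp
  with attainable_zero show ?thesis unfolding cone_adjoin_neg_def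
    by (intro CollectI exI[of _ "\<lambda>_. 0"] exI[of _ 1]) auto
qed

lemma adjoin_add:
  assumes "f \<in> cone_adjoin_neg A X" "g \<in> cone_adjoin_neg A X"
  shows "(\<lambda>x. f x + g x) \<in> cone_adjoin_neg A X"
proof -
  obtain a c where a: "f = (\<lambda>x. a x - c *\<^sub>R X x)" "a \<in> A" "0 \<le> c" using assms(1) by (auto simp: cone_adjoin_neg_def)
  obtain b d where b: "g = (\<lambda>x. b x - d *\<^sub>R X x)" "b \<in> A" "0 \<le> d" using assms(2) by (auto simp: cone_adjoin_neg_def)
  have "(\<lambda>x. f x + g x) = (\<lambda>x. (a x + b x) - (c + d) *\<^sub>R X x)"
    by (simp add: a(1) b(1) scaleR_add_left fun_eq_iff)
  with attainable_add[OF a(2) b(2)] a(3) b(3) show ?thesis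
    unfolding cone_adjoin_neg_def by (intro CollectI exI[of _ "\<lambda>x. a x + b x"] exI[of _ "c + d"]) auto
qed

lemma adjoin_scaleR:
  assumes "f \<in> cone_adjoin_neg A X" "0 \<le> r"
  shows "(\<lambda>x. r *\<^sub>R f x) \<in> cone_adjoin_neg A X"
proof -
  obtain a c where a: "f = (\<lambda>x. a x - c *\<^sub>R X x)" "a \<in> A" "0 \<le> c" using assms(1) by (auto simp: cone_adjoin_neg_def)
  have "(\<lambda>x. r *\<^sub>R f x) = (\<lambda>x. r *\<^sub>R a x - (r * c) *\<^sub>R X x)"
    by (simp add: a(1) scaleR_diff_right fun_eq_iff)
  with attainable_scaleR[OF a(2) assms(2)] a(3) assms(2) show ?thesis
    unfolding cone_adjoin_neg_def by (intro CollectI exI[of _ "\<lambda>x. r *\<^sub>R a x"] exI[of _ "r * c"]) auto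
qed

lemma price_zero_decomposition:
  assumes X: "X \<in> A" and Z: "consistent_price_process M F T G Z"
    and int: "integrable M (claim Z X)" "pairing M (Z T) X = 0"
  obtains x where "\<And>t. t \<le> T \<Longrightarrow> x t \<in> borel_measurable (F t)"
    "AE \<omega> in M. X \<omega> = (\<Sum>t\<le>T. x t \<omega>)" "AE \<omega> in M. \<forall>t\<le>T. Z t \<omega> \<bullet> x t \<omega> = 0"
proof -
  have mart: "is_martingale M F T Z" using Z by (simp add: consistent_price_process_def)
  obtain x where x: "\<And>t. t \<le> T \<Longrightarrow> x t \<in> borel_measurable (F t)"
    "\<And>t \<omega> z. t \<le> T \<Longrightarrow> \<omega> \<in> space M \<Longrightarrow> z \<in> polar_cone (G t) \<omega> \<Longrightarrow> z \<bullet> x t \<omega> \<le> 0"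
    "AE \<omega> in M. X \<omega> = (\<Sum>t\<le>T. x t \<omega>)"
    by (rule attainable_decompose[OF X]) (rule that)
  have xle: "AE \<omega> in M. Z t \<omega> \<bullet> x t \<omega> \<le> 0" if t: "t \<le> T" for t
  proof -
    have "AE \<omega> in M. Z t \<omega> \<in> polar_cone (G t) \<omega> - {0}"
      using Z t by (simp add: consistent_price_process_def)
    with AE_space show ?thesis by eventually_elim (use x(2) t in auto)
  qed
  show ?thesis
    using that x(1,3) price_decomposition(3)[OF filtration mart x(1) xle x(3) int] by blast
qed

lemma properly_maximal_of_price:
  assumes X: "X \<in> A" and Z: "consistent_price_process M F T G Z"
    and int: "integrable M (claim Z X)" "pairing M (Z T) X = 0"
  shows "properly_maximal M A X"
proof -
  let ?S = "cone_adjoin_neg A X"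
  have mart: "is_martingale M F T Z" using Z by (simp add: consistent_price_process_def)
  have ZF: "Z t \<in> borel_measurable (F t)" if "t \<le> T" for t using mart that by (simp add: is_martingale_def)
  have ZM [measurable]: "Z T \<in> borel_measurable M" using measurable_from_subalg[OF subalg ZF] by blast
  have pol: "AE \<omega> in M. \<forall>t\<in>{..T}. Z t \<omega> \<in> polar_cone (G t) \<omega> - {0}"
    using Z unfolding consistent_price_process_def by (intro AE_finite_allI) auto
  have pos: "AE \<omega> in M. \<forall>i. 0 < Z T \<omega> $ i"
    using pol terminal_polar_positive by eventually_elim auto
  obtain x where x: "\<And>t. t \<le> T \<Longrightarrow> x t \<in> borel_measurable (F t)"
    "AE \<omega> in M. X \<omega> = (\<Sum>t\<le>T. x t \<omega>)" "AE \<omega> in M. \<forall>t\<le>T. Z t \<omega> \<bullet> x t \<omega> = 0"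
    by (rule price_zero_decomposition[OF X Z int]) (rule that)
  have "f \<in> L0_zero M" if f: "f \<in> L0_topology M closure_of ?S" "f \<in> L0_nonneg M" for f
  proof -
    have fM [measurable]: "f \<in> borel_measurable M" using f(2) by (simp add: L0_nonneg_def)
    have fnn: "AE \<omega> in M. \<forall>i. 0 \<le> f \<omega> $ i" using f(2) by (simp add: L0_nonneg_def)
    have "\<forall>n. \<exists>h. h \<in> ?S \<and> dist_prob M (1 / real (Suc n)) f h < 1 / real (Suc n)"
    proof
      fix n
      have "0 < 1 / real (Suc n)" by simp
      then show "\<exists>h. h \<in> ?S \<and> dist_prob M (1 / real (Suc n)) f h < 1 / real (Suc n)"
        using f(1) unfolding L0_closure_iff[OF adjoin_measurable[OF X]] by blast
    qed
    from choice[OF this] obtain h where h: "\<And>n. h n \<in> ?S"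
      "\<And>n. dist_prob M (1 / real (Suc n)) f (h n) < 1 / real (Suc n)" by blast
    have hM [measurable]: "h n \<in> borel_measurable M" for n using h(1) adjoin_measurable[OF X] by blast
    have "vanish M (\<lambda>n \<omega>. dist (f \<omega>) (h n \<omega>))"
      unfolding vanish_def
    proof (intro allI impI, rule Lim_null_comparison[of _ "\<lambda>n. 1 / real (Suc n)"])
      fix e :: real assume e: "e > 0"
      then obtain N where N: "inverse (real (Suc N)) < e" using reals_Archimedean by blast
      show "eventually (\<lambda>n. norm (prob {\<omega>\<in>space M. e < dist (f \<omega>) (h n \<omega>)}) \<le> 1 / real (Suc n)) sequentially"
        unfolding eventually_sequentially
      proof (intro exI[of _ N] allI impI)
        fix n assume "n \<ge> N"
        then have "1 / real (Suc n) \<le> 1 / real (Suc N)" by (intro divide_left_mono) auto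
        with N have "1 / real (Suc n) \<le> e" by (simp add: inverse_eq_divide)
        from dist_prob_mono[OF fM hM this] h(2)[of n]
        show "norm (prob {\<omega>\<in>space M. e < dist (f \<omega>) (h n \<omega>)}) \<le> 1 / real (Suc n)"
          unfolding real_norm_def abs_of_nonneg[OF measure_nonneg] by (rule order_trans[OF _ less_imp_le])
      qed
      show "(\<lambda>n. 1 / real (Suc n)) \<longlonglongrightarrow> 0"
        using LIMSEQ_inverse_real_of_nat by (simp add: inverse_eq_divide)
    qed
    then have err: "vanish M (\<lambda>n \<omega>. norm (Z T \<omega>) * dist (f \<omega>) (h n \<omega>))"
      by (intro vanish_mult) auto
    have "\<forall>n. \<exists>\<eta>. (\<forall>t<T. \<eta> t \<in> borel_measurable (F t)) \<and> (AE \<omega> in M. Z T \<omega> \<bullet> h n \<omega> \<le> stoch_int \<eta> Z T \<omega>)"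
    proof
      fix n
      obtain a c where a: "h n = (\<lambda>\<omega>. a \<omega> - c *\<^sub>R X \<omega>)" "a \<in> A" "0 \<le> c"
        using h(1)[of n] by (auto simp: cone_adjoin_neg_def)
      obtain \<xi> where \<xi>: "\<And>t. t \<le> T \<Longrightarrow> \<xi> t \<in> borel_measurable (F t)"
        "\<And>t \<omega> z. t \<le> T \<Longrightarrow> \<omega> \<in> space M \<Longrightarrow> z \<in> polar_cone (G t) \<omega> \<Longrightarrow> z \<bullet> \<xi> t \<omega> \<le> 0"
        "AE \<omega> in M. a \<omega> = (\<Sum>t\<le>T. \<xi> t \<omega>)"
        by (rule attainable_decompose[OF a(2)]) (rule that)
      \<comment> \<open>Since Z t \<bullet> x t = 0, the correction does not change Z t \<bullet>
        \<xi> t \<le> 0. The bound by a stochastic integral thus holds for a - c X whatever the size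
        of c.\<close>
      define \<zeta> where "\<zeta> t \<omega> = \<xi> t \<omega> - c *\<^sub>R x t \<omega>" for t \<omega>
      define \<eta> where "\<eta> t \<omega> = (\<Sum>s\<le>t. \<zeta> s \<omega>)" for t \<omega>
      have \<zeta>m: "\<zeta> t \<in> borel_measurable (F t)" if "t \<le> T" for t
        unfolding \<zeta>_def using \<xi>(1)[OF that] x(1)[OF that] by measurable
      have "\<forall>t<T. \<eta> t \<in> borel_measurable (F t)"
        unfolding \<eta>_def using \<zeta>m
        by (intro allI impI borel_measurable_sum) (auto intro: filtration_measurable[OF filtration])
      moreover have "AE \<omega> in M. Z T \<omega> \<bullet> h n \<omega> \<le> stoch_int \<eta> Z T \<omega>"
        using \<xi>(3) x(2,3) pol AE_space
      proof eventually_elim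
        case (elim \<omega>)
        have "Z T \<omega> \<bullet> h n \<omega> = Z T \<omega> \<bullet> (\<Sum>t\<le>T. \<zeta> t \<omega>)"
          by (simp add: a(1) elim(1,2) \<zeta>_def sum_subtractf scaleR_sum_right)
        also have "\<dots> = (\<Sum>t\<le>T. Z t \<omega> \<bullet> \<zeta> t \<omega>) + stoch_int \<eta> Z T \<omega>"
          unfolding \<eta>_def by (rule inner_sum_by_parts)
        also have "(\<Sum>t\<le>T. Z t \<omega> \<bullet> \<zeta> t \<omega>) \<le> 0"
          using elim(3,4,5) \<xi>(2) by (intro sum_nonpos) (simp add: \<zeta>_def inner_diff_right)
        finally show ?case by simp
      qed
      ultimately show "\<exists>\<eta>. (\<forall>t<T. \<eta> t \<in> borel_measurable (F t)) \<and> (AE \<omega> in M. Z T \<omega> \<bullet> h n \<omega> \<le> stoch_int \<eta> Z T \<omega>)"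
        by blast
    qed
    from choice[OF this] obtain \<eta> where \<eta>: "\<And>n t. t < T \<Longrightarrow> \<eta> n t \<in> borel_measurable (F t)"
      "\<And>n. AE \<omega> in M. Z T \<omega> \<bullet> h n \<omega> \<le> stoch_int (\<eta> n) Z T \<omega>" by blast
    have IF: "stoch_int (\<eta> n) Z T \<in> borel_measurable (F T)" for n
      by (rule stoch_int_measurable[OF filtration ZF \<eta>(1)]) auto
    have IM [measurable]: "stoch_int (\<eta> n) Z T \<in> borel_measurable M" for n
      using measurable_from_subalg[OF subalg IF] by blast
    \<comment> \<open>Links the limit f to the n-th integral; the error tends to 0 in probability by
      \<open>err\<close>, although Z T may be unbounded.\<close>
    have cmp: "AE \<omega> in M. Z T \<omega> \<bullet> f \<omega> \<le> stoch_int (\<eta> n) Z T \<omega> + norm (Z T \<omega>) * dist (f \<omega>) (h n \<omega>)" for n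
      using \<eta>(2)[of n]
    proof eventually_elim
      case (elim \<omega>)
      have "Z T \<omega> \<bullet> (f \<omega> - h n \<omega>) \<le> norm (Z T \<omega>) * norm (f \<omega> - h n \<omega>)" by (rule norm_cauchy_schwarz)
      with elim show ?case by (simp add: inner_diff_right dist_norm)
    qed
    have Zf: "AE \<omega> in M. 0 \<le> Z T \<omega> \<bullet> f \<omega>"
      using pos fnn
    proof eventually_elim
      case (elim \<omega>)
      then show ?case unfolding inner_vec_def inner_real_def
        by (intro sum_nonneg mult_nonneg_nonneg) (auto simp: less_imp_le)
    qed
    \<comment> \<open>As Z T \<bullet> f is nonnegative, \<open>cmp\<close> bounds the negative part
      of the integral by the error alone.\<close>
    have "vanish M (\<lambda>n \<omega>. - stoch_int (\<eta> n) Z T \<omega>)"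
    proof (rule vanish_mono[OF _ err])
      show "AE \<omega> in M. - stoch_int (\<eta> n) Z T \<omega> \<le> max 0 (norm (Z T \<omega>) * dist (f \<omega>) (h n \<omega>))" for n
        using cmp[of n] Zf by eventually_elim linarith
    qed measurable
    then have vI: "vanish M (\<lambda>n. stoch_int (\<eta> n) Z T)"
      by (intro stoch_int_vanish[OF filtration mart order_refl] \<eta>(1))
    have "vanish M (\<lambda>n \<omega>. Z T \<omega> \<bullet> f \<omega>)"
    proof (rule vanish_le_add[OF _ vI _ err])
      show "AE \<omega> in M. Z T \<omega> \<bullet> f \<omega> \<le> max 0 (stoch_int (\<eta> n) Z T \<omega>) + max 0 (norm (Z T \<omega>) * dist (f \<omega>) (h n \<omega>))" for n
        using cmp[of n] by eventually_elim linarith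
    qed measurable
    then have "AE \<omega> in M. Z T \<omega> \<bullet> f \<omega> \<le> 0"
      by (rule vanish_const) measurable
    with Zf pos fnn have "AE \<omega> in M. f \<omega> = 0"
    proof eventually_elim
      case (elim \<omega>)
      have "(\<Sum>i\<in>UNIV. Z T \<omega> $ i * f \<omega> $ i) = 0"
        using elim(1,4) by (simp add: inner_vec_def)
      then have "\<forall>i\<in>UNIV. Z T \<omega> $ i * f \<omega> $ i = 0"
        using elim(2,3) by (subst (asm) sum_nonneg_eq_0_iff) (auto simp: less_imp_le)
      with elim(2) show ?case by (auto simp: vec_eq_iff) (metis less_irrefl)
    qed
    with fM show ?thesis by (simp add: L0_zero_def)
  qed
  moreover have "L0_zero M \<subseteq> L0_topology M closure_of ?S \<inter> L0_nonneg M"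
  proof -
    have "L0_zero M \<subseteq> A" using no_arbitrage by (auto simp: arbitrage_free_def)
    also have "\<dots> \<subseteq> ?S" by (rule adjoin_superset)
    also have "\<dots> \<subseteq> L0_topology M closure_of ?S"
      using adjoin_measurable[OF X] by (intro closure_of_subset) (simp add: topspace_L0_topology)
    finally show ?thesis by (auto simp: L0_zero_def L0_nonneg_def)
  qed
  ultimately show ?thesis unfolding properly_maximal_def arbitrage_free_def by blast
qed

lemma price_of_properly_maximal:
  assumes X: "X \<in> A" and pm: "properly_maximal M A X"
  shows "\<exists>Z. consistent_price_process M F T G Z \<and>
    integrable M (claim Z X) \<and> pairing M (Z T) X = 0"
proof -
  \<comment> \<open>On this space every measurable nonpositive vector is attainable, as
    \<open>Kreps_Yan\<close> demands.\<close>
  let ?N = "restr_to_subalg M (F T)"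
  let ?S = "cone_adjoin_neg A X"
  define B where "B = L0_topology M closure_of ?S"
  note S = adjoin_measurable[OF X]
  note sub = subalg[OF order_refl]
  have SB: "?S \<subseteq> B" unfolding B_def using S by (intro closure_of_subset) (simp add: topspace_L0_topology)
  then have AB: "A \<subseteq> B" using adjoin_superset by blast
  note B_AE = L0_closure_AE[OF S, folded B_def]
  interpret N: prob_space ?N by (rule prob_space_restr_to_subalg[OF sub prob_space_axioms])
  have Nm: "borel_measurable ?N = (borel_measurable (F T) :: ('a \<Rightarrow> 'c::topological_space) set)"
    using measurable_in_subalg[OF sub] measurable_in_subalg'[OF sub] by blast
  have Nprob: "N.prob E = prob E" if "E \<in> sets (F T)" for E
    using emeasure_restr_to_subalg[OF sub that] by (simp add: measure_def)
  have spF: "space (F T) = space M" using sub by (simp add: subalgebra_def)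
  obtain x where x: "\<And>t. t \<le> T \<Longrightarrow> x t \<in> borel_measurable (F t)" "AE \<omega> in M. X \<omega> = (\<Sum>t\<le>T. x t \<omega>)"
    by (rule attainable_decompose[OF X]) (rule that)
  \<comment> \<open>An \<open>F T\<close>-measurable version of X, which itself is only
    M-measurable.\<close>
  define X' where "X' \<omega> = (\<Sum>t\<le>T. x t \<omega>)" for \<omega>
  have X'm [measurable]: "X' \<in> borel_measurable (F T)"
    unfolding X'_def using x(1) by (intro borel_measurable_sum) (auto intro: filtration_measurable[OF filtration])
  have X'M [measurable]: "X' \<in> borel_measurable M" by (rule measurable_from_subalg[OF sub X'm])
  have XX': "AE \<omega> in M. X' \<omega> = X \<omega>" using x(2) by eventually_elim (simp add: X'_def)
  have Xm: "X \<in> borel_measurable M" using X attainable_measurable by blast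
  have GT: "g \<in> borel_measurable (F T)" if "t \<le> T" "g \<in> G t" for t g
    using generators(2)[OF that(1)] that by (auto intro: filtration_measurable[OF filtration])
  define \<rho> where "\<rho> \<omega> = norm (X' \<omega>) + (\<Sum>t\<le>T. \<Sum>g\<in>G t. norm (g \<omega>))" for \<omega>
  have \<rho>m [measurable]: "\<rho> \<in> borel_measurable (F T)"
    unfolding \<rho>_def using GT X'm by (intro borel_measurable_add borel_measurable_sum borel_measurable_norm) auto
  have \<rho>: "0 \<le> \<rho> \<omega>" "norm (X' \<omega>) \<le> \<rho> \<omega>" for \<omega>
    unfolding \<rho>_def by (auto intro!: add_nonneg_nonneg sum_nonneg)
  have \<rho>g: "norm (g \<omega>) \<le> \<rho> \<omega>" if "t \<le> T" "g \<in> G t" for t g \<omega>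
  proof -
    have "norm (g \<omega>) \<le> (\<Sum>g\<in>G t. norm (g \<omega>))" using that generators(1) by (intro member_le_sum) auto
    also have "\<dots> \<le> (\<Sum>t\<le>T. \<Sum>g\<in>G t. norm (g \<omega>))"
      using that by (intro member_le_sum[of t "{..T}" "\<lambda>t. \<Sum>g\<in>G t. norm (g \<omega>)"]) (auto intro: sum_nonneg)
    finally show ?thesis unfolding \<rho>_def using norm_ge_zero[of "X' \<omega>"] by linarith
  qed
  define \<psi> where "\<psi> \<omega> = 1 / (1 + \<rho> \<omega>)" for \<omega>
  have \<psi>m [measurable]: "\<psi> \<in> borel_measurable (F T)" unfolding \<psi>_def by measurable
  note [measurable] = measurable_from_subalg[OF sub \<psi>m]
  have \<psi>: "0 < \<psi> \<omega>" "\<psi> \<omega> * \<rho> \<omega> \<le> 1" for \<omega>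
    using \<rho>(1)[of \<omega>] by (auto simp: \<psi>_def divide_le_eq_1)
  have \<psi>bound: "norm (\<psi> \<omega> *\<^sub>R v) \<le> 1" if "norm v \<le> \<rho> \<omega>" for v :: "real ^ 'd" and \<omega>
  proof -
    have "norm (\<psi> \<omega> *\<^sub>R v) = \<psi> \<omega> * norm v" using \<psi>(1)[of \<omega>] by simp
    also have "\<dots> \<le> \<psi> \<omega> * \<rho> \<omega>" using that \<psi>(1)[of \<omega>] by (intro mult_left_mono) auto
    finally show ?thesis using \<psi>(2)[of \<omega>] by simp
  qed
  have \<psi>inv: "(1 / \<psi> \<omega>) *\<^sub>R \<psi> \<omega> *\<^sub>R v = v" for v :: "real ^ 'd" and \<omega>
    using \<psi>(1)[of \<omega>] by simp
  \<comment> \<open>The separating functional tests only members of L2. Multiplication by \<psi>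
    brings X' and the generators there; \<psi> being positive and \<open>F T\<close>-measurable, the
    cone properties, closedness and absence of arbitrage carry over.\<close>
  define B' where "B' = {h \<in> borel_measurable ?N. (\<lambda>\<omega>. (1 / \<psi> \<omega>) *\<^sub>R h \<omega>) \<in> B}"
  have B'I: "(\<lambda>\<omega>. \<psi> \<omega> *\<^sub>R f \<omega>) \<in> B'" if f: "f \<in> borel_measurable (F T)" "f \<in> B" for f
    using f unfolding B'_def Nm mem_Collect_eq \<psi>inv by (intro conjI borel_measurable_scaleR \<psi>m) auto
  obtain z where z: "z \<in> L2 ?N" "AE \<omega> in ?N. \<forall>i. 0 < z \<omega> $ i"
    "\<And>b. b \<in> B' \<Longrightarrow> b \<in> L2 ?N \<Longrightarrow> (\<integral>\<omega>. z \<omega> \<bullet> b \<omega> \<partial>?N) \<le> 0"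
  proof (rule N.Kreps_Yan[of B'])
    show "B' \<subseteq> borel_measurable ?N" by (auto simp: B'_def)
    show "(\<lambda>\<omega>. f \<omega> + g \<omega>) \<in> B'" if fg: "f \<in> B'" "g \<in> B'" for f g
    proof -
      have "(\<lambda>\<omega>. (1 / \<psi> \<omega>) *\<^sub>R f \<omega>) \<in> B" "(\<lambda>\<omega>. (1 / \<psi> \<omega>) *\<^sub>R g \<omega>) \<in> B"
        using fg unfolding B'_def by blast+
      from L0_closure_add[OF S adjoin_add this[unfolded B_def], folded B_def]
      have "(\<lambda>\<omega>. (1 / \<psi> \<omega>) *\<^sub>R (f \<omega> + g \<omega>)) \<in> B" unfolding scaleR_add_right by blast
      with fg show ?thesis unfolding B'_def by auto
    qed
    show "(\<lambda>\<omega>. c *\<^sub>R f \<omega>) \<in> B'" if f: "f \<in> B'" "0 \<le> c" for f c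
    proof -
      have "(\<lambda>\<omega>. (1 / \<psi> \<omega>) *\<^sub>R f \<omega>) \<in> B" using f unfolding B'_def by blast
      from L0_closure_scaleR[OF S adjoin_scaleR this[unfolded B_def] f(2), folded B_def]
      have "(\<lambda>\<omega>. (1 / \<psi> \<omega>) *\<^sub>R c *\<^sub>R f \<omega>) \<in> B" unfolding scaleR_scaleR mult.commute[of c] by blast
      with f(1) show ?thesis unfolding B'_def by auto
    qed
    show "f \<in> B'" if f: "f \<in> borel_measurable ?N" "\<And>\<omega> i. f \<omega> $ i \<le> 0" for f
    proof -
      have "(\<lambda>\<omega>. (1 / \<psi> \<omega>) *\<^sub>R f \<omega>) \<in> A"
        using f \<psi>(1) unfolding Nm
        by (intro attainable_nonpos) (auto simp: less_imp_le mult_nonneg_nonpos divide_nonpos_pos)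
      with AB f(1) show ?thesis by (auto simp: B'_def)
    qed
    show "AE \<omega> in ?N. f \<omega> = 0" if f: "f \<in> B'" "AE \<omega> in ?N. \<forall>i. 0 \<le> f \<omega> $ i" for f
    proof -
      have fm [measurable]: "f \<in> borel_measurable (F T)" using f(1) by (simp add: B'_def Nm)
      have fB: "(\<lambda>\<omega>. (1 / \<psi> \<omega>) *\<^sub>R f \<omega>) \<in> B" using f(1) by (simp add: B'_def)
      have "AE \<omega> in M. \<forall>i. 0 \<le> ((1 / \<psi> \<omega>) *\<^sub>R f \<omega>) $ i"
        using AE_restr_to_subalg[OF sub f(2)] by eventually_elim (simp add: \<psi>(1) less_imp_le)
      with fB have "(\<lambda>\<omega>. (1 / \<psi> \<omega>) *\<^sub>R f \<omega>) \<in> L0_zero M"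
        using pm L0_closure_measurable[OF S, folded B_def]
        unfolding properly_maximal_def arbitrage_free_def B_def[symmetric] L0_nonneg_def by blast
      then have "AE \<omega> in M. f \<omega> = 0"
        using \<psi>(1) by (auto simp: L0_zero_def less_imp_neq[THEN not_sym])
      then show ?thesis by (rule AE_restr_to_subalg2[OF sub]) measurable
    qed
    show "f \<in> B'" if f: "f \<in> borel_measurable ?N"
      and c: "\<And>e. e > 0 \<Longrightarrow> \<exists>g\<in>B'. N.prob {\<omega>\<in>space ?N. dist (f \<omega>) (g \<omega>) > e} < e" for f
    proof -
      have fm [measurable]: "f \<in> borel_measurable (F T)" using f by (simp add: Nm)
      have fM [measurable]: "f \<in> borel_measurable M" by (rule measurable_from_subalg[OF sub fm])
      have "(\<lambda>\<omega>. (1 / \<psi> \<omega>) *\<^sub>R f \<omega>) \<in> B"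
      proof (rule L0_closure_closed[OF S, folded B_def])
        fix e :: real assume e: "e > 0"
        \<comment> \<open>Division by \<psi> is unbounded but continuous in probability: off a set
          of probability below e / 2 it multiplies distances by at most k, which the choice of r
          absorbs.\<close>
        obtain k :: nat where k: "prob {\<omega>\<in>space M. real k < \<bar>1 / \<psi> \<omega>\<bar>} < e / 2"
          using measure_tail[of "\<lambda>\<omega>. 1 / \<psi> \<omega>" "e / 2"] e by auto
        define r where "r = min (e / 2) (e / (real k + 1))"
        have r: "r > 0" using e by (simp add: r_def)
        obtain g where g: "g \<in> B'" "N.prob {\<omega>\<in>space ?N. dist (f \<omega>) (g \<omega>) > r} < r"
          using c[OF r] by blast
        have gm [measurable]: "g \<in> borel_measurable (F T)" using g(1) by (simp add: B'_def Nm)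
        have gM [measurable]: "g \<in> borel_measurable M" by (rule measurable_from_subalg[OF sub gm])
        let ?E = "{\<omega>\<in>space M. real k < \<bar>1 / \<psi> \<omega>\<bar>}" and ?D = "{\<omega>\<in>space M. dist (f \<omega>) (g \<omega>) > r}"
        have "{\<omega>\<in>space (F T). dist (f \<omega>) (g \<omega>) > r} \<in> sets (F T)" by measurable
        then have "prob ?D < r" using g(2) Nprob[of ?D] by (simp add: spF space_restr_to_subalg)
        then have D: "prob ?D < e / 2" by (simp add: r_def)
        have "prob {\<omega>\<in>space M. dist ((1 / \<psi> \<omega>) *\<^sub>R f \<omega>) ((1 / \<psi> \<omega>) *\<^sub>R g \<omega>) > e} \<le> prob (?E \<union> ?D)"
        proof (intro finite_measure_mono subsetI)
          fix \<omega> assume w: "\<omega> \<in> {\<omega>\<in>space M. dist ((1 / \<psi> \<omega>) *\<^sub>R f \<omega>) ((1 / \<psi> \<omega>) *\<^sub>R g \<omega>) > e}"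
          show "\<omega> \<in> ?E \<union> ?D"
          proof (rule ccontr)
            assume "\<omega> \<notin> ?E \<union> ?D"
            with w have le: "\<bar>1 / \<psi> \<omega>\<bar> \<le> real k + 1" "dist (f \<omega>) (g \<omega>) \<le> e / (real k + 1)"
              by (auto simp: not_less r_def)
            have "dist ((1 / \<psi> \<omega>) *\<^sub>R f \<omega>) ((1 / \<psi> \<omega>) *\<^sub>R g \<omega>) = \<bar>1 / \<psi> \<omega>\<bar> * dist (f \<omega>) (g \<omega>)"
              unfolding dist_norm scaleR_diff_right[symmetric] norm_scaleR ..
            also have "\<dots> \<le> (real k + 1) * (e / (real k + 1))" using le by (intro mult_mono) auto
            also have "\<dots> = e" by simp
            finally show False using w by simp
          qed
        qed measurable
        also have "\<dots> \<le> prob ?E + prob ?D" by (intro measure_Un_le) measurable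
        also have "\<dots> < e" using k D by simp
        finally show "\<exists>h\<in>B. prob {\<omega>\<in>space M. dist ((1 / \<psi> \<omega>) *\<^sub>R f \<omega>) (h \<omega>) > e} < e"
          using g(1) by (intro bexI[of _ "\<lambda>\<omega>. (1 / \<psi> \<omega>) *\<^sub>R g \<omega>"]) (auto simp: B'_def)
      qed measurable
      with f show ?thesis by (simp add: B'_def)
    qed
  qed (rule that)
  have zm [measurable]: "z \<in> borel_measurable (F T)" using L2_measurable[OF z(1)] by (simp add: Nm)
  have zM [measurable]: "z \<in> borel_measurable M" by (rule measurable_from_subalg[OF sub zm])
  have zi: "integrable M z" by (rule integrable_from_subalg[OF sub N.L2_L1(1)[OF z(1) zero_less_one]])
  have zpos: "AE \<omega> in M. \<forall>i. 0 < z \<omega> $ i" by (rule AE_restr_to_subalg[OF sub z(2)])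
  have \<psi>z: "integrable M (\<lambda>\<omega>. z \<omega> \<bullet> (\<psi> \<omega> *\<^sub>R v \<omega>))"
    "(\<lambda>\<omega>. \<psi> \<omega> *\<^sub>R v \<omega>) \<in> L2 ?N"
    "(\<integral>\<omega>. z \<omega> \<bullet> (\<psi> \<omega> *\<^sub>R v \<omega>) \<partial>?N) = (\<integral>\<omega>. z \<omega> \<bullet> (\<psi> \<omega> *\<^sub>R v \<omega>) \<partial>M)"
    if [measurable]: "v \<in> borel_measurable (F T)" and "\<And>\<omega>. norm (v \<omega>) \<le> \<rho> \<omega>" for v
  proof -
    show "(\<lambda>\<omega>. \<psi> \<omega> *\<^sub>R v \<omega>) \<in> L2 ?N"
      by (rule N.L2_bounded[of _ 1]) (auto simp only: Nm intro!: \<psi>bound that borel_measurable_scaleR \<psi>m)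
    from integrable_from_subalg[OF sub L2_inner[OF z(1) this]]
    show "integrable M (\<lambda>\<omega>. z \<omega> \<bullet> (\<psi> \<omega> *\<^sub>R v \<omega>))" .
    show "(\<integral>\<omega>. z \<omega> \<bullet> (\<psi> \<omega> *\<^sub>R v \<omega>) \<partial>?N) = (\<integral>\<omega>. z \<omega> \<bullet> (\<psi> \<omega> *\<^sub>R v \<omega>) \<partial>M)"
      by (rule integral_subalgebra2[OF sub]) measurable
  qed
  have dual: "(\<integral>\<omega>. z \<omega> \<bullet> (\<psi> \<omega> *\<^sub>R v \<omega>) \<partial>M) \<le> 0"
    if "v \<in> borel_measurable (F T)" "\<And>\<omega>. norm (v \<omega>) \<le> \<rho> \<omega>" "v \<in> B" for v
    using z(3)[OF B'I[OF that(1,3)] \<psi>z(2)[OF that(1,2)]] \<psi>z(3)[OF that(1,2)] by simp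
  \<comment> \<open>Undoes the rescaling by moving \<psi> from the claim to the functional: z
    \<bullet> (\<psi> f) = (\<psi> z) \<bullet> f. Thus \<psi> z is the terminal price.\<close>
  define Y where "Y i \<omega> = \<psi> \<omega> * z \<omega> $ i" for i \<omega>
  define Z where "Z t \<omega> = (\<Sum>i\<in>UNIV. real_cond_exp M (F t) (Y i) \<omega> *\<^sub>R (axis i 1 :: real ^ 'd))" for t \<omega>
  have Zi: "Z t \<omega> $ i = real_cond_exp M (F t) (Y i) \<omega>" for t \<omega> i
    by (simp add: Z_def axis_def if_distrib cong: if_cong)
  have compz [measurable]: "(\<lambda>\<omega>. z \<omega> $ i) \<in> borel_measurable (F T)" for i by (simp add: cart_eq_inner_axis)
  have Ym [measurable]: "Y i \<in> borel_measurable (F T)" for i unfolding Y_def by measurable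
  have \<psi>1: "\<psi> \<omega> \<le> 1" for \<omega> using \<rho>(1)[of \<omega>] by (simp add: \<psi>_def)
  have Yi: "integrable M (Y i)" for i
  proof (rule Bochner_Integration.integrable_bound[OF zi])
    show "AE \<omega> in M. norm (Y i \<omega>) \<le> norm (z \<omega>)"
    proof (intro AE_I2)
      fix \<omega>
      have "norm (Y i \<omega>) \<le> 1 * norm (z \<omega>)"
        unfolding Y_def real_norm_def abs_mult
        using \<psi>(1)[of \<omega>] \<psi>1[of \<omega>] component_le_norm_cart[of "z \<omega>" i] by (intro mult_mono) auto
      then show "norm (Y i \<omega>) \<le> norm (z \<omega>)" by simp
    qed
  qed (rule measurable_from_subalg[OF sub Ym])
  have ZTeq: "AE \<omega> in M. Z T \<omega> = \<psi> \<omega> *\<^sub>R z \<omega>"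
  proof -
    interpret FT: finite_measure_subalgebra M "F T" by (rule filtration_subalgebra[OF filtration order_refl])
    have "AE \<omega> in M. \<forall>i\<in>UNIV. real_cond_exp M (F T) (Y i) \<omega> = Y i \<omega>"
      by (intro AE_finite_allI FT.real_cond_exp_F_meas Yi Ym) simp
    then show ?thesis by eventually_elim (simp add: vec_eq_iff Zi Y_def)
  qed
  have mart: "is_martingale M F T Z"
    unfolding is_martingale_def
  proof (intro conjI allI impI ballI)
    fix t assume t: "t \<le> T"
    interpret Ft: finite_measure_subalgebra M "F t" by (rule filtration_subalgebra[OF filtration t])
    show "Z t \<in> borel_measurable (F t)" unfolding Z_def by measurable
    show "integrable M (Z t)"
      unfolding Z_def by (intro Bochner_Integration.integrable_sum integrable_scaleR_left Ft.real_cond_exp_int(1) Yi)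
  next
    fix s t and b :: "real ^ 'd" assume st: "s \<le> t \<and> t \<le> T" and b: "b \<in> Basis"
    interpret Fs: finite_measure_subalgebra M "F s" using filtration_subalgebra[OF filtration] st by simp
    obtain i where i: "b = axis i 1" using b by (auto simp: Basis_vec_def)
    have "AE \<omega> in M. real_cond_exp M (F s) (real_cond_exp M (F t) (Y i)) \<omega> = real_cond_exp M (F s) (Y i) \<omega>"
      using filtration st by (intro Fs.real_cond_exp_nested_subalg Yi) (auto simp: discrete_filtration_def)
    then show "AE \<omega> in M. real_cond_exp M (F s) (\<lambda>\<omega>. Z t \<omega> \<bullet> b) \<omega> = Z s \<omega> \<bullet> b"
      by (simp add: i inner_axis Zi)
  qed
  have polar: "AE \<omega> in M. Z t \<omega> \<bullet> g \<omega> \<le> 0" if t: "t \<le> T" and g: "g \<in> G t" for t g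
  proof -
    interpret Ft: finite_measure_subalgebra M "F t" by (rule filtration_subalgebra[OF filtration t])
    note gF [measurable] = GT[OF t g]
    have gm [measurable]: "g \<in> borel_measurable (F t)" using generators(2)[OF t] g by blast
    have eq: "z \<omega> \<bullet> (\<psi> \<omega> *\<^sub>R g \<omega>) = (\<Sum>i\<in>UNIV. g \<omega> $ i * Y i \<omega>)" for \<omega>
      by (simp add: inner_vec_def Y_def sum_distrib_left mult_ac)
    have gi: "integrable M (\<lambda>\<omega>. \<Sum>i\<in>UNIV. g \<omega> $ i * Y i \<omega>)"
      using \<psi>z(1)[OF gF \<rho>g[OF t g]] unfolding eq .
    have gc: "(\<lambda>\<omega>. g \<omega> $ i) \<in> borel_measurable (F t)" for i by (simp add: cart_eq_inner_axis)
    have "AE \<omega> in M. real_cond_exp M (F t) (\<lambda>\<omega>. \<Sum>i\<in>UNIV. g \<omega> $ i * Y i \<omega>) \<omega>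
        = (\<Sum>i\<in>UNIV. g \<omega> $ i * real_cond_exp M (F t) (Y i) \<omega>)"
      by (rule Ft.real_cond_exp_sum_mult) (use gi gc Yi in simp_all)
    moreover have "AE \<omega> in M. real_cond_exp M (F t) (\<lambda>\<omega>. \<Sum>i\<in>UNIV. g \<omega> $ i * Y i \<omega>) \<omega> \<le> 0"
    proof (rule Ft.real_cond_exp_nonpos)
      show "integrable M (\<lambda>\<omega>. \<Sum>i\<in>UNIV. g \<omega> $ i * Y i \<omega>)" by (rule gi)
      fix E assume E [measurable]: "E \<in> sets (F t)"
      \<comment> \<open>Trading g on an event known at t is attainable. Its nonpositive price on all
        such events amounts to the conditional inequality, that is, to Z t lying in the
        polar.\<close>
      let ?v = "\<lambda>\<omega>. (indicator E \<omega> :: real) *\<^sub>R g \<omega>"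
      have "?v \<in> A" by (rule attainable_ray[OF t g]) auto
      moreover have "?v \<in> borel_measurable (F t)" by measurable
      then have "?v \<in> borel_measurable (F T)" by (rule filtration_measurable[OF filtration t order_refl])
      moreover have "norm (?v \<omega>) \<le> \<rho> \<omega>" for \<omega>
        using \<rho>g[OF t g, of \<omega>] \<rho>(1)[of \<omega>] by (simp add: indicator_def)
      ultimately have "(\<integral>\<omega>. z \<omega> \<bullet> (\<psi> \<omega> *\<^sub>R ?v \<omega>) \<partial>M) \<le> 0" using AB by (intro dual) auto
      also have "(\<lambda>\<omega>. z \<omega> \<bullet> (\<psi> \<omega> *\<^sub>R ?v \<omega>)) = (\<lambda>\<omega>. indicator E \<omega> * (\<Sum>i\<in>UNIV. g \<omega> $ i * Y i \<omega>))"
        by (auto simp: eq[symmetric] fun_eq_iff indicator_def)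
      finally show "(\<integral>\<omega>. indicator E \<omega> * (\<Sum>i\<in>UNIV. g \<omega> $ i * Y i \<omega>) \<partial>M) \<le> 0" .
    qed
    ultimately show ?thesis
      by eventually_elim (simp add: inner_vec_def Zi mult.commute)
  qed
  have cpp: "consistent_price_process M F T G Z"
    unfolding consistent_price_process_def
  proof (intro conjI mart allI impI)
    fix t assume t: "t \<le> T"
    interpret Ft: finite_measure_subalgebra M "F t" by (rule filtration_subalgebra[OF filtration t])
    have "AE \<omega> in M. \<forall>g\<in>G t. Z t \<omega> \<bullet> g \<omega> \<le> 0"
      by (intro AE_finite_allI generators t polar)
    moreover have "AE \<omega> in M. 0 < real_cond_exp M (F t) (Y i) \<omega>" for i
      by (rule Ft.real_cond_exp_gr_c[OF Yi]) (use zpos in \<open>auto simp: Y_def \<psi>(1) elim!: eventually_mono\<close>)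
    \<comment> \<open>One positive coordinate suffices, and \<open>undefined\<close> is an arbitrary
      index.\<close>
    from this[of undefined] have "AE \<omega> in M. Z t \<omega> \<noteq> 0"
    proof eventually_elim
      case (elim \<omega>)
      then have "Z t \<omega> $ undefined \<noteq> 0" by (simp add: Zi)
      then show ?case by (metis zero_index)
    qed
    ultimately show "AE \<omega> in M. Z t \<omega> \<in> polar_cone (G t) \<omega> - {0}"
      by eventually_elim (auto simp: polar_cone_def)
  qed
  have ZX: "AE \<omega> in M. Z T \<omega> \<bullet> X \<omega> = z \<omega> \<bullet> (\<psi> \<omega> *\<^sub>R X' \<omega>)"
    using ZTeq XX' by eventually_elim simp
  have ZTM [measurable]: "Z T \<in> borel_measurable M"
    using mart by (auto simp: is_martingale_def)
  note Xm [measurable]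
  \<comment> \<open>Both signs of X lie in the closed cone, so its price is at most 0 and at least
    0. The version X' enters because \<open>dual\<close> needs \<open>F T\<close>-measurability and
    the pointwise bound by \<rho>.\<close>
  have XB: "X \<in> B" "(\<lambda>\<omega>. - X \<omega>) \<in> B" using X AB SB adjoin_neg by auto
  have X'B: "X' \<in> B" by (rule B_AE[OF XB(1) X'M XX'])
  have X'B2: "(\<lambda>\<omega>. - X' \<omega>) \<in> B" by (rule B_AE[OF XB(2)]) (use XX' in auto)
  have "(\<integral>\<omega>. z \<omega> \<bullet> (\<psi> \<omega> *\<^sub>R - X' \<omega>) \<partial>M) \<le> 0" using \<rho>(2) by (intro dual X'B2) auto
  moreover have "(\<integral>\<omega>. z \<omega> \<bullet> (\<psi> \<omega> *\<^sub>R X' \<omega>) \<partial>M) \<le> 0" by (rule dual[OF X'm \<rho>(2) X'B])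
  ultimately have "(\<integral>\<omega>. z \<omega> \<bullet> (\<psi> \<omega> *\<^sub>R X' \<omega>) \<partial>M) = 0" by simp
  moreover have "pairing M (Z T) X = (\<integral>\<omega>. z \<omega> \<bullet> (\<psi> \<omega> *\<^sub>R X' \<omega>) \<partial>M)"
    by (rule integral_cong_AE[OF _ _ ZX]) measurable
  moreover have "integrable M (claim Z X)"
    by (rule integrable_cong_AE_imp[OF \<psi>z(1)[OF X'm \<rho>(2)]]) (use ZX in \<open>auto elim!: eventually_mono\<close>)
  ultimately show ?thesis using cpp by (intro exI[of _ Z]) simp
qed

end

section \<open>The value process under equivalent measures\<close>

lemma martingale_real_cond_exp:
  fixes C :: "'a \<Rightarrow> real"
  assumes "finite_measure M" and F: "discrete_filtration M F T" and C: "integrable M C"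
    and V: "\<And>t. t \<le> T \<Longrightarrow> V t \<in> borel_measurable (F t)"
    and eq: "\<And>t. t \<le> T \<Longrightarrow> AE \<omega> in M. V t \<omega> = real_cond_exp M (F t) C \<omega>"
  shows "is_martingale M F T V"
proof -
  interpret finite_measure M by fact
  have VM [measurable]: "V t \<in> borel_measurable M" if "t \<le> T" for t
    using F that by (intro measurable_from_subalg[OF _ V]) (auto simp: discrete_filtration_def)
  show ?thesis
    unfolding is_martingale_def
  proof (intro conjI allI impI ballI V)
    fix t assume t: "t \<le> T"
    interpret Ft: finite_measure_subalgebra M "F t" by (rule filtration_subalgebra[OF F t])
    show "integrable M (V t)"
      by (rule integrable_cong_AE_imp[OF Ft.real_cond_exp_int(1)[OF C] VM[OF t] AE_symmetric[OF eq[OF t]]])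
  next
    fix s t and b :: real assume st: "s \<le> t \<and> t \<le> T" and "b \<in> Basis"
    then have b: "b = 1" by simp
    interpret Fs: finite_measure_subalgebra M "F s" using filtration_subalgebra[OF F] st by simp
    have "AE \<omega> in M. real_cond_exp M (F s) (V t) \<omega> = real_cond_exp M (F s) (real_cond_exp M (F t) C) \<omega>"
      using st by (intro Fs.real_cond_exp_cong eq VM) auto
    moreover have "AE \<omega> in M. real_cond_exp M (F s) (real_cond_exp M (F t) C) \<omega> = real_cond_exp M (F s) C \<omega>"
      using F st by (intro Fs.real_cond_exp_nested_subalg C) (auto simp: discrete_filtration_def)
    moreover have "AE \<omega> in M. V s \<omega> = real_cond_exp M (F s) C \<omega>" using st by (intro eq) simp
    ultimately show "AE \<omega> in M. real_cond_exp M (F s) (\<lambda>\<omega>. V t \<omega> \<bullet> b) \<omega> = V s \<omega> \<bullet> b"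
      unfolding b inner_real_def mult_1_right by eventually_elim simp
  qed
qed

context reduced_market
begin

text \<open>The integrand comes from a decomposition of X fixed before any Q is considered.
  Equivalent measures share null sets, so the terms Z t \<bullet> x t vanish under Q too and the
  claim equals the same integral at T, now taken under a measure for which Z is a
  martingale.\<close>

lemma value_process_eq_stoch_int:
  assumes X: "X \<in> A" and Z: "consistent_price_process M F T G Z"
    and int: "integrable M (claim Z X)" "pairing M (Z T) X = 0"
  obtains \<eta> where "\<And>Q t. Q \<in> pricing_measures M F T Z (claim Z X) \<Longrightarrow> t \<le> T \<Longrightarrow>
    AE \<omega> in M. value_process Q F (claim Z X) t \<omega> = stoch_int \<eta> Z t \<omega>"
proof -
  have mart: "is_martingale M F T Z" using Z by (simp add: consistent_price_process_def)
  obtain x where x: "\<And>t. t \<le> T \<Longrightarrow> x t \<in> borel_measurable (F t)"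
    "AE \<omega> in M. X \<omega> = (\<Sum>t\<le>T. x t \<omega>)" "AE \<omega> in M. \<forall>t\<le>T. Z t \<omega> \<bullet> x t \<omega> = 0"
    by (rule price_zero_decomposition[OF X Z int]) (rule that)
  have xle: "AE \<omega> in M. Z t \<omega> \<bullet> x t \<omega> \<le> 0" if "t \<le> T" for t
    using x(3) by eventually_elim (use that in simp)
  let ?I = "stoch_int (\<lambda>t \<omega>. \<Sum>s\<le>t. x s \<omega>) Z"
  have ZX: "AE \<omega> in M. Z T \<omega> \<bullet> X \<omega> = ?I T \<omega>"
    using x(2,3) by eventually_elim (simp add: inner_sum_by_parts)
  show ?thesis
  proof (rule that)
    fix Q t assume Q: "Q \<in> pricing_measures M F T Z (claim Z X)" and t: "t \<le> T"
    then have ps: "prob_space Q" and sets: "sets Q = sets M" and ac: "absolutely_continuous M Q" "absolutely_continuous Q M"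
      and martQ: "is_martingale Q F T Z" and intQ: "integrable Q (claim Z X)"
      by (auto simp: pricing_measures_def equivalent_martingale_measures_def)
    interpret Q: prob_space Q by (rule ps)
    have MQ: "AE \<omega> in Q. P \<omega>" if "AE \<omega> in M. P \<omega>" for P
      by (rule absolutely_continuous_AE[OF sets ac(1) that])
    have QM: "AE \<omega> in M. P \<omega>" if "AE \<omega> in Q. P \<omega>" for P
      by (rule absolutely_continuous_AE[OF sets[symmetric] ac(2) that])
    have filtQ: "discrete_filtration Q F T"
      using filtration sets sets_eq_imp_space_eq[OF sets] by (simp add: discrete_filtration_def subalgebra_def)
    note I = Q.price_decomposition(1,2)[OF filtQ martQ x(1) MQ[OF xle] MQ[OF x(2)] intQ]
    interpret Ft: finite_measure_subalgebra Q "F t" by (rule Q.filtration_subalgebra[OF filtQ t])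
    have "AE \<omega> in Q. real_cond_exp Q (F t) (claim Z X) \<omega> = real_cond_exp Q (F t) (?I T) \<omega>"
      using MQ[OF ZX] borel_measurable_integrable[OF intQ] borel_measurable_integrable[OF I(1)]
      by (intro Ft.real_cond_exp_cong) auto
    moreover have "AE \<omega> in Q. real_cond_exp Q (F t) (?I T) \<omega> = ?I t \<omega>" using I(2) t by auto
    ultimately have "AE \<omega> in Q. value_process Q F (claim Z X) t \<omega> = ?I t \<omega>"
      unfolding value_process_def by eventually_elim simp
    then show "AE \<omega> in M. value_process Q F (claim Z X) t \<omega> = ?I t \<omega>" by (rule QM)
  qed
qed

lemma value_process_uniform:
  assumes X: "X \<in> A" and Z: "consistent_price_process M F T G Z"
    and int: "integrable M (claim Z X)" "pairing M (Z T) X = 0"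
    and Q: "Q \<in> pricing_measures M F T Z (claim Z X)"
    and Q': "Q' \<in> pricing_measures M F T Z (claim Z X)"
  shows "t \<le> T \<Longrightarrow> AE \<omega> in M. value_process Q F (claim Z X) t \<omega> = value_process Q' F (claim Z X) t \<omega>"
    and "is_martingale Q' F T (value_process Q F (claim Z X))"
proof -
  obtain \<eta> where \<eta>: "\<And>Q t. Q \<in> pricing_measures M F T Z (claim Z X) \<Longrightarrow> t \<le> T \<Longrightarrow>
    AE \<omega> in M. value_process Q F (claim Z X) t \<omega> = stoch_int \<eta> Z t \<omega>"
    by (rule value_process_eq_stoch_int[OF X Z int]) (rule that)
  show eq: "AE \<omega> in M. value_process Q F (claim Z X) t \<omega> = value_process Q' F (claim Z X) t \<omega>"
    if "t \<le> T" for t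
    using \<eta>[OF Q that] \<eta>[OF Q' that] by eventually_elim simp
  have ps: "prob_space Q'" and sets: "sets Q' = sets M" and ac: "absolutely_continuous M Q'"
    and intQ: "integrable Q' (claim Z X)"
    using Q' by (auto simp: pricing_measures_def equivalent_martingale_measures_def)
  interpret Q': prob_space Q' by (rule ps)
  show "is_martingale Q' F T (value_process Q F (claim Z X))"
  \<comment> \<open>The process is computed under Q but tested under Q'; by \<open>eq\<close> it is
    a version of the conditional expectations under Q', adapted since any
    \<open>real_cond_exp\<close> given \<open>F t\<close> is \<open>F t\<close>-measurable.\<close>
  proof (rule martingale_real_cond_exp[OF Q'.finite_measure_axioms _ intQ])
    show "discrete_filtration Q' F T"
      using filtration sets sets_eq_imp_space_eq[OF sets] by (simp add: discrete_filtration_def subalgebra_def)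
    show "value_process Q F (claim Z X) t \<in> borel_measurable (F t)" for t
      unfolding value_process_def by measurable
    show "AE \<omega> in Q'. value_process Q F (claim Z X) t \<omega> = real_cond_exp Q' (F t) (claim Z X) \<omega>"
      if "t \<le> T" for t
      using absolutely_continuous_AE[OF sets ac eq[OF that]] by (simp add: value_process_def)
  qed
qed

end

theorem theorem2p9:
  fixes M :: "'a measure" and F :: "nat \<Rightarrow> 'a measure" and T :: nat
    and \<pi> :: "nat \<Rightarrow> 'a \<Rightarrow> real ^ 'd ^ 'd"
    and G :: "nat \<Rightarrow> ('a \<Rightarrow> real ^ 'd) set"
    and X :: "'a \<Rightarrow> real ^ 'd"
  assumes "prob_space M"
    and "discrete_filtration M F T"
    and "bid_ask_process M F T \<pi>"
    and "closedin (L0_topology M) (attainable M F T \<pi>)"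
    and "arbitrage_free M (attainable M F T \<pi>)"
    and "reduced_generators M F T \<pi> G"
    and "X \<in> attainable M F T \<pi>"
  shows "((\<exists>Z. consistent_price_process M F T G Z \<and>
              integrable M (\<lambda>\<omega>. Z T \<omega> \<bullet> X \<omega>) \<and> (\<integral>\<omega>. Z T \<omega> \<bullet> X \<omega> \<partial>M) = 0)
            \<longleftrightarrow> properly_maximal M (attainable M F T \<pi>) X) \<and>
         (\<forall>Z. properly_maximal M (attainable M F T \<pi>) X \<and>
              consistent_price_process M F T G Z \<and>
              integrable M (\<lambda>\<omega>. Z T \<omega> \<bullet> X \<omega>) \<and> (\<integral>\<omega>. Z T \<omega> \<bullet> X \<omega> \<partial>M) = 0 \<longrightarrow>
            (\<forall>Q \<in> pricing_measures M F T Z (\<lambda>\<omega>. Z T \<omega> \<bullet> X \<omega>).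
             \<forall>Q' \<in> pricing_measures M F T Z (\<lambda>\<omega>. Z T \<omega> \<bullet> X \<omega>).
               (\<forall>t\<le>T. AE \<omega> in M. value_process Q F (\<lambda>\<omega>. Z T \<omega> \<bullet> X \<omega>) t \<omega>
                              = value_process Q' F (\<lambda>\<omega>. Z T \<omega> \<bullet> X \<omega>) t \<omega>) \<and>
               is_martingale Q' F T (value_process Q F (\<lambda>\<omega>. Z T \<omega> \<bullet> X \<omega>))))"
proof -
  interpret reduced_market M F T \<pi> G
    using assms(1,2,3,5,6) by (simp add: reduced_market_def reduced_market_axioms_def)
  show ?thesis
    using properly_maximal_of_price price_of_properly_maximal value_process_uniform assms(7)
    by (intro conjI iffI allI impI ballI) blast+
qed

end
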